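(* Let $A$ be a finite set, let $L$ be a regular language over a finite alphabet $\Sigma\subseteq\mathbb Z^A$, let $M\in M_A(\mathbb Z)$ be an irreducible Pisot unimodular matrix, and let $\pi$ be the projection onto a hyperplane $\mathcal P$ of $\mathbb R^A$ along the eigenspace of $M$ for its maximal eigenvalue $\beta$. Then the language $$\overset{\circ}{L}:=\{u\in L:\ Q_u\in\overset{\circ}{Q}_L\}$$ is regular and satisfies $Q_{\overset{\circ}{L}}=\overset{\circ}{Q}_L$. Moreover, $\overset{\circ}{L}$ is computable from $L$ (there is an algorithm that, from $M$ and a finite automaton recognizing $L$, produces a finite automaton recognizing $\overset{\circ}{L}$).
   Context: Irreducible Pisot unimodular matrix: an integer matrix with determinant $\pm1$ whose characteristic polynomial is irreducible over $\mathbb Q$ and whose maximal eigenvalue $\beta$ is a Pisot number (an algebraic integer $>1$ all of whose other conjugates have modulus $<1$). For a word $u=u_0u_1\cdots u_{n-1}$ over $\Sigma\subseteq\mathbb Z^A$, $Q_u=Q_{u,M}=\sum_{i=0}^{n-1}M^iu_i\in\mathbb Z^A$ ; for a language $L$ over $\Sigma$, $Q_L=Q_{L,M}=\{Q_u:u\in L\}$. A language is regular if it is recognized by a finite automaton. Topology: for $U\subseteq\mathcal P$ put $Q_U=\{x\in\mathbb N^A:\pi(x)\in U\}$. The open sets of $\mathbb N^A$ are the sets $Q_U$ with $U$ open in $\mathcal P$. For $P\subseteq\mathbb Z^A$, $\overset{\circ}{P}$ denotes its interior for this topology, i.e. the union of all $Q_U$, $U$ open in $\mathcal P$, with $Q_U\subseteq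 P$. *)

theory Defs
  imports
    "HOL-Analysis.Abstract_Euclidean_Space"
    "HOL-Library.Nat_Bijection"
    "Jordan_Normal_Form.Char_Poly"
begin

text \<open>
  The finite index set is \<open>A = {0..<d}\<close>: integer (real) vectors indexed by \<open>A\<close> are the elements of
  \<open>carrier_vec d\<close>, and matrices in \<open>M\<^sub>A(Z)\<close> those of \<open>carrier_mat d d\<close>. The dimension is a number
  and not a type, so that a single algorithm can serve all dimensions.
\<close>

section \<open>Irreducible Pisot unimodular matrices\<close>

text \<open>\<open>z\<close> is a root of the minimal polynomial of \<open>\<beta>\<close> over the rationals.\<close>

definition rat_conjugate :: "real \<Rightarrow> complex \<Rightarrow> bool" where
  "rat_conjugate \<beta> z \<longleftrightarrow>
     (\<exists>p :: rat poly. irreducible p \<and> poly (map_poly of_rat p) \<beta> = 0 \<and> poly (map_poly of_rat p) z = 0)"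

definition pisot_number :: "real \<Rightarrow> bool" where
  "pisot_number \<beta> \<longleftrightarrow> algebraic_int \<beta> \<and> \<beta> > 1 \<and>
     (\<forall>z. rat_conjugate \<beta> z \<and> z \<noteq> complex_of_real \<beta> \<longrightarrow> cmod z < 1)"

definition maximal_eigenvalue :: "int mat \<Rightarrow> real \<Rightarrow> bool" where
  "maximal_eigenvalue M \<beta> \<longleftrightarrow> eigenvalue (map_mat real_of_int M) \<beta> \<and>
     (\<forall>z. eigenvalue (map_mat complex_of_int M) z \<longrightarrow> cmod z \<le> \<beta>)"

definition irreducible_pisot_unimodular :: "nat \<Rightarrow> int mat \<Rightarrow> bool" where
  "irreducible_pisot_unimodular d M \<longleftrightarrow>
     M \<in> carrier_mat d d \<and> det M \<in> {1, - 1} \<and>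
     irreducible (char_poly (map_mat rat_of_int M)) \<and>
     (\<exists>\<beta>. maximal_eigenvalue M \<beta> \<and> pisot_number \<beta>)"

section \<open>Projection along the maximal eigenspace and the induced topology\<close>

definition eigenspace :: "nat \<Rightarrow> int mat \<Rightarrow> real \<Rightarrow> real vec set" where
  "eigenspace d M \<beta> = {v \<in> carrier_vec d. map_mat real_of_int M *\<^sub>v v = \<beta> \<cdot>\<^sub>v v}"

definition hyperplane :: "nat \<Rightarrow> real vec set \<Rightarrow> bool" where
  "hyperplane d P \<longleftrightarrow>
     (\<exists>a \<in> carrier_vec d. a \<noteq> 0\<^sub>v d \<and> P = {x \<in> carrier_vec d. a \<bullet> x = 0})"

text \<open>The decomposition of \<open>x\<close> into \<open>\<pi> x\<close> and \<open>x - \<pi> x\<close> is unique, because \<open>P\<close> and \<open>E\<close> meet only in 0.\<close>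

definition projection_along ::
    "nat \<Rightarrow> real vec set \<Rightarrow> real vec set \<Rightarrow> (real vec \<Rightarrow> real vec) \<Rightarrow> bool" where
  "projection_along d P E \<pi> \<longleftrightarrow> P \<inter> E = {0\<^sub>v d} \<and>
     (\<forall>x \<in> carrier_vec d. \<pi> x \<in> P \<and> x - \<pi> x \<in> E)"

text \<open>The usual topology of \<open>R\<^sup>d\<close>, transported from \<^const>\<open>Euclidean_space\<close> through coordinates.\<close>

definition real_vec_topology :: "nat \<Rightarrow> real vec topology" where
  "real_vec_topology d =
     pullback_topology (carrier_vec d) (\<lambda>v i. if i < d then v $ i else 0) (Euclidean_space d)"

definition nonneg_vecs :: "nat \<Rightarrow> int vec set" where
  "nonneg_vecs d = {x \<in> carrier_vec d. \<forall>i<d. x $ i \<ge> 0}"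

text \<open>The set \<open>Q\<^sub>U\<close> for \<open>U \<subseteq> P\<close>.\<close>

definition proj_preimage :: "nat \<Rightarrow> (real vec \<Rightarrow> real vec) \<Rightarrow> real vec set \<Rightarrow> int vec set" where
  "proj_preimage d \<pi> U = {x \<in> nonneg_vecs d. \<pi> (map_vec real_of_int x) \<in> U}"

definition proj_interior ::
    "nat \<Rightarrow> real vec set \<Rightarrow> (real vec \<Rightarrow> real vec) \<Rightarrow> int vec set \<Rightarrow> int vec set" where
  "proj_interior d P \<pi> S =
     \<Union> {proj_preimage d \<pi> U | U.
          openin (subtopology (real_vec_topology d) P) U \<and> proj_preimage d \<pi> U \<subseteq> S}"

section \<open>Words, languages and finite automata\<close>

text \<open>The vector \<open>Q\<^sub>u\<close>; the set \<open>Q\<^sub>L\<close> is the image \<open>word_value M ` L\<close>.\<close>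

definition word_value :: "int mat \<Rightarrow> int vec list \<Rightarrow> int vec" where
  "word_value M u =
     finsum_vec TYPE(int) (dim_row M) (\<lambda>i. (M ^\<^sub>m i) *\<^sub>v (u ! i)) {..<length u}"

definition interior_language ::
    "nat \<Rightarrow> int mat \<Rightarrow> real vec set \<Rightarrow> (real vec \<Rightarrow> real vec) \<Rightarrow> int vec list set \<Rightarrow> int vec list set" where
  "interior_language d M P \<pi> L = {u \<in> L. word_value M u \<in> proj_interior d P \<pi> (word_value M ` L)}"

text \<open>
  Nondeterministic finite automata, presented by finite data so that they can be the input and output
  of an algorithm. The states are \<open>0, \<dots>, num_states - 1\<close>.
\<close>

record 'a automaton =
  num_states :: nat
  alphabet :: "'a list"
  initials :: "nat list"
  transitions :: "(nat \<times> 'a \<times> nat) list"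
  finals :: "nat list"

definition automaton_over :: "'a set \<Rightarrow> 'a automaton \<Rightarrow> bool" where
  "automaton_over \<Sigma> B \<longleftrightarrow> set (alphabet B) = \<Sigma> \<and>
     set (initials B) \<subseteq> {..<num_states B} \<and> set (finals B) \<subseteq> {..<num_states B} \<and>
     set (transitions B) \<subseteq> {..<num_states B} \<times> \<Sigma> \<times> {..<num_states B}"

fun path :: "(nat \<times> 'a \<times> nat) set \<Rightarrow> nat \<Rightarrow> 'a list \<Rightarrow> nat \<Rightarrow> bool" where
  "path T p [] q \<longleftrightarrow> p = q"
| "path T p (a # w) q \<longleftrightarrow> (\<exists>r. (p, a, r) \<in> T \<and> path T r w q)"

definition recognized :: "'a automaton \<Rightarrow> 'a list set" where
  "recognized B =
     {w. \<exists>p \<in> set (initials B). \<exists>q \<in> set (finals B). path (set (transitions B)) p w q}"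

definition regular_language :: "'a set \<Rightarrow> 'a list set \<Rightarrow> bool" where
  "regular_language \<Sigma> L \<longleftrightarrow> (\<exists>B. automaton_over \<Sigma> B \<and> recognized B = L)"

section \<open>Algorithms: partial recursive functions\<close>

datatype recf =
    RZero
  | RSucc
  | RProj nat
  | RComp recf "recf list"
  | RPrim recf recf
  | RMu recf

text \<open>
  \<open>computes f xs y\<close>: the partial function denoted by \<open>f\<close> is defined at the argument tuple \<open>xs\<close>, with
  value \<open>y\<close>. In \<open>RPrim\<close> and \<open>RMu\<close> the recursion (search) variable is the first argument.
\<close>

inductive computes :: "recf \<Rightarrow> nat list \<Rightarrow> nat \<Rightarrow> bool" where
  zero: "computes RZero xs 0"
| succ: "computes RSucc [x] (Suc x)"
| proj: "i < length xs \<Longrightarrow> computes (RProj i) xs (xs ! i)"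
| comp: "list_all2 (\<lambda>g y. computes g xs y) gs ys \<Longrightarrow> computes f ys z \<Longrightarrow> computes (RComp f gs) xs z"
| prim_0: "computes f xs y \<Longrightarrow> computes (RPrim f g) (0 # xs) y"
| prim_Suc: "computes (RPrim f g) (n # xs) r \<Longrightarrow> computes g (n # r # xs) y
    \<Longrightarrow> computes (RPrim f g) (Suc n # xs) y"
| mu: "computes f (n # xs) 0 \<Longrightarrow> (\<forall>m<n. \<exists>k. computes f (m # xs) (Suc k)) \<Longrightarrow> computes (RMu f) xs n"

text \<open>Goedel numbers of matrices and automata.\<close>

definition vec_code :: "int vec \<Rightarrow> nat" where
  "vec_code v = list_encode (map int_encode (list_of_vec v))"

definition mat_code :: "int mat \<Rightarrow> nat" where
  "mat_code M = list_encode (map vec_code (rows M))"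

definition automaton_code :: "int vec automaton \<Rightarrow> nat" where
  "automaton_code B = list_encode
     [num_states B,
      list_encode (map vec_code (alphabet B)),
      list_encode (initials B),
      list_encode (map (\<lambda>(p, a, q). list_encode [p, vec_code a, q]) (transitions B)),
      list_encode (finals B)]"

end

theory Submission
  imports
    Defs
    "Jordan_Normal_Form.Jordan_Normal_Form_Existence"
    "HOL-Computational_Algebra.Field_as_Ring"
begin

text \<open>
  Write \<open>Q\<close> for the value of a word, and let \<open>S\<close> be the set of all integer vectors of sup norm at most
  some \<open>r\<close> that exceeds the letters and \<open>1 + mat_size M\<close>. As \<open>M\<close> contracts transversally to its
  \<open>\<beta>\<close>-eigenline and \<open>M\<close> is invertible over the integers, the values \<open>Q (u 0\<^sup>k w)\<close> with \<open>w\<close> over \<open>S\<close>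
  form, for \<open>k \<rightarrow> \<infinity>\<close>, a basis of neighbourhoods of \<open>Q u\<close>. Hence \<open>Q u\<close> is an interior point iff it is
  nonnegative and, for some \<open>k\<close>, every nonnegative value \<open>Q (u 0\<^sup>k w)\<close> is the value of a word of \<open>L\<close>.

  The values of the suffixes of a word are a path in the graph \<open>y \<mapsto> t + M y\<close>. There is a radius \<open>K\<close> such
  that a path starting at 0 that has left the ball of radius \<open>K\<close> keeps its sign pattern forever; in
  particular it never returns to 0. Consequently equality of values and nonnegativity are decided by
  congruences of finite index bounded in terms of \<open>K\<close>, which makes the language of interior words
  regular and all the quantifiers above bounded; the automaton is the Nerode automaton on short words.

  The only constant that is not given by a formula is \<open>K\<close>. It is found by unbounded search: halving
  all the points of a path yields a path again, so the claim on \<open>K\<close> follows from its analogue for paths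
  within one finite ball, and this analogue has a finite certificate.
\<close>

section \<open>Computable functions between coded types\<close>

text \<open>The combinatorial description of interior points mentions neither \<beta> nor the
  projection. So one automaton serves every hyperplane, and the algorithm needs integer arithmetic
  only: the spectral data prove that its search ends and that its result is right, but are never
  computed. The obstacle is that word values are unbounded along the eigenline. Two words are
  therefore compared through the differences of their suffix values. These form a path from 0 over
  the doubled box; equal values mean that it returns to 0. Signs freeze because word values stay at
  bounded distance from the eigenline while its direction has no zero coordinate. Irreducibility
  makes the eigenvalues simple, hence M diagonalizable over the complex numbers. Unimodularity is
  used twice: if a coordinate of the eigenvector were 0, some power of M would have a zero row; and
  powers of M have integral inverses, so every lattice point near Q u is reached. The size
  \<open>1 + mat_size M\<close> of the letters absorbs rounding errors, once for points of the
  eigenline and once for halved paths.\<close>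

definition rec_fun :: "nat \<Rightarrow> (nat list \<Rightarrow> nat) \<Rightarrow> bool" where
  "rec_fun n F \<longleftrightarrow> (\<exists>f. \<forall>xs. length xs = n \<longrightarrow> computes f xs (F xs))"

lemma rec_fun_cong:
  "(\<And>xs. length xs = n \<Longrightarrow> F xs = G xs) \<Longrightarrow> rec_fun n F \<longleftrightarrow> rec_fun n G"
  unfolding rec_fun_def by simp

lemma rec_fun_zero: "rec_fun n (\<lambda>_. 0)"
  unfolding rec_fun_def by (blast intro: computes.zero)

lemma rec_fun_proj: "i < n \<Longrightarrow> rec_fun n (\<lambda>xs. xs ! i)"
  unfolding rec_fun_def by (blast intro: computes.proj)

lemma rec_fun_comp1:
  assumes "rec_fun 1 (\<lambda>xs. f (xs ! 0))" "rec_fun n A"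
  shows "rec_fun n (\<lambda>xs. f (A xs))"
proof -
  obtain g a where g: "\<And>xs. length xs = 1 \<Longrightarrow> computes g xs (f (xs ! 0))"
    and a: "\<And>xs. length xs = n \<Longrightarrow> computes a xs (A xs)"
    using assms unfolding rec_fun_def by blast
  have "computes (RComp g [a]) xs (f (A xs))" if "length xs = n" for xs
    by (rule computes.comp[where ys = "[A xs]"]) (use a g[of "[A xs]"] that in auto)
  then show ?thesis unfolding rec_fun_def by blast
qed

lemma rec_fun_comp2:
  assumes "rec_fun 2 (\<lambda>xs. f (xs ! 0) (xs ! 1))" "rec_fun n A" "rec_fun n B"
  shows "rec_fun n (\<lambda>xs. f (A xs) (B xs))"
proof -
  obtain g a b where g: "\<And>xs. length xs = 2 \<Longrightarrow> computes g xs (f (xs ! 0) (xs ! 1))"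
    and a: "\<And>xs. length xs = n \<Longrightarrow> computes a xs (A xs)"
    and b: "\<And>xs. length xs = n \<Longrightarrow> computes b xs (B xs)"
    using assms unfolding rec_fun_def by blast
  have "computes (RComp g [a, b]) xs (f (A xs) (B xs))" if "length xs = n" for xs
    by (rule computes.comp[where ys = "[A xs, B xs]"]) (use a b g[of "[A xs, B xs]"] that in auto)
  then show ?thesis unfolding rec_fun_def by blast
qed

lemma rec_fun_Suc: "rec_fun n A \<Longrightarrow> rec_fun n (\<lambda>xs. Suc (A xs))"
proof (rule rec_fun_comp1[where f = Suc])
  have "computes RSucc xs (Suc (xs ! 0))" if "length xs = 1" for xs
    using that computes.succ by (cases xs) auto
  then show "rec_fun 1 (\<lambda>xs. Suc (xs ! 0))" unfolding rec_fun_def by auto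
qed

lemma rec_fun_rec_nat:
  assumes "rec_fun n A" "rec_fun (Suc (Suc n)) (\<lambda>ys. G (ys ! 0) (ys ! 1) (drop 2 ys))" "rec_fun n N"
  shows "rec_fun n (\<lambda>xs. rec_nat (A xs) (\<lambda>m r. G m r xs) (N xs))"
proof -
  obtain a g k where a: "\<And>xs. length xs = n \<Longrightarrow> computes a xs (A xs)"
    and g: "\<And>ys. length ys = Suc (Suc n) \<Longrightarrow> computes g ys (G (ys ! 0) (ys ! 1) (drop 2 ys))"
    and k: "\<And>xs. length xs = n \<Longrightarrow> computes k xs (N xs)"
    using assms unfolding rec_fun_def by blast
  have prim: "computes (RPrim a g) (m # xs) (rec_nat (A xs) (\<lambda>m r. G m r xs) m)"
    if "length xs = n" for m xs
  proof (induction m)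
    case 0
    then show ?case using a[OF that] by (auto intro: computes.prim_0)
  next
    case (Suc m)
    then show ?case
      using computes.prim_Suc[OF Suc] g[of "m # rec_nat (A xs) (\<lambda>m r. G m r xs) m # xs"] that
      by auto
  qed
  \<comment> \<open>The projections copy the parameters behind the counter, since
    \<open>RPrim\<close> recurses on its first argument.\<close>
  let ?projs = "map RProj [0..<n]"
  have "computes (RComp (RPrim a g) (k # ?projs)) xs (rec_nat (A xs) (\<lambda>m r. G m r xs) (N xs))"
    if "length xs = n" for xs
  proof (rule computes.comp[where ys = "N xs # xs"])
    have "list_all2 (\<lambda>g y. computes g xs y) ?projs xs"
      using that by (auto simp: list_all2_conv_all_nth intro: computes.proj)
    then show "list_all2 (\<lambda>g y. computes g xs y) (k # ?projs) (N xs # xs)"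
      using k[OF that] by simp
  qed (rule prim[OF that])
  then show ?thesis unfolding rec_fun_def by blast
qed

lemma rec_fun_Least:
  assumes "rec_fun (Suc n) F" "\<And>xs. length xs = n \<Longrightarrow> \<exists>m. F (m # xs) = 0"
  shows "rec_fun n (\<lambda>xs. LEAST m. F (m # xs) = 0)"
proof -
  obtain f where f: "\<And>xs. length xs = Suc n \<Longrightarrow> computes f xs (F xs)"
    using assms(1) unfolding rec_fun_def by blast
  have "computes (RMu f) xs (LEAST m. F (m # xs) = 0)" if "length xs = n" for xs
  proof (rule computes.mu)
    have "F ((LEAST m. F (m # xs) = 0) # xs) = 0"
      using LeastI_ex[OF assms(2)[OF that]] .
    then show "computes f ((LEAST m. F (m # xs) = 0) # xs) 0"
      using f[of "(LEAST m. F (m # xs) = 0) # xs"] that by simp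
    show "\<forall>m<LEAST m. F (m # xs) = 0. \<exists>k. computes f (m # xs) (Suc k)"
    proof safe
      fix m assume "m < (LEAST m. F (m # xs) = 0)"
      then have "F (m # xs) \<noteq> 0" by (rule not_less_Least)
      then obtain k where "F (m # xs) = Suc k" using not0_implies_Suc by blast
      then show "\<exists>k. computes f (m # xs) (Suc k)" using f[of "m # xs"] that by auto
    qed
  qed
  then show ?thesis unfolding rec_fun_def by blast
qed

lemma rec_fun_const: "rec_fun n (\<lambda>_. c)"
  by (induction c) (auto intro: rec_fun_zero rec_fun_Suc)

lemma rec_fun_add2: "rec_fun 2 (\<lambda>xs. xs ! 0 + xs ! 1)"
proof -
  have "rec_fun 2 (\<lambda>xs. rec_nat (xs ! 0) (\<lambda>m r. Suc r) (xs ! 1))"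
    by (intro rec_fun_rec_nat[where G = "\<lambda>m r _. Suc r"] rec_fun_Suc rec_fun_proj) simp_all
  moreover have "rec_nat a (\<lambda>m r. Suc r) b = a + b" for a b :: nat by (induction b) auto
  ultimately show ?thesis by simp
qed

lemmas rec_fun_add = rec_fun_comp2[where f = plus, OF rec_fun_add2]

lemma rec_fun_pred1: "rec_fun 1 (\<lambda>xs. xs ! 0 - 1)"
proof -
  have "rec_fun 1 (\<lambda>xs. rec_nat 0 (\<lambda>m r. m) (xs ! 0))"
    by (intro rec_fun_rec_nat[where G = "\<lambda>m r _. m"] rec_fun_zero rec_fun_proj) simp_all
  moreover have "rec_nat 0 (\<lambda>m r. m) a = a - 1" for a :: nat by (induction a) auto
  ultimately show ?thesis by simp
qed

lemma rec_fun_diff2: "rec_fun 2 (\<lambda>xs. xs ! 0 - xs ! 1)"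
proof -
  have "rec_fun 2 (\<lambda>xs. rec_nat (xs ! 0) (\<lambda>m r. r - 1) (xs ! 1))"
    by (intro rec_fun_rec_nat[where G = "\<lambda>m r _. r - 1"] rec_fun_comp1[where f = "\<lambda>a. a - 1", OF rec_fun_pred1] rec_fun_proj)
      simp_all
  moreover have "rec_nat a (\<lambda>m r. r - 1) b = a - b" for a b :: nat by (induction b) auto
  ultimately show ?thesis by simp
qed

lemmas rec_fun_diff = rec_fun_comp2[where f = minus, OF rec_fun_diff2]

lemma rec_fun_triangle1: "rec_fun 1 (\<lambda>xs. triangle (xs ! 0))"
proof -
  have "rec_fun 1 (\<lambda>xs. rec_nat 0 (\<lambda>m r. r + Suc m) (xs ! 0))"
    by (intro rec_fun_rec_nat[where G = "\<lambda>m r _. r + Suc m"] rec_fun_add rec_fun_Suc rec_fun_zero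
        rec_fun_proj) simp_all
  moreover have "rec_nat 0 (\<lambda>m r. r + Suc m) a = triangle a" for a :: nat by (induction a) auto
  ultimately show ?thesis by simp
qed

lemmas rec_fun_triangle = rec_fun_comp1[where f = triangle, OF rec_fun_triangle1]

lemma rec_fun_prod_encode:
  "rec_fun n A \<Longrightarrow> rec_fun n B \<Longrightarrow> rec_fun n (\<lambda>xs. prod_encode (A xs, B xs))"
  unfolding prod_encode_def case_prod_conv by (intro rec_fun_add rec_fun_triangle)

text \<open>If n codes (a, b) then n = \<open>triangle (a + b) + a\<close>, and a + b is the least s
  with n < \<open>triangle (Suc s)\<close>. Truncated subtraction turns this inequality into an
  equation with 0, which is what a search can test.\<close>

lemma prod_decode_by_Least:
  fixes n :: nat
  defines "s \<equiv> LEAST s. Suc n - triangle (Suc s) = 0"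
  shows "fst (prod_decode n) = n - triangle s" "snd (prod_decode n) = s - (n - triangle s)"
    and "\<exists>s. Suc n - triangle (Suc s) = 0"
proof -
  obtain a b where ab: "prod_decode n = (a, b)" by force
  have "prod_encode (a, b) = n" unfolding ab[symmetric] by simp
  then have n: "n = triangle (a + b) + a" by (simp add: prod_encode_def)
  have mono: "triangle i \<le> triangle j" if "i \<le> j" for i j
    using that by (induction j) (auto simp: le_Suc_eq)
  have "s = a + b" unfolding s_def
  proof (rule Least_equality)
    show "Suc n - triangle (Suc (a + b)) = 0" using n by simp
    fix y assume y: "Suc n - triangle (Suc y) = 0"
    show "a + b \<le> y"
      by (rule ccontr) (use mono[of "Suc y" "a + b"] y n in simp)
  qed
  moreover have "n - triangle (a + b) = a" using n by simp
  ultimately show "fst (prod_decode n) = n - triangle s" "snd (prod_decode n) = s - (n - triangle s)"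
    using ab by simp_all
  show "\<exists>s. Suc n - triangle (Suc s) = 0" using n by (intro exI[of _ "a + b"]) simp
qed

lemma rec_fun_prod_decode:
  assumes "rec_fun n A"
  shows "rec_fun n (\<lambda>xs. fst (prod_decode (A xs)))" "rec_fun n (\<lambda>xs. snd (prod_decode (A xs)))"
proof -
  let ?s = "\<lambda>n. LEAST s. Suc n - triangle (Suc s) = 0"
  have "rec_fun (Suc 1) (\<lambda>ys. Suc (ys ! 1) - triangle (Suc (ys ! 0)))"
    by (intro rec_fun_diff rec_fun_Suc rec_fun_triangle rec_fun_proj) simp_all
  from rec_fun_Least[OF this] have s: "rec_fun 1 (\<lambda>xs. ?s (xs ! 0))"
    using prod_decode_by_Least(3) by simp
  have 1: "rec_fun 1 (\<lambda>xs. fst (prod_decode (xs ! 0)))" "rec_fun 1 (\<lambda>xs. snd (prod_decode (xs ! 0)))"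
    unfolding prod_decode_by_Least
    by (intro rec_fun_diff rec_fun_triangle s rec_fun_proj; simp)+
  show "rec_fun n (\<lambda>xs. fst (prod_decode (A xs)))"
    by (rule rec_fun_comp1[where f = "\<lambda>a. fst (prod_decode a)", OF 1(1) assms])
  show "rec_fun n (\<lambda>xs. snd (prod_decode (A xs)))"
    by (rule rec_fun_comp1[where f = "\<lambda>a. snd (prod_decode a)", OF 1(2) assms])
qed

section \<open>Bijective codings and computable functions between coded types\<close>

class coded =
  fixes enc :: "'a \<Rightarrow> nat"
  assumes bij_enc: "bij enc"

lemma enc_eq_iff [simp]: "enc x = enc y \<longleftrightarrow> x = (y :: 'a :: coded)"
  using bij_enc by (metis bij_betw_imp_inj_on inj_eq)

text \<open>Codings are bijections so that every number decodes. A function between coded types then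
  corresponds to a total function on numbers, and no validity test for codes is ever
  required.\<close>

definition dec :: "nat \<Rightarrow> 'a :: coded" where
  "dec = inv_into UNIV enc"

lemma enc_dec [simp]: "enc (dec n :: 'a :: coded) = n"
  unfolding dec_def using f_inv_into_f[of n "enc :: 'a \<Rightarrow> nat" UNIV] bij_enc
  by (auto simp: bij_def)

lemma dec_enc [simp]: "dec (enc x) = (x :: 'a :: coded)"
  by (rule enc_eq_iff[THEN iffD1]) simp

instantiation nat :: coded
begin
definition enc_nat :: "nat \<Rightarrow> nat" where [simp]: "enc_nat n = n"
instance by standard (auto simp: bij_betw_def inj_on_def)
end

instantiation int :: coded
begin
definition enc_int :: "int \<Rightarrow> nat" where "enc_int = int_encode"
instance by standard (simp add: enc_int_def bij_int_encode)
end

instantiation prod :: (coded, coded) coded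
begin
definition enc_prod :: "'a \<times> 'b \<Rightarrow> nat" where
  "enc_prod z = prod_encode (enc (fst z), enc (snd z))"
instance
proof
  show "bij (enc :: 'a \<times> 'b \<Rightarrow> nat)"
  proof (rule bijI)
    show "inj (enc :: 'a \<times> 'b \<Rightarrow> nat)" by (auto intro!: injI simp: enc_prod_def prod_eq_iff)
    have "enc (dec (fst (prod_decode n)) :: 'a, dec (snd (prod_decode n)) :: 'b) = n" for n
      by (simp add: enc_prod_def)
    then show "surj (enc :: 'a \<times> 'b \<Rightarrow> nat)" unfolding surj_def by metis
  qed
qed
end

instantiation list :: (coded) coded
begin
definition enc_list :: "'a list \<Rightarrow> nat" where
  "enc_list xs = list_encode (map enc xs)"
instance
proof
  show "bij (enc :: 'a list \<Rightarrow> nat)"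
  proof (rule bijI)
    show "inj (enc :: 'a list \<Rightarrow> nat)"
    proof (rule injI)
      fix xs ys :: "'a list" assume "enc xs = enc ys"
      then have "map enc xs = map enc ys" by (simp add: enc_list_def list_encode_eq)
      then show "xs = ys" by (metis (mono_tags) enc_eq_iff injI inj_map_eq_map)
    qed
    have "enc (map dec (list_decode n) :: 'a list) = n" for n
      by (simp add: enc_list_def comp_def)
    then show "surj (enc :: 'a list \<Rightarrow> nat)" unfolding surj_def by metis
  qed
qed
end

lemma enc_Pair: "enc (a, b) = prod_encode (enc a, enc b)"
  by (simp add: enc_prod_def)

lemma enc_Nil [simp]: "enc [] = 0"
  by (simp add: enc_list_def)

lemma enc_Cons: "enc (x # xs) = Suc (prod_encode (enc x, enc xs))"
  by (simp add: enc_list_def)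

definition computable :: "('a :: coded \<Rightarrow> 'b :: coded) \<Rightarrow> bool" where
  "computable F \<longleftrightarrow> (\<exists>f. \<forall>x. computes f [enc x] (enc (F x)))"

named_theorems computable_intros

lemma computable_iff_rec_fun:
  fixes F :: "'a :: coded \<Rightarrow> 'b :: coded"
  shows "computable F \<longleftrightarrow> rec_fun 1 (\<lambda>xs. enc (F (dec (xs ! 0))))"
proof -
  have "(\<forall>xs. length xs = 1 \<longrightarrow> computes f xs (enc (F (dec (xs ! 0))))) \<longleftrightarrow>
      (\<forall>x. computes f [enc x] (enc (F x)))" for f
  proof safe
    fix x :: 'a assume "\<forall>xs. length xs = 1 \<longrightarrow> computes f xs (enc (F (dec (xs ! 0))))"
    from this[rule_format, of "[enc x]"] show "computes f [enc x] (enc (F x))" by simp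
  next
    fix xs :: "nat list" assume *: "\<forall>x. computes f [enc x] (enc (F x))" and "length xs = 1"
    then obtain n where "xs = [n]" by (cases xs) auto
    then show "computes f xs (enc (F (dec (xs ! 0))))" using *[rule_format, of "dec n"] by simp
  qed
  then show ?thesis unfolding computable_def rec_fun_def by simp
qed

lemma computable_by_code:
  assumes "rec_fun 1 (\<lambda>xs. G (xs ! 0))" "\<And>x. enc (F x) = G (enc x)"
  shows "computable F"
  unfolding computable_iff_rec_fun using assms by simp

lemma computable_rec_fun:
  assumes "computable F" "rec_fun n A"
  shows "rec_fun n (\<lambda>xs. enc (F (dec (A xs))))"
  by (rule rec_fun_comp1[OF assms(1)[unfolded computable_iff_rec_fun] assms(2)])

lemma computable_id [computable_intros]: "computable (\<lambda>x. x)"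
  by (rule computable_by_code[where G = "\<lambda>x. x"]) (auto intro: rec_fun_proj)

lemma computable_const [computable_intros]: "computable (\<lambda>_. c)"
  by (rule computable_by_code[where G = "\<lambda>_. enc c"]) (auto intro: rec_fun_const)

lemma computable_comp:
  assumes "computable F" "computable G"
  shows "computable (\<lambda>x. F (G x))"
proof (rule computable_by_code)
  show "rec_fun 1 (\<lambda>xs. enc (F (dec (enc (G (dec (xs ! 0)))))))"
    by (rule computable_rec_fun[OF assms(1)]) (use assms(2) in \<open>simp add: computable_iff_rec_fun\<close>)
qed simp

lemma computable_by_code_comp:
  assumes "rec_fun 1 (\<lambda>xs. G (xs ! 0))" "\<And>x. enc (F x) = G (enc x)" "computable A"
  shows "computable (\<lambda>x. F (A x))"
  by (rule computable_comp[OF computable_by_code assms(3)]) (use assms in auto)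

lemma computable_Pair [computable_intros]:
  assumes "computable A" "computable B"
  shows "computable (\<lambda>x. (A x, B x))"
  unfolding computable_iff_rec_fun enc_Pair
  by (intro rec_fun_prod_encode assms[unfolded computable_iff_rec_fun])

lemma computable_fst [computable_intros]: "computable A \<Longrightarrow> computable (\<lambda>x. fst (A x))"
  by (rule computable_by_code_comp[where F = fst and G = "\<lambda>n. fst (prod_decode n)"])
    (auto simp: enc_prod_def intro!: rec_fun_prod_decode rec_fun_proj)

lemma computable_snd [computable_intros]: "computable A \<Longrightarrow> computable (\<lambda>x. snd (A x))"
  by (rule computable_by_code_comp[where F = snd and G = "\<lambda>n. snd (prod_decode n)"])
    (auto simp: enc_prod_def intro!: rec_fun_prod_decode rec_fun_proj)

lemma computable_enc_iff: "computable (\<lambda>x. enc (A x)) \<longleftrightarrow> computable A"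
  unfolding computable_def by simp

lemma computable_comp2:
  assumes "computable (\<lambda>z. F (fst z) (snd z))" "computable A" "computable B"
  shows "computable (\<lambda>x. F (A x) (B x))"
  using computable_comp[OF assms(1) computable_Pair[OF assms(2,3)]] by simp

lemma computable_comp3:
  assumes "computable (\<lambda>z. F (fst z) (fst (snd z)) (snd (snd z)))" "computable A" "computable B" "computable C"
  shows "computable (\<lambda>x. F (A x) (B x) (C x))"
  using computable_comp[OF assms(1) computable_Pair[OF assms(2) computable_Pair[OF assms(3,4)]]] by simp

lemma computable_case_prod [computable_intros]:
  assumes "computable (\<lambda>x. F x (fst (A x)) (snd (A x)))"
  shows "computable (\<lambda>x. case_prod (F x) (A x))"
  using assms by (simp add: case_prod_beta)

lemma computable_rec_nat [computable_intros]:
  assumes A: "computable A" and G: "computable (\<lambda>z. G (fst z) (fst (snd z)) (snd (snd z)))"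
    and N: "computable N"
  shows "computable (\<lambda>x. rec_nat (A x) (G x) (N x))"
proof -
  let ?G = "\<lambda>m r xs. enc (G (dec (xs ! 0)) m (dec r))"
  have "rec_fun 1 (\<lambda>xs. rec_nat (enc (A (dec (xs ! 0)))) (\<lambda>m r. ?G m r xs) (enc (N (dec (xs ! 0)))))"
  proof (rule rec_fun_rec_nat[where G = ?G])
    show "rec_fun 1 (\<lambda>xs. enc (A (dec (xs ! 0))))" "rec_fun 1 (\<lambda>xs. enc (N (dec (xs ! 0))))"
      using A N by (simp_all add: computable_iff_rec_fun)
    \<comment> \<open>Repacks counter, previous value and parameter into the code of the triple
      (parameter, counter, value) that \<open>G\<close> reads.\<close>
    let ?z = "\<lambda>ys. prod_encode (ys ! 2, prod_encode (ys ! 0, ys ! 1))"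
    have "(dec (prod_encode (a, prod_encode (b, c))) :: 'a \<times> nat \<times> 'b) = (dec a, b, dec c)"
      for a b c
      by (rule enc_eq_iff[THEN iffD1]) (simp add: enc_Pair del: enc_eq_iff)
    moreover have "rec_fun (Suc (Suc 1)) ?z"
      by (intro rec_fun_prod_encode rec_fun_proj) simp_all
    ultimately have "rec_fun (Suc (Suc 1)) (\<lambda>ys. ?G (ys ! 0) (ys ! 1) [ys ! 2])"
      using computable_rec_fun[OF G, where n = "Suc (Suc 1)" and A = ?z] by simp
    then show "rec_fun (Suc (Suc 1)) (\<lambda>ys. ?G (ys ! 0) (ys ! 1) (drop 2 ys))"
      by (subst rec_fun_cong[where G = "\<lambda>ys. ?G (ys ! 0) (ys ! 1) [ys ! 2]"]) simp_all
  qed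
  moreover have "rec_nat (enc a) (\<lambda>m r. enc (g m (dec r))) n = enc (rec_nat a g n)"
    for a :: 'b and g n by (induction n) auto
  ultimately show ?thesis unfolding computable_iff_rec_fun by simp
qed

lemma computable_Suc [computable_intros]: "computable A \<Longrightarrow> computable (\<lambda>x. Suc (A x))"
  by (rule computable_by_code_comp[where F = Suc and G = Suc]) (auto intro: rec_fun_Suc rec_fun_proj)

lemma computable_add_nat [computable_intros]:
  assumes "computable A" "computable B"
  shows "computable (\<lambda>x. A x + B x :: nat)"
proof -
  have "computable (\<lambda>x. rec_nat (A x) (\<lambda>m r. Suc r) (B x))"
    by (intro computable_intros assms)
  moreover have "rec_nat a (\<lambda>m r. Suc r) b = a + b" for a b :: nat by (induction b) auto
  ultimately show ?thesis by simp
qed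

lemma computable_diff_nat [computable_intros]:
  assumes "computable A" "computable B"
  shows "computable (\<lambda>x. A x - B x :: nat)"
proof -
  have "computable (\<lambda>x. rec_nat (A x) (\<lambda>m r. rec_nat 0 (\<lambda>k s. k) r) (B x))"
    by (intro computable_intros assms)
  moreover have "rec_nat 0 (\<lambda>k s. k) r = r - Suc 0" for r :: nat by (cases r) auto
  moreover have "rec_nat a (\<lambda>m r. r - Suc 0) b = a - b" for a b :: nat by (induction b) auto
  ultimately show ?thesis by simp
qed

lemma computable_mult_nat [computable_intros]:
  assumes "computable A" "computable B"
  shows "computable (\<lambda>x. A x * B x :: nat)"
proof -
  have "computable (\<lambda>x. rec_nat 0 (\<lambda>m r. r + A x) (B x))"
    by (intro computable_intros assms computable_comp[OF assms(1)])
  moreover have "rec_nat 0 (\<lambda>m r. r + a) b = a * b" for a b :: nat by (induction b) auto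
  ultimately show ?thesis by simp
qed

lemma computable_power_nat [computable_intros]:
  assumes "computable A" "computable B"
  shows "computable (\<lambda>x. A x ^ B x :: nat)"
proof -
  have "computable (\<lambda>x. rec_nat 1 (\<lambda>m r. A x * r) (B x))"
    by (intro computable_intros assms computable_comp[OF assms(1)])
  moreover have "rec_nat 1 (\<lambda>m r. a * r) b = a ^ b" for a b :: nat by (induction b) auto
  ultimately show ?thesis by simp
qed

section \<open>Decidable predicates\<close>

definition decidable :: "('a :: coded \<Rightarrow> bool) \<Rightarrow> bool" where
  "decidable P \<longleftrightarrow> computable (\<lambda>x. if P x then 1 else 0 :: nat)"

lemma computable_If [computable_intros]:
  assumes "decidable P" "computable A" "computable B"
  shows "computable (\<lambda>x. if P x then A x else B x)"
proof -
  have "computable (\<lambda>x. rec_nat (B x) (\<lambda>_ _. A x) (if P x then 1 else 0))"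
    by (intro computable_intros assms(3) assms(1)[unfolded decidable_def] computable_comp[OF assms(2)])
  moreover have "rec_nat b (\<lambda>_ _. a) (if p then 1 else 0) = (if p then a else b)" for a b :: 'b and p
    by simp
  ultimately show ?thesis by simp
qed

lemma decidable_comp: "decidable P \<Longrightarrow> computable A \<Longrightarrow> decidable (\<lambda>x. P (A x))"
  unfolding decidable_def by (rule computable_comp)

lemma decidable_not [computable_intros]:
  assumes "decidable P"
  shows "decidable (\<lambda>x. \<not> P x)"
proof -
  have *: "(if \<not> P x then 1 else 0 :: nat) = (if P x then 0 else 1)" for x by auto
  show ?thesis unfolding decidable_def *
    by (rule computable_If[OF assms computable_const computable_const])
qed

lemma decidable_conj [computable_intros]:
  assumes "decidable P" "decidable Q"
  shows "decidable (\<lambda>x. P x \<and> Q x)"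
proof -
  have *: "(if P x \<and> Q x then 1 else 0 :: nat) = (if P x then (if Q x then 1 else 0) else 0)" for x
    by auto
  show ?thesis unfolding decidable_def *
    by (rule computable_If[OF assms(1) assms(2)[unfolded decidable_def] computable_const])
qed

lemma decidable_disj [computable_intros]:
  assumes "decidable P" "decidable Q"
  shows "decidable (\<lambda>x. P x \<or> Q x)"
  using decidable_not[OF decidable_conj[OF decidable_not[OF assms(1)] decidable_not[OF assms(2)]]]
  by simp

lemma decidable_imp [computable_intros]:
  assumes "decidable P" "decidable Q"
  shows "decidable (\<lambda>x. P x \<longrightarrow> Q x)"
  using decidable_disj[OF decidable_not[OF assms(1)] assms(2)] by simp

lemma decidable_eq_0:
  assumes "computable (A :: _ \<Rightarrow> nat)"
  shows "decidable (\<lambda>x. A x = 0)"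
proof -
  have "computable (\<lambda>x. 1 - A x)" by (intro computable_intros assms)
  moreover have "(\<lambda>x. 1 - A x) = (\<lambda>x. if A x = 0 then 1 else 0)" by auto
  ultimately show ?thesis unfolding decidable_def by simp
qed

lemma decidable_le_nat [computable_intros]:
  assumes "computable A" "computable B"
  shows "decidable (\<lambda>x. A x \<le> (B x :: nat))"
  using decidable_eq_0[OF computable_diff_nat[OF assms]] by simp

lemma decidable_eq [computable_intros]:
  assumes "computable A" "computable B"
  shows "decidable (\<lambda>x. A x = B x)"
proof -
  have "decidable (\<lambda>x. enc (A x) \<le> enc (B x) \<and> enc (B x) \<le> enc (A x))"
    by (intro computable_intros) (simp_all add: computable_enc_iff assms)
  moreover have "enc a \<le> enc b \<and> enc b \<le> enc a \<longleftrightarrow> a = b" for a b :: 'b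
    using enc_eq_iff[of a b] by linarith
  ultimately show ?thesis by simp
qed

section \<open>Functions on lists\<close>

lemma computable_Cons [computable_intros]:
  assumes "computable A" "computable B"
  shows "computable (\<lambda>x. A x # B x)"
  unfolding computable_iff_rec_fun enc_Cons
  by (intro rec_fun_Suc rec_fun_prod_encode assms[unfolded computable_iff_rec_fun])

lemma rec_fun_pred: "rec_fun n A \<Longrightarrow> rec_fun n (\<lambda>xs. A xs - 1)"
  by (rule rec_fun_diff[OF _ rec_fun_const])

text \<open>A total variant of \<^const>\<open>hd\<close> whose value on the empty list is computable, too.\<close>

definition coded_hd :: "'a :: coded list \<Rightarrow> 'a" where
  "coded_hd xs = dec (fst (prod_decode (enc xs - 1)))"

lemma coded_hd_Cons [simp]: "coded_hd (x # xs) = x"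
  by (simp add: coded_hd_def enc_Cons)

lemma computable_coded_hd: "computable A \<Longrightarrow> computable (\<lambda>x. coded_hd (A x))"
  by (rule computable_by_code_comp[where F = coded_hd and G = "\<lambda>n. fst (prod_decode (n - 1))"])
    (auto simp: coded_hd_def intro!: rec_fun_prod_decode(1) rec_fun_pred[simplified] rec_fun_proj)

text \<open>Makes the decoding of tails correct on the empty list too: its code 0, lowered by
  truncated subtraction, decodes to a pair whose second part is 0 again.\<close>

lemma prod_decode_0: "prod_decode 0 = (0, 0)"
  using prod_encode_inverse[of "(0, 0)"] by (simp add: prod_encode_def)

lemma computable_tl: "computable A \<Longrightarrow> computable (\<lambda>x. tl (A x))"
proof (rule computable_by_code_comp[where F = tl and G = "\<lambda>n. snd (prod_decode (n - 1))"])
  show "enc (tl xs) = snd (prod_decode (enc xs - 1))" for xs :: "'b list"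
    by (cases xs) (auto simp: enc_Cons prod_decode_0)
  show "rec_fun 1 (\<lambda>xs. snd (prod_decode (xs ! 0 - 1)))"
    by (intro rec_fun_prod_decode rec_fun_pred rec_fun_proj) simp
qed

lemma computable_case_list [computable_intros]:
  assumes "computable L" "computable A" "computable (\<lambda>z. F (fst z) (fst (snd z)) (snd (snd z)))"
  shows "computable (\<lambda>x. case_list (A x) (F x) (L x))"
proof -
  have "computable (\<lambda>x. if L x = [] then A x else F x (coded_hd (L x)) (tl (L x)))"
    by (intro computable_intros assms(1,2) computable_comp3[OF assms(3)] computable_coded_hd computable_tl)
  moreover have "(if l = [] then a else f (coded_hd l) (tl l)) = case_list a f l"
    for l :: "'b list" and a :: 'c and f by (cases l) auto
  ultimately show ?thesis by simp
qed

lemma length_le_enc: "length xs \<le> enc xs"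
proof (induction xs)
  case (Cons x xs)
  then show ?case using le_prod_encode_2[of "enc xs" "enc x"] by (simp add: enc_Cons)
qed simp

text \<open>The code of a list bounds its length, so primitive recursion up to the code consumes the
  whole list; the surplus rounds leave the state unchanged.\<close>

lemma computable_foldl [computable_intros]:
  assumes G: "computable (\<lambda>z. G (fst z) (fst (snd z)) (snd (snd z)))"
    and B: "computable B" and L: "computable L"
  shows "computable (\<lambda>x. foldl (G x) (B x) (L x))"
proof -
  let ?step = "\<lambda>x s. case snd s of [] \<Rightarrow> s | y # ys \<Rightarrow> (G x (fst s) y, ys)"
  have "computable (\<lambda>x. fst (rec_nat (B x, L x) (\<lambda>_. ?step x) (enc (L x))))"
    by (intro computable_intros B L computable_comp3[OF G] computable_enc_iff[THEN iffD2])
  moreover have "rec_nat (b, l) (\<lambda>_. ?step x) n = (foldl (G x) b (take n l), drop n l)" for x b l n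
  proof (induction n)
    case (Suc n)
    show ?case
    proof (cases "n < length l")
      case True
      then show ?thesis using Suc Cons_nth_drop_Suc[OF True, symmetric]
        by (auto simp: take_Suc_conv_app_nth)
    qed (use Suc in auto)
  qed simp
  ultimately show ?thesis by (simp add: length_le_enc)
qed

lemma computable_rev [computable_intros]:
  assumes "computable A" shows "computable (\<lambda>x. rev (A x))"
proof -
  have "computable (\<lambda>x. foldl (\<lambda>ys y. y # ys) [] (A x))"
    by (intro computable_intros assms)
  moreover have "foldl (\<lambda>ys y. y # ys) zs xs = rev xs @ zs" for xs zs :: "'b list"
    by (induction xs arbitrary: zs) auto
  ultimately show ?thesis by simp
qed

lemma computable_foldr [computable_intros]:
  assumes "computable (\<lambda>z. G (fst z) (fst (snd z)) (snd (snd z)))" "computable B" "computable L"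
  shows "computable (\<lambda>x. foldr (G x) (L x) (B x))"
  unfolding foldr_conv_foldl
  by (intro computable_intros assms computable_comp3[OF assms(1)])

lemma computable_append [computable_intros]:
  assumes "computable A" "computable B" shows "computable (\<lambda>x. A x @ B x)"
proof -
  have "computable (\<lambda>x. foldr (\<lambda>y ys. y # ys) (A x) (B x))"
    by (intro computable_intros assms)
  moreover have "foldr (\<lambda>y ys. y # ys) xs zs = xs @ zs" for xs zs :: "'b list"
    by (induction xs) auto
  ultimately show ?thesis by simp
qed

lemma computable_map [computable_intros]:
  assumes "computable (\<lambda>z. F (fst z) (snd z))" "computable L"
  shows "computable (\<lambda>x. map (F x) (L x))"
proof -
  have "computable (\<lambda>x. foldr (\<lambda>y ys. F x y # ys) (L x) [])"
    by (intro computable_intros assms computable_comp2[OF assms(1)])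
  moreover have "foldr (\<lambda>y ys. f y # ys) xs [] = map f xs" for f :: "'b \<Rightarrow> 'c" and xs
    by (induction xs) auto
  ultimately show ?thesis by simp
qed

lemma computable_filter [computable_intros]:
  assumes "decidable (\<lambda>z. P (fst z) (snd z))" "computable L"
  shows "computable (\<lambda>x. filter (P x) (L x))"
proof -
  have P: "decidable (\<lambda>z. P (A z) (B z))" if "computable A" "computable B" for A B
    using decidable_comp[OF assms(1) computable_Pair[OF that]] by simp
  have "computable (\<lambda>x. foldr (\<lambda>y ys. if P x y then y # ys else ys) (L x) [])"
    by (intro computable_intros assms P)
  moreover have "foldr (\<lambda>y ys. if p y then y # ys else ys) xs [] = filter p xs" for p :: "'b \<Rightarrow> bool" and xs
    by (induction xs) auto
  ultimately show ?thesis by simp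
qed

lemma computable_concat [computable_intros]:
  assumes "computable A" shows "computable (\<lambda>x. concat (A x))"
  unfolding concat_conv_foldr by (intro computable_intros assms)

lemma decidable_Ball_set [computable_intros]:
  assumes "decidable (\<lambda>z. P (fst z) (snd z))" "computable L"
  shows "decidable (\<lambda>x. \<forall>y\<in>set (L x). P x y)"
proof -
  have "decidable (\<lambda>x. filter (\<lambda>y. \<not> P x y) (L x) = [])"
    by (intro computable_intros assms)
  then show ?thesis by (simp add: filter_empty_conv)
qed

lemma decidable_Bex_set [computable_intros]:
  assumes "decidable (\<lambda>z. P (fst z) (snd z))" "computable L"
  shows "decidable (\<lambda>x. \<exists>y\<in>set (L x). P x y)"
proof -
  have "decidable (\<lambda>x. \<not> (\<forall>y\<in>set (L x). \<not> P x y))"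
    by (intro computable_intros assms)
  then show ?thesis by simp
qed

lemma decidable_in_set [computable_intros]:
  assumes "computable A" "computable L"
  shows "decidable (\<lambda>x. A x \<in> set (L x))"
proof -
  have "decidable (\<lambda>x. \<exists>y\<in>set (L x). y = A x)"
    by (intro computable_intros assms computable_comp[OF assms(1)])
  then show ?thesis by simp
qed

lemma computable_length [computable_intros]:
  assumes "computable A" shows "computable (\<lambda>x. length (A x))"
proof -
  have "computable (\<lambda>x. foldr (\<lambda>_ n. Suc n) (A x) 0)"
    by (intro computable_intros assms)
  moreover have "foldr (\<lambda>_ n. Suc n) xs 0 = length xs" for xs :: "'b list" by (induction xs) auto
  ultimately show ?thesis by simp
qed

lemma computable_upt [computable_intros]:
  assumes "computable A" "computable B" shows "computable (\<lambda>x. [A x ..< B x])"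
proof -
  have "computable (\<lambda>x. rec_nat [] (\<lambda>n ys. if A x \<le> n then ys @ [n] else []) (B x))"
    by (intro computable_intros assms computable_comp[OF assms(1)])
  moreover have "rec_nat [] (\<lambda>n ys. if a \<le> n then ys @ [n] else []) b = [a..<b]" for a b :: nat
    by (induction b) auto
  ultimately show ?thesis by simp
qed

lemma computable_replicate [computable_intros]:
  assumes "computable A" "computable B" shows "computable (\<lambda>x. replicate (A x) (B x))"
proof -
  have "computable (\<lambda>x. map (\<lambda>_. B x) [0..<A x])"
    by (intro computable_intros assms computable_comp[OF assms(2)])
  then show ?thesis by (simp add: map_replicate_const)
qed

lemma computable_zip [computable_intros]:
  assumes "computable A" "computable B" shows "computable (\<lambda>x. zip (A x) (B x))"
proof -
  let ?step = "\<lambda>s a. case snd s of [] \<Rightarrow> (fst s, []) | b # bs \<Rightarrow> (fst s @ [(a, b)], bs)"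
  have "computable (\<lambda>x. fst (foldl ?step ([], B x) (A x)))"
    by (intro computable_intros assms)
  moreover have "fst (foldl ?step (zs, bs) as) = zs @ zip as bs"
    for zs and as :: "'b list" and bs :: "'c list"
    by (induction as arbitrary: zs bs) (auto split: list.split)
  ultimately show ?thesis by simp
qed

lemma computable_n_lists [computable_intros]:
  assumes "computable A" "computable B" shows "computable (\<lambda>x. List.n_lists (A x) (B x))"
proof -
  have "computable (\<lambda>x. rec_nat [[]] (\<lambda>_ yss. concat (map (\<lambda>ys. map (\<lambda>y. y # ys) (B x)) yss)) (A x))"
    by (intro computable_intros assms computable_comp[OF assms(2)])
  moreover have "rec_nat [[]] (\<lambda>_ yss. concat (map (\<lambda>ys. map (\<lambda>y. y # ys) b) yss)) a = List.n_lists a b"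
    for a and b :: "'b list"
    by (induction a) auto
  ultimately show ?thesis by simp
qed

section \<open>Integer arithmetic\<close>

lemma computable_div_mod_2:
  assumes "computable A"
  shows "computable (\<lambda>x. A x div 2 :: nat)" "computable (\<lambda>x. A x mod 2 :: nat)"
proof -
  let ?r = "\<lambda>n. rec_nat (0, 0) (\<lambda>_ s. if snd s = 1 then (Suc (fst s), 0) else (fst s, 1)) n :: nat \<times> nat"
  have "?r n = (n div 2, n mod 2)" for n by (induction n) (auto simp: div_Suc mod_Suc)
  moreover have "computable (\<lambda>x. ?r (A x))" by (intro computable_intros assms)
  ultimately have "computable (\<lambda>x. (A x div 2, A x mod 2))" by simp
  from computable_fst[OF this] computable_snd[OF this]
  show "computable (\<lambda>x. A x div 2 :: nat)" "computable (\<lambda>x. A x mod 2 :: nat)" by simp_all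
qed

lemma enc_int_eq: "enc (i :: int) = (if 0 \<le> i then 2 * nat i else Suc (2 * nat (- i - 1)))"
  by (simp add: enc_int_def int_encode_def sum_encode_def)

lemma computable_int [computable_intros]:
  assumes "computable A" shows "computable (\<lambda>x. int (A x))"
proof -
  have "computable (\<lambda>x. 2 * A x)" by (intro computable_intros assms)
  then have "computable (\<lambda>x. enc (int (A x)))" by (simp add: enc_int_eq)
  then show ?thesis by (simp only: computable_enc_iff)
qed

lemma computable_nat [computable_intros]:
  assumes "computable A" shows "computable (\<lambda>x. nat (A x))"
proof -
  have A: "computable (\<lambda>x. enc (A x))" using assms by (simp only: computable_enc_iff)
  have "computable (\<lambda>x. if enc (A x) mod 2 = 0 then enc (A x) div 2 else 0)"
    by (intro computable_intros computable_div_mod_2 A)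
  moreover have "(if enc i mod 2 = 0 then enc i div 2 else 0) = nat i" for i :: int
    by (auto simp: enc_int_eq)
  ultimately show ?thesis by simp
qed

text \<open>Together with \<open>nat\<close> this gives the positive and the negative part of an
  integer. Sums, products and negation are computed on these parts and reassembled by
  \<open>computable_int_diff\<close>.\<close>

lemma computable_nat_uminus:
  assumes "computable A" shows "computable (\<lambda>x. nat (- A x))"
proof -
  have A: "computable (\<lambda>x. enc (A x))" using assms by (simp only: computable_enc_iff)
  have "computable (\<lambda>x. if enc (A x) mod 2 = 0 then 0 else Suc (enc (A x) div 2))"
    by (intro computable_intros computable_div_mod_2 A)
  moreover have "(if enc i mod 2 = 0 then 0 else Suc (enc i div 2)) = nat (- i)" for i :: int
    by (auto simp: enc_int_eq)
  ultimately show ?thesis by simp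
qed

lemma computable_int_diff:
  assumes "computable A" "computable B" shows "computable (\<lambda>x. int (A x) - int (B x))"
proof -
  have "computable (\<lambda>x. if B x \<le> A x then 2 * (A x - B x) else 2 * (B x - A x) - 1)"
    by (intro computable_intros assms)
  moreover have "(if b \<le> a then 2 * (a - b) else 2 * (b - a) - 1) = enc (int a - int b)" for a b
    by (auto simp: enc_int_eq)
  ultimately have "computable (\<lambda>x. enc (int (A x) - int (B x)))" by simp
  then show ?thesis by (simp only: computable_enc_iff)
qed

lemma int_split: "int (nat i) - int (nat (- i)) = i"
  by simp

lemma computable_add_int [computable_intros]:
  assumes "computable A" "computable B" shows "computable (\<lambda>x. A x + B x :: int)"
proof -
  have "computable (\<lambda>x. int (nat (A x) + nat (B x)) - int (nat (- A x) + nat (- B x)))"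
    by (intro computable_int_diff computable_intros computable_nat_uminus assms)
  moreover have "int (nat i + nat j) - int (nat (- i) + nat (- j)) = i + j" for i j by simp
  ultimately show ?thesis by simp
qed

lemma computable_uminus_int [computable_intros]:
  assumes "computable A" shows "computable (\<lambda>x. - A x :: int)"
proof -
  have "computable (\<lambda>x. int (nat (- A x)) - int (nat (A x)))"
    by (intro computable_int_diff computable_intros computable_nat_uminus assms)
  moreover have "int (nat (- i)) - int (nat i) = - i" for i by simp
  ultimately show ?thesis by simp
qed

lemma computable_mult_int [computable_intros]:
  assumes "computable A" "computable B" shows "computable (\<lambda>x. A x * B x :: int)"
proof -
  have "computable (\<lambda>x. int (nat (A x) * nat (B x) + nat (- A x) * nat (- B x)) -
      int (nat (A x) * nat (- B x) + nat (- A x) * nat (B x)))"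
    by (intro computable_int_diff computable_intros computable_nat_uminus assms)
  moreover have "int (nat i * nat j + nat (- i) * nat (- j)) - int (nat i * nat (- j) + nat (- i) * nat j)
      = i * j" for i j
  proof -
    have "i * j = (int (nat i) - int (nat (- i))) * (int (nat j) - int (nat (- j)))"
      unfolding int_split ..
    then show ?thesis by (simp only: of_nat_add of_nat_mult) (simp add: algebra_simps)
  qed
  ultimately show ?thesis by simp
qed

lemma computable_abs_int [computable_intros]:
  assumes "computable A" shows "computable (\<lambda>x. \<bar>A x\<bar> :: int)"
proof -
  have "computable (\<lambda>x. int (nat (A x) + nat (- A x)))"
    by (intro computable_intros computable_nat_uminus assms)
  moreover have "int (nat i + nat (- i)) = \<bar>i\<bar>" for i by simp
  ultimately show ?thesis by simp
qed

lemma decidable_le_int [computable_intros]: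
  assumes "computable A" "computable B" shows "decidable (\<lambda>x. A x \<le> (B x :: int))"
proof -
  have "decidable (\<lambda>x. nat (A x + - B x) = 0)" by (intro computable_intros assms)
  then show ?thesis by simp
qed

lemma decidable_less_int [computable_intros]:
  assumes "computable A" "computable B" shows "decidable (\<lambda>x. A x < (B x :: int))"
proof -
  have "decidable (\<lambda>x. \<not> B x \<le> A x)" by (intro computable_intros assms)
  then show ?thesis by (simp add: not_le)
qed

lemma computable_sum_list_int [computable_intros]:
  assumes "computable A" shows "computable (\<lambda>x. sum_list (A x) :: int)"
  unfolding sum_list.eq_foldr by (intro computable_intros assms)

text \<open>The search is specified only on inputs that have a witness, because numbers that do not
  code an admissible matrix and automaton may have none. Hence a program on two raw arguments in
  place of a \<open>computable\<close> function, which would be total.\<close>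

lemma computable_partial_Least:
  assumes "decidable (\<lambda>z. P (fst z) (snd z))" "computable (\<lambda>z. F (fst z) (snd z))"
  shows "\<exists>f. \<forall>x y :: nat. (\<exists>c. P c (x, y)) \<longrightarrow> computes f [x, y] (enc (F (LEAST c :: nat. P c (x, y)) (x, y)))"
proof -
  have "decidable (\<lambda>z. \<not> P (fst z) (snd z))" by (intro computable_intros assms)
  note computable_rec_fun[OF this[unfolded decidable_def], of 3 "\<lambda>xs. prod_encode (xs ! 0, prod_encode (xs ! 1, xs ! 2))"]
  moreover have code: "rec_fun 3 (\<lambda>xs. prod_encode (xs ! 0, prod_encode (xs ! 1, xs ! 2)))"
    by (intro rec_fun_prod_encode rec_fun_proj; simp)
  moreover have dec: "(dec (prod_encode (c, prod_encode (x, y))) :: nat \<times> nat \<times> nat) = (c, x, y)" for c x y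
    by (rule enc_eq_iff[THEN iffD1]) (simp add: enc_Pair del: enc_eq_iff)
  ultimately obtain p where p0: "\<And>xs. length xs = 3 \<Longrightarrow>
      computes p xs (if \<not> P (xs ! 0) (xs ! 1, xs ! 2) then 1 else 0)"
    unfolding rec_fun_def dec fst_conv snd_conv enc_nat_def by blast
  have p: "computes p [c, x, y] (if P c (x, y) then 0 else 1)" for c x y
    using p0[of "[c, x, y]"] by (simp add: numeral_2_eq_2 split: if_splits)
  obtain f where f: "\<And>z. computes f [enc z] (enc (F (fst z) (snd z)))"
    using assms(2) unfolding computable_def by blast
  obtain e where e0: "\<And>xs. length xs = 3 \<Longrightarrow> computes e xs (prod_encode (xs ! 0, prod_encode (xs ! 1, xs ! 2)))"
    using code unfolding rec_fun_def by blast
  have e: "computes e [c, x, y] (prod_encode (c, prod_encode (x, y)))" for c x y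
    using e0[of "[c, x, y]"] by (simp add: numeral_2_eq_2)
  let ?f = "RComp (RComp f [e]) [RMu p, RProj 0, RProj 1]"
  have "computes ?f [x, y] (enc (F (LEAST c. P c (x, y)) (x, y)))" if ex: "\<exists>c. P c (x, y)" for x y
  proof -
    let ?c = "LEAST c. P c (x, y)"
    have "computes (RMu p) [x, y] ?c"
    proof (rule computes.mu)
      show "computes p [?c, x, y] 0" using p[of ?c x y] LeastI_ex[OF ex] by simp
      show "\<forall>m<?c. \<exists>k. computes p [m, x, y] (Suc k)"
        using p not_less_Least[of _ "\<lambda>c. P c (x, y)"] by (metis One_nat_def)
    qed
    moreover have "computes (RProj 0) [x, y] x" "computes (RProj 1) [x, y] y"
      using computes.proj[of 0 "[x, y]"] computes.proj[of 1 "[x, y]"] by simp_all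
    ultimately have args: "list_all2 (\<lambda>g. computes g [x, y]) [RMu p, RProj 0, RProj 1] [?c, x, y]"
      by simp
    have "computes (RComp f [e]) [?c, x, y] (enc (F ?c (x, y)))"
      by (rule computes.comp[where ys = "[prod_encode (?c, prod_encode (x, y))]"])
        (use e f[of "(?c, x, y)"] in \<open>auto simp: enc_Pair\<close>)
    with args show ?thesis by (rule computes.comp)
  qed
  then show ?thesis by blast
qed

section \<open>Residuals and the Nerode automaton\<close>

definition residual :: "'a set \<Rightarrow> 'a list set \<Rightarrow> 'a list \<Rightarrow> 'a list set" where
  "residual S X u = {w \<in> lists S. u @ w \<in> X}"

text \<open>A bound for the number of Myhill-Nerode classes. Finiteness is stated separately because
  \<open>card\<close> is 0 on infinite sets.\<close>

definition index_le :: "'a set \<Rightarrow> 'a list set \<Rightarrow> nat \<Rightarrow> bool" where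
  "index_le S X N \<longleftrightarrow> finite (residual S X ` lists S) \<and> card (residual S X ` lists S) \<le> N"

lemma residual_append:
  assumes "residual S X u = residual S X u'" "w \<in> lists S"
  shows "residual S X (u @ w) = residual S X (u' @ w)"
proof -
  have "w @ v \<in> residual S X u \<longleftrightarrow> w @ v \<in> residual S X u'" for v using assms(1) by simp
  then show ?thesis using assms(2) by (auto simp: residual_def)
qed

lemma residual_mem:
  assumes "residual S X u = residual S X u'"
  shows "u \<in> X \<longleftrightarrow> u' \<in> X"
proof -
  have "[] \<in> residual S X u \<longleftrightarrow> [] \<in> residual S X u'" using assms by simp
  then show ?thesis by (simp add: residual_def)
qed

text \<open>The residual factors through \<open>f\<close>. So \<open>f u\<close> can be any finite
  record of u that settles membership of u w for all w.\<close>

lemma index_le_if_kernel: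
  assumes "f ` lists S \<subseteq> F" "finite F" "card F \<le> N"
    and "\<And>u u'. u \<in> lists S \<Longrightarrow> u' \<in> lists S \<Longrightarrow> f u = f u' \<Longrightarrow> residual S X u = residual S X u'"
  shows "index_le S X N"
proof -
  define g where "g y = residual S X (SOME u. u \<in> lists S \<and> f u = y)" for y
  have g: "residual S X u = g (f u)" if u: "u \<in> lists S" for u
  proof -
    have "(SOME v. v \<in> lists S \<and> f v = f u) \<in> lists S \<and> f (SOME v. v \<in> lists S \<and> f v = f u) = f u"
      by (rule someI[of "\<lambda>v. v \<in> lists S \<and> f v = f u" u]) (use u in blast)
    then show ?thesis unfolding g_def by (intro assms(4) u) (blast, metis)
  qed
  have sub: "residual S X ` lists S \<subseteq> g ` F"
  proof
    fix R assume "R \<in> residual S X ` lists S"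
    then obtain u where "u \<in> lists S" "R = residual S X u" by blast
    then show "R \<in> g ` F" using g[of u] assms(1) by blast
  qed
  have "finite (g ` F)" using assms(2) by blast
  then have "card (residual S X ` lists S) \<le> card (g ` F)" using sub by (rule card_mono)
  also have "\<dots> \<le> card F" using assms(2) by (rule card_image_le)
  also note assms(3)
  finally show ?thesis
    unfolding index_le_def using finite_subset[OF sub \<open>finite (g ` F)\<close>] by blast
qed

lemma index_leD_kernel:
  assumes "index_le S X N"
  obtains F where "\<forall>w\<in>lists S. residual S X w \<in> F" "finite F" "card F \<le> N"
  using that[of "residual S X ` lists S"] assms unfolding index_le_def by blast

lemma index_le_mono: "index_le S X N \<Longrightarrow> N \<le> N' \<Longrightarrow> index_le S X N'"
  unfolding index_le_def by auto

text \<open>Over the smaller alphabet the residuals are the old ones intersected with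
  \<open>lists S'\<close>. This passes from a box of letters to the alphabet of the given
  language.\<close>

lemma index_le_subset:
  assumes "index_le S X N" "S' \<subseteq> S"
  shows "index_le S' X N"
proof -
  obtain F where F: "\<forall>w\<in>lists S. residual S X w \<in> F" "finite F" "card F \<le> N"
    by (rule index_leD_kernel[OF assms(1)])
  show ?thesis
  proof (rule index_le_if_kernel[of "residual S X" S' F])
    show "residual S X ` lists S' \<subseteq> F" using F(1) lists_mono[OF assms(2)] by blast
    fix u u' assume "residual S X u = residual S X u'"
    moreover have "residual S' X v = residual S X v \<inter> lists S'" for v
      using lists_mono[OF assms(2)] by (auto simp: residual_def)
    ultimately show "residual S' X u = residual S' X u'" by simp
  qed (use F in auto)
qed

lemma repeat_if_card_le:
  assumes "finite F" "card F \<le> N" "\<And>i. i \<le> N \<Longrightarrow> h i \<in> F"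
  obtains i j where "i < j" "j \<le> N" "h i = h j"
proof -
  have "\<not> inj_on h {..N}"
  proof
    assume "inj_on h {..N}"
    then have "card (h ` {..N}) = Suc N" by (simp add: card_image)
    moreover have "card (h ` {..N}) \<le> card F" using assms by (intro card_mono) auto
    ultimately show False using assms(2) by simp
  qed
  then obtain i j where "i \<le> N" "j \<le> N" "h i = h j" "i \<noteq> j" by (auto simp: inj_on_def)
  then show thesis using that[of i j] that[of j i] by (cases "i < j") auto
qed

text \<open>Cutting out the part between two repetitions of \<open>h\<close> shortens a word without changing the
  predicate.\<close>

lemma short_word:
  assumes F: "finite F" "card F \<le> N" and h: "\<And>w i. P w \<Longrightarrow> b \<le> i \<Longrightarrow> i \<le> length w \<Longrightarrow> h w i \<in> F"
    and cut: "\<And>w i j. P w \<Longrightarrow> b \<le> i \<Longrightarrow> i < j \<Longrightarrow> j \<le> length w \<Longrightarrow> h w i = h w j \<Longrightarrow> P (take i w @ drop j w)"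
    and "P w"
  obtains w' where "P w'" "length w' < b + N"
proof -
  define w' where "w' = arg_min length P"
  have "P w'" unfolding w'_def by (rule arg_min_natI[where P = P, OF \<open>P w\<close>])
  have min: "length w' \<le> length v" if "P v" for v unfolding w'_def by (rule arg_min_nat_le[where P = P, OF that])
  have "length w' < b + N"
  proof (rule ccontr)
    assume long: "\<not> length w' < b + N"
    obtain i j where ij: "i < j" "j \<le> N" "h w' (b + i) = h w' (b + j)"
      using repeat_if_card_le[OF F, of "\<lambda>i. h w' (b + i)"] h[OF \<open>P w'\<close>] long
      by (metis add_le_cancel_left le_add1 le_trans not_less)
    then have "P (take (b + i) w' @ drop (b + j) w')"
      using cut[OF \<open>P w'\<close>, of "b + i" "b + j"] long by auto
    from min[OF this] show False using ij long by auto
  qed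
  with \<open>P w'\<close> show thesis by (rule that)
qed

lemma short_representative:
  assumes "index_le S X N" "u \<in> lists S"
  obtains u' where "u' \<in> lists S" "length u' < N" "residual S X u' = residual S X u"
proof -
  obtain F where F: "\<forall>w\<in>lists S. residual S X w \<in> F" "finite F" "card F \<le> N"
    by (rule index_leD_kernel[OF assms(1)])
  let ?P = "\<lambda>w. w \<in> lists S \<and> residual S X w = residual S X u"
  obtain w' where "?P w'" "length w' < 0 + N"
  proof (rule short_word[of F N ?P 0 "\<lambda>w i. residual S X (take i w)" u])
    show "residual S X (take i w) \<in> F" if "?P w" for w i
      using that F(1)[rule_format, of "take i w"] by (auto dest: in_set_takeD)
    fix w i j assume w: "?P w" and ij: "i < j" "j \<le> length w"
      and eq: "residual S X (take i w) = residual S X (take j w)"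
    have "drop j w \<in> lists S" "take i w \<in> lists S"
      using w by (auto dest: in_set_takeD in_set_dropD)
    then show "?P (take i w @ drop j w)" using residual_append[OF eq, of "drop j w"] w by auto
  qed (use F assms in auto)
  then show thesis using that[of w'] by simp
qed

text \<open>The cut must preserve the behaviour of both words at once, so repetitions are sought
  among pairs of residuals. This is the origin of \<open>N * N\<close>, and of the squared word
  length in the final automaton.\<close>

lemma short_distinguishing:
  assumes "index_le S X N" "u \<in> lists S" "u' \<in> lists S" "residual S X u \<noteq> residual S X u'"
  obtains w where "w \<in> lists S" "length w < N * N" "(u @ w \<in> X) \<noteq> (u' @ w \<in> X)"
proof -
  obtain F where F: "\<forall>w\<in>lists S. residual S X w \<in> F" "finite F" "card F \<le> N"
    by (rule index_leD_kernel[OF assms(1)])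
  let ?P = "\<lambda>w. w \<in> lists S \<and> (u @ w \<in> X) \<noteq> (u' @ w \<in> X)"
  obtain w0 where w0: "?P w0" using assms(4) by (auto simp: residual_def)
  obtain w' where "?P w'" "length w' < 0 + N * N"
  proof (rule short_word[of "F \<times> F" "N * N" ?P 0
        "\<lambda>w i. (residual S X (u @ take i w), residual S X (u' @ take i w))" w0])
    show "card (F \<times> F) \<le> N * N" using F by (simp add: card_cartesian_product mult_le_mono)
    show "(residual S X (u @ take i w), residual S X (u' @ take i w)) \<in> F \<times> F" if "?P w" for w i
    proof -
      have "take i w \<in> lists S" using that by (auto dest: in_set_takeD)
      then show ?thesis using F(1)[rule_format, of "u @ take i w"] F(1)[rule_format, of "u' @ take i w"] assms(2,3) by simp
    qed
    fix w i j assume w: "?P w" and ij: "i < j" "j \<le> length w"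
      and eq: "(residual S X (u @ take i w), residual S X (u' @ take i w)) =
        (residual S X (u @ take j w), residual S X (u' @ take j w))"
    have l: "drop j w \<in> lists S" "take i w \<in> lists S"
      using w by (auto dest: in_set_takeD in_set_dropD)
    have "u @ take i w @ drop j w \<in> X \<longleftrightarrow> u @ w \<in> X" "u' @ take i w @ drop j w \<in> X \<longleftrightarrow> u' @ w \<in> X"
      using eq residual_mem[OF residual_append[OF _ l(1)], of X "u @ take i w" "u @ take j w"]
        residual_mem[OF residual_append[OF _ l(1)], of X "u' @ take i w" "u' @ take j w"]
      by simp_all
    then show "?P (take i w @ drop j w)" using w l by auto
  qed (use F w0 in auto)
  then show thesis using that[of w'] by simp
qed

section \<open>Universality and its bounded tests\<close>

definition universal :: "'a set \<Rightarrow> 'a list set \<Rightarrow> 'a list \<Rightarrow> bool" where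
  "universal S X u \<longleftrightarrow> (\<forall>w\<in>lists S. u @ w \<in> X)"

lemma universal_residual: "residual S X u = residual S X u' \<Longrightarrow> universal S X u = universal S X u'"
  by (auto simp: universal_def residual_def set_eq_iff)

lemma universal_append: "universal S X u \<Longrightarrow> w \<in> lists S \<Longrightarrow> universal S X (u @ w)"
  by (simp add: universal_def)

text \<open>A shortest failing extension runs through pairwise different residuals, so it has fewer
  than N letters.\<close>

lemma universal_short:
  assumes "index_le S X N" "u \<in> lists S"
    and "\<And>w. w \<in> lists S \<Longrightarrow> length w < N \<Longrightarrow> u @ w \<in> X"
  shows "universal S X u"
proof (rule ccontr)
  assume "\<not> universal S X u"
  obtain F where F: "\<forall>w\<in>lists S. residual S X w \<in> F" "finite F" "card F \<le> N"
    by (rule index_leD_kernel[OF assms(1)])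
  let ?P = "\<lambda>w. w \<in> lists S \<and> u @ w \<notin> X"
  obtain w0 where w0: "?P w0" using \<open>\<not> universal S X u\<close> by (auto simp: universal_def)
  obtain w' where "?P w'" "length w' < 0 + N"
  proof (rule short_word[of F N ?P 0 "\<lambda>w i. residual S X (u @ take i w)" w0])
    show "residual S X (u @ take i w) \<in> F" if "?P w" for w i
    proof -
      have "take i w \<in> lists S" using that by (auto dest: in_set_takeD)
      then show ?thesis using F(1)[rule_format, of "u @ take i w"] assms(2) by simp
    qed
    fix w i j assume w: "?P w" and ij: "i < j" "j \<le> length w"
      and eq: "residual S X (u @ take i w) = residual S X (u @ take j w)"
    have l: "drop j w \<in> lists S" "take i w \<in> lists S"
      using w by (auto dest: in_set_takeD in_set_dropD)
    have "u @ take i w @ drop j w \<in> X \<longleftrightarrow> u @ w \<in> X"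
      using residual_mem[OF residual_append[OF eq l(1)]] by simp
    then show "?P (take i w @ drop j w)" using w l by auto
  qed (use F w0 in auto)
  then show False using assms(3)[of w'] by simp
qed

text \<open>A shortest power of z that makes u universal has fewer than N letters, and universality
  survives further letters. Hence an unknown number of zeros can be replaced by the fixed number
  N.\<close>

lemma universal_replicate:
  assumes "index_le S X N" "u \<in> lists S" "z \<in> S" "universal S X (u @ replicate k z)"
  shows "universal S X (u @ replicate N z)"
proof -
  obtain F where F: "\<forall>w\<in>lists S. residual S X w \<in> F" "finite F" "card F \<le> N"
    by (rule index_leD_kernel[OF assms(1)])
  let ?P = "\<lambda>w. set w \<subseteq> {z} \<and> universal S X (u @ w)"
  have S: "w \<in> lists S" if "set w \<subseteq> {z}" for w using that assms(3) by auto
  obtain w' where w': "?P w'" "length w' < 0 + N"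
  proof (rule short_word[of F N ?P 0 "\<lambda>w i. residual S X (u @ take i w)" "replicate k z"])
    show "residual S X (u @ take i w) \<in> F" if "?P w" for w i
    proof -
      have "take i w \<in> lists S" using that S by (auto dest!: in_set_takeD)
      then show ?thesis using F(1)[rule_format, of "u @ take i w"] assms(2) by simp
    qed
    fix w i j assume w: "?P w" and ij: "i < j" "j \<le> length w"
      and eq: "residual S X (u @ take i w) = residual S X (u @ take j w)"
    have l: "drop j w \<in> lists S" "set (take i w @ drop j w) \<subseteq> {z}"
      using w S by (auto dest!: in_set_takeD in_set_dropD)
    have "universal S X (u @ take i w @ drop j w) = universal S X (u @ w)"
      using universal_residual[OF residual_append[OF eq l(1)]] by simp
    then show "?P (take i w @ drop j w)" using w l by auto
  qed (use F assms in auto)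
  then have "w' = replicate (length w') z" by (intro replicate_eqI) auto
  then have "u @ replicate N z = (u @ w') @ replicate (N - length w') z"
    using w'(2) by (metis append.assoc add_0 le_add_diff_inverse less_imp_le replicate_add)
  then show ?thesis using universal_append[of S X "u @ w'"] w'(1) assms(3)
    by (simp add: in_lists_conv_set)
qed

section \<open>The Nerode automaton on short words\<close>

definition words_upto :: "'a list \<Rightarrow> nat \<Rightarrow> 'a list list" where
  "words_upto As N = concat (map (\<lambda>n. List.n_lists n As) [0..<Suc N])"

lemma set_words_upto: "set (words_upto As N) = {w \<in> lists (set As). length w \<le> N}"
  by (auto simp: words_upto_def set_n_lists simp del: upt_Suc)

text \<open>A residual may own many states: all short words are states, and a transition leads to
  every state of the right class, which avoids choosing representatives. The same words serve as
  tests, so only finitely many values of \<open>X\<close> are inspected.\<close>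

definition nerode_automaton :: "'a list \<Rightarrow> nat \<Rightarrow> ('a list \<Rightarrow> bool) \<Rightarrow> 'a automaton" where
  "nerode_automaton As N X =
    (let W = words_upto As N; E = List.enumerate 0 W; eqv = (\<lambda>u u'. \<forall>w\<in>set W. X (u @ w) \<longleftrightarrow> X (u' @ w)) in
     \<lparr>num_states = length W, alphabet = As,
      initials = map fst (filter (\<lambda>(i, u). eqv [] u) E),
      transitions = concat (map (\<lambda>(i, u). concat (map (\<lambda>a.
         map (\<lambda>(j, v). (i, a, j)) (filter (\<lambda>(j, v). eqv (u @ [a]) v) E)) As)) E),
      finals = map fst (filter (\<lambda>(i, u). X u) E)\<rparr>)"

lemma in_set_enumerate_0: "(i, u) \<in> set (List.enumerate 0 W) \<longleftrightarrow> i < length W \<and> u = W ! i"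
  by (auto simp: in_set_enumerate_eq)

lemma in_fst_filter_enumerate:
  "i \<in> set (map fst (filter (\<lambda>(i, u). R u) (List.enumerate 0 W))) \<longleftrightarrow> i < length W \<and> R (W ! i)"
  by (force simp: in_set_enumerate_0 image_iff)

lemma in_concat_map_pairs:
  "y \<in> set (concat (map f E)) \<longleftrightarrow> (\<exists>i u. (i, u) \<in> set E \<and> y \<in> set (f (i, u)))"
  by auto

lemma in_transitions_enumerate:
  "(i, a, j) \<in> set (concat (map (\<lambda>(i, u). concat (map (\<lambda>a.
       map (\<lambda>(j, v). (i, a, j)) (filter (\<lambda>(j, v). R u a v) (List.enumerate 0 W))) As)) (List.enumerate 0 W)))
    \<longleftrightarrow> i < length W \<and> a \<in> set As \<and> j < length W \<and> R (W ! i) a (W ! j)"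
  (is "_ \<in> set (concat (map ?f ?E)) \<longleftrightarrow> _")
proof -
  have "(i, a, j) \<in> set (?f (i', u)) \<longleftrightarrow> i' = i \<and> a \<in> set As \<and> j < length W \<and> R u a (W ! j)" for i' u
    by (force simp: in_set_enumerate_0 image_iff)
  note f = this
  have "(i, a, j) \<in> set (concat (map ?f ?E)) \<longleftrightarrow> (\<exists>i' u. (i', u) \<in> set ?E \<and> (i, a, j) \<in> set (?f (i', u)))"
    by (rule in_concat_map_pairs)
  also have "\<dots> \<longleftrightarrow> (\<exists>u. (i, u) \<in> set ?E \<and> a \<in> set As \<and> j < length W \<and> R u a (W ! j))"
    unfolding f by blast
  finally show ?thesis unfolding in_set_enumerate_0 by blast
qed

lemma
  fixes As :: "'a list" and X :: "'a list \<Rightarrow> bool" and N :: nat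
  defines "W \<equiv> words_upto As N" and "B \<equiv> nerode_automaton As N X"
  shows num_states_nerode: "num_states B = length W"
    and alphabet_nerode: "alphabet B = As"
    and initials_nerode: "i \<in> set (initials B) \<longleftrightarrow> i < length W \<and> (\<forall>w\<in>set W. X w \<longleftrightarrow> X (W ! i @ w))"
    and finals_nerode: "i \<in> set (finals B) \<longleftrightarrow> i < length W \<and> X (W ! i)"
    and transitions_nerode: "(i, a, j) \<in> set (transitions B) \<longleftrightarrow> i < length W \<and> a \<in> set As \<and>
      j < length W \<and> (\<forall>w\<in>set W. X ((W ! i @ [a]) @ w) \<longleftrightarrow> X (W ! j @ w))"
  unfolding B_def W_def nerode_automaton_def Let_def automaton.select_convs
    in_fst_filter_enumerate in_transitions_enumerate by simp_all

lemma automaton_over_nerode: "automaton_over (set As) (nerode_automaton As N X)"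
  unfolding automaton_over_def
  by (auto simp: num_states_nerode alphabet_nerode initials_nerode finals_nerode transitions_nerode)

text \<open>Suffixes shorter than \<open>N0 * N0\<close> separate different residuals, and words
  shorter than \<open>N0\<close> represent all of them; N admits both. Along a path the state
  reached then has the residual of the word read.\<close>

lemma recognized_nerode:
  assumes X: "X \<subseteq> lists (set As)" and N: "index_le (set As) X N0" "N0 * N0 \<le> N"
  shows "recognized (nerode_automaton As N (\<lambda>w. w \<in> X)) = X"
proof -
  let ?S = "set As" and ?r = "residual (set As) X"
  define W where "W = words_upto As N"
  have W: "set W = {w \<in> lists ?S. length w \<le> N}" unfolding W_def by (rule set_words_upto)
  have nth_W: "W ! i \<in> lists ?S" if "i < length W" for i using nth_mem[OF that] W by auto
  let ?B = "nerode_automaton As N (\<lambda>w. w \<in> X)"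
  let ?T = "set (transitions ?B)"
  have eqv: "(\<forall>w\<in>set W. u @ w \<in> X \<longleftrightarrow> u' @ w \<in> X) \<longleftrightarrow> ?r u = ?r u'"
    if uu': "u \<in> lists ?S" "u' \<in> lists ?S" for u u'
  proof
    assume *: "\<forall>w\<in>set W. u @ w \<in> X \<longleftrightarrow> u' @ w \<in> X"
    show "?r u = ?r u'"
    proof (rule ccontr)
      assume "?r u \<noteq> ?r u'"
      then obtain w where "w \<in> lists ?S" "length w < N0 * N0" "(u @ w \<in> X) \<noteq> (u' @ w \<in> X)"
        by (rule short_distinguishing[OF N(1) uu'])
      then show False using * W N(2) by auto
    qed
  next
    assume *: "?r u = ?r u'"
    show "\<forall>w\<in>set W. u @ w \<in> X \<longleftrightarrow> u' @ w \<in> X"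
      using residual_mem[OF residual_append[OF *]] W by auto
  qed
  have rep: "\<exists>i<length W. ?r (W ! i) = ?r u" if u: "u \<in> lists ?S" for u
  proof -
    obtain u' where "u' \<in> lists ?S" "length u' < N0" "?r u' = ?r u"
      by (rule short_representative[OF N(1) u])
    moreover have "N0 \<le> N" using N(2) le_square le_trans by blast
    ultimately have "u' \<in> set W" using W by auto
    then show ?thesis using \<open>?r u' = ?r u\<close> by (metis in_set_conv_nth)
  qed
  have ini: "set (initials ?B) = {i. i < length W \<and> ?r [] = ?r (W ! i)}"
  proof -
    have "(\<forall>w\<in>set W. w \<in> X \<longleftrightarrow> W ! i @ w \<in> X) \<longleftrightarrow> ?r [] = ?r (W ! i)" if "i < length W" for i
      using eqv[OF lists.Nil nth_W[OF that]] by simp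
    then show ?thesis unfolding W_def initials_nerode set_eq_iff mem_Collect_eq by blast
  qed
  have fin: "set (finals ?B) = {i. i < length W \<and> W ! i \<in> X}"
    unfolding W_def set_eq_iff finals_nerode by simp
  have trans: "(i, a, j) \<in> ?T \<longleftrightarrow> i < length W \<and> a \<in> ?S \<and> j < length W \<and> ?r (W ! i @ [a]) = ?r (W ! j)"
    for i a j
  proof -
    have "W ! i @ [a] \<in> lists ?S" if "i < length W" "a \<in> ?S" using nth_W[OF that(1)] that(2) by simp
    then show ?thesis unfolding transitions_nerode W_def[symmetric] using eqv nth_W by blast
  qed
  have sound: "j < length W \<and> w \<in> lists ?S \<and> ?r (W ! i @ w) = ?r (W ! j)"
    if "path ?T i w j" "i < length W" for i w j
    using that
  proof (induction w arbitrary: i)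
    case (Cons a w)
    then obtain k where k: "(i, a, k) \<in> ?T" "path ?T k w j" by auto
    have k': "k < length W" "a \<in> ?S" "?r (W ! i @ [a]) = ?r (W ! k)" using k(1) trans by auto
    have IH: "j < length W" "w \<in> lists ?S" "?r (W ! k @ w) = ?r (W ! j)"
      using Cons.IH[OF k(2) k'(1)] by auto
    then show ?case using residual_append[OF k'(3) IH(2)] k'(2) by simp
  qed simp
  have complete: "\<exists>j. path ?T i w j" if "w \<in> lists ?S" "i < length W" for i w
    using that
  proof (induction w arbitrary: i)
    case (Cons a w)
    then obtain k where "k < length W" "?r (W ! k) = ?r (W ! i @ [a])"
      using rep[of "W ! i @ [a]"] nth_W by auto
    moreover from this obtain j where "path ?T k w j" using Cons.IH[of k] Cons.prems by auto
    ultimately have "path ?T i (a # w) j" using Cons trans[of i a k] by auto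
    then show ?case by blast
  qed auto
  show ?thesis
  proof (intro equalityI subsetI)
    fix w assume "w \<in> recognized ?B"
    then obtain i j where ij: "i \<in> set (initials ?B)" "j \<in> set (finals ?B)" "path ?T i w j"
      unfolding recognized_def by blast
    then have i: "i < length W" "?r [] = ?r (W ! i)" and j: "W ! j \<in> X" using ini fin by auto
    from sound[OF ij(3) i(1)] have w: "w \<in> lists ?S" "?r (W ! i @ w) = ?r (W ! j)" by auto
    then show "w \<in> X" using residual_append[OF i(2)[symmetric] w(1)] residual_mem[of ?S X w "W ! j"] j by simp
  next
    fix w assume w: "w \<in> X"
    then have wS: "w \<in> lists ?S" using X by auto
    obtain i where i: "i < length W" "?r (W ! i) = ?r []" using rep[of "[]"] by auto
    obtain j where j: "path ?T i w j" using complete[OF wS i(1)] by auto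
    from sound[OF j i(1)] have "j < length W" "?r (W ! i @ w) = ?r (W ! j)" by auto
    then have "W ! j \<in> X" using residual_append[OF i(2) wS] residual_mem[of ?S X w "W ! j"] w by simp
    then have "i \<in> set (initials ?B)" "j \<in> set (finals ?B)" using i \<open>j < length W\<close> ini fin by auto
    with j show "w \<in> recognized ?B" unfolding recognized_def by blast
  qed
qed

section \<open>Word values\<close>

definition int_box :: "nat \<Rightarrow> nat \<Rightarrow> int vec set" where
  "int_box d r = {x \<in> carrier_vec d. \<forall>i<d. \<bar>x $ i\<bar> \<le> int r}"

text \<open>A crude integral bound for the norm of M with respect to the sup norm.\<close>

definition mat_size :: "int mat \<Rightarrow> nat" where
  "mat_size M = (\<Sum>i<dim_row M. \<Sum>j<dim_col M. nat \<bar>M $$ (i, j)\<bar>)"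

text \<open>Strictness excludes zero entries. In positive dimension the zero vector is thus related
  to nothing, which is what forbids a return to 0.\<close>

definition same_sign :: "nat \<Rightarrow> int vec \<Rightarrow> int vec \<Rightarrow> bool" where
  "same_sign d x y \<longleftrightarrow> (\<forall>i<d. 0 < x $ i * y $ i)"

text \<open>The entries are halved towards 0, so that signs are never reversed.\<close>

definition half :: "int vec \<Rightarrow> int vec" where
  "half x = vec (dim_vec x) (\<lambda>i. sgn (x $ i) * (\<bar>x $ i\<bar> div 2))"

lemma int_box_carrier: "x \<in> int_box d r \<Longrightarrow> x \<in> carrier_vec d"
  by (simp add: int_box_def)

lemma int_box_mono: "r \<le> s \<Longrightarrow> int_box d r \<subseteq> int_box d s"
  by (force simp: int_box_def)

lemma zero_in_int_box [simp]: "0\<^sub>v d \<in> int_box d r"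
  by (simp add: int_box_def)

lemma add_in_int_box: "x \<in> int_box d r \<Longrightarrow> y \<in> int_box d s \<Longrightarrow> x + y \<in> int_box d (r + s)"
  by (force simp: int_box_def)

lemma in_int_box_iff_list:
  "x \<in> int_box d r \<longleftrightarrow> list_of_vec x \<in> {xs. set xs \<subseteq> {- int r..int r} \<and> length xs = d}"
proof -
  have "set (list_of_vec x) \<subseteq> {- int r..int r} \<longleftrightarrow> (\<forall>i<dim_vec x. \<bar>x $ i\<bar> \<le> int r)"
    unfolding subset_code(1) all_set_conv_all_nth list_of_vec_index length_list_of_vec atLeastAtMost_iff
      abs_le_iff by (simp add: minus_le_iff conj_commute)
  then show ?thesis unfolding int_box_def carrier_vec_def mem_Collect_eq by auto
qed

lemma card_int_box: "finite (int_box d r) \<and> card (int_box d r) = (2 * r + 1) ^ d"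
proof -
  let ?X = "{xs. set xs \<subseteq> {- int r..int r} \<and> length xs = d}"
  have bij: "bij_betw list_of_vec (int_box d r) ?X"
  proof (rule bij_betw_byWitness[where f' = vec_of_list])
    show "list_of_vec ` int_box d r \<subseteq> ?X" using in_int_box_iff_list by blast
    have "vec_of_list xs \<in> int_box d r" if "xs \<in> ?X" for xs
      using that unfolding in_int_box_iff_list list_vec .
    then show "vec_of_list ` ?X \<subseteq> int_box d r" by blast
  qed (simp_all add: vec_list list_vec)
  have "nat (2 * int r + 1) = 2 * r + 1" by linarith
  then have "finite ?X" "card ?X = (2 * r + 1) ^ d"
    using finite_lists_length_eq[of "{- int r..int r}" d] card_lists_length_eq[of "{- int r..int r}" d]
    by simp_all
  then show ?thesis using bij_betw_finite[OF bij] bij_betw_same_card[OF bij] by simp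
qed

declare index_mult_mat_vec [simp del]

locale int_matrix =
  fixes d :: nat and M :: "int mat"
  assumes M_carrier [simp]: "M \<in> carrier_mat d d"
begin

abbreviation Q :: "int vec list \<Rightarrow> int vec" where "Q \<equiv> word_value M"
abbreviation box :: "nat \<Rightarrow> int vec set" where "box \<equiv> int_box d"

lemma dim_M [simp]: "dim_row M = d" "dim_col M = d"
  by (rule carrier_matD[OF M_carrier])+

lemma pow_M_carrier [simp]: "M ^\<^sub>m k \<in> carrier_mat d d"
  by simp

lemma mult_M_carrier [simp]: "x \<in> carrier_vec d \<Longrightarrow> M *\<^sub>v x \<in> carrier_vec d"
  by (rule mult_mat_vec_carrier[OF M_carrier])

lemma pow_M_mult_carrier [simp]: "x \<in> carrier_vec d \<Longrightarrow> M ^\<^sub>m k *\<^sub>v x \<in> carrier_vec d"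
  by (rule mult_mat_vec_carrier[OF pow_M_carrier])

lemma pow_M_Suc: "M ^\<^sub>m Suc k = M * M ^\<^sub>m k"
proof (induction k)
  case (Suc k)
  have "M ^\<^sub>m Suc (Suc k) = (M * M ^\<^sub>m k) * M" using Suc by simp
  then show ?case by (simp add: assoc_mult_mat[of _ d d _ d _ d])
qed simp

lemma pow_M_Suc_mult: "x \<in> carrier_vec d \<Longrightarrow> M ^\<^sub>m Suc k *\<^sub>v x = M *\<^sub>v (M ^\<^sub>m k *\<^sub>v x)"
  unfolding pow_M_Suc by (simp add: assoc_mult_mat_vec[of _ d d _ d])

lemma index_mult_M:
  "x \<in> carrier_vec d \<Longrightarrow> i < d \<Longrightarrow> (M *\<^sub>v x) $ i = (\<Sum>j<d. M $$ (i, j) * x $ j)"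
  by (auto simp: index_mult_mat_vec scalar_prod_def atLeast0LessThan intro!: sum.cong)

lemma Q_carrier [simp]: "u \<in> lists (carrier_vec d) \<Longrightarrow> Q u \<in> carrier_vec d"
  unfolding word_value_def dim_M by (rule finsum_vec_closed) (auto simp: in_lists_conv_set all_set_conv_all_nth)

lemma Q_index:
  assumes "u \<in> lists (carrier_vec d)" "i < d"
  shows "Q u $ i = (\<Sum>k<length u. (M ^\<^sub>m k *\<^sub>v (u ! k)) $ i)"
  unfolding word_value_def dim_M using assms by (subst index_finsum_vec) (auto simp: in_lists_conv_set all_set_conv_all_nth)

lemma Q_Nil [simp]: "Q [] = 0\<^sub>v d"
  by (rule eq_vecI) (use Q_index[of "[]"] Q_carrier[of "[]"] in auto)

lemma Q_Cons:
  assumes a: "a \<in> carrier_vec d" and u: "u \<in> lists (carrier_vec d)"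
  shows "Q (a # u) = a + M *\<^sub>v Q u"
proof (rule eq_vecI)
  have c: "Q (a # u) \<in> carrier_vec d" "Q u \<in> carrier_vec d" using a u by auto
  then show "dim_vec (Q (a # u)) = dim_vec (a + M *\<^sub>v Q u)" by simp
  fix i assume "i < dim_vec (a + M *\<^sub>v Q u)"
  then have i: "i < d" by simp
  have uk: "u ! k \<in> carrier_vec d" if "k < length u" for k using u that by auto
  have "Q (a # u) $ i = (\<Sum>k<Suc (length u). (M ^\<^sub>m k *\<^sub>v ((a # u) ! k)) $ i)"
    using Q_index[of "a # u" i] a u i by simp
  also have "\<dots> = a $ i + (\<Sum>k<length u. (M ^\<^sub>m Suc k *\<^sub>v (u ! k)) $ i)"
    using a by (subst sum.lessThan_Suc_shift) simp
  also have "(\<Sum>k<length u. (M ^\<^sub>m Suc k *\<^sub>v (u ! k)) $ i) =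
      (\<Sum>k<length u. \<Sum>j<d. M $$ (i, j) * (M ^\<^sub>m k *\<^sub>v (u ! k)) $ j)"
  proof (rule sum.cong[OF refl])
    fix k assume "k \<in> {..<length u}"
    then have k: "u ! k \<in> carrier_vec d" using uk by simp
    then have "M ^\<^sub>m k *\<^sub>v u ! k \<in> carrier_vec d" by (metis mult_mat_vec_carrier pow_M_carrier)
    then show "(M ^\<^sub>m Suc k *\<^sub>v (u ! k)) $ i = (\<Sum>j<d. M $$ (i, j) * (M ^\<^sub>m k *\<^sub>v (u ! k)) $ j)"
      unfolding pow_M_Suc_mult[OF k] using i by (rule index_mult_M)
  qed
  also have "\<dots> = (\<Sum>j<d. M $$ (i, j) * (\<Sum>k<length u. (M ^\<^sub>m k *\<^sub>v (u ! k)) $ j))"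
    by (subst sum.swap) (simp add: sum_distrib_left)
  also have "\<dots> = (\<Sum>j<d. M $$ (i, j) * Q u $ j)"
    by (rule sum.cong) (use Q_index[OF u] in auto)
  also have "\<dots> = (M *\<^sub>v Q u) $ i" by (rule index_mult_M[symmetric]) (use c i in auto)
  finally show "Q (a # u) $ i = (a + M *\<^sub>v Q u) $ i" using i c by simp
qed

lemma Q_append:
  assumes "u \<in> lists (carrier_vec d)" "w \<in> lists (carrier_vec d)"
  shows "Q (u @ w) = Q u + M ^\<^sub>m length u *\<^sub>v Q w"
  using assms(1)
proof (induction u)
  case Nil
  then show ?case using assms(2) by simp
next
  case (Cons a u)
  let ?y = "M ^\<^sub>m length u *\<^sub>v Q w"
  have y: "?y \<in> carrier_vec d" using assms(2) by (metis Q_carrier mult_mat_vec_carrier pow_M_carrier)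
  have c: "a \<in> carrier_vec d" "Q u \<in> carrier_vec d" "M *\<^sub>v Q u \<in> carrier_vec d" "M *\<^sub>v ?y \<in> carrier_vec d"
    using Cons y by auto
  have "Q ((a # u) @ w) = a + M *\<^sub>v (Q u + ?y)" using Cons assms(2) by (simp add: Q_Cons)
  also have "\<dots> = a + (M *\<^sub>v Q u + M *\<^sub>v ?y)"
    using c y by (simp add: mult_add_distrib_mat_vec[of _ d d])
  also have "\<dots> = (a + M *\<^sub>v Q u) + M *\<^sub>v ?y" using c by (simp add: assoc_add_vec[of _ d])
  also have "M *\<^sub>v ?y = M ^\<^sub>m Suc (length u) *\<^sub>v Q w"
    by (rule pow_M_Suc_mult[symmetric]) (use assms(2) in simp)
  finally show ?case using Cons by (simp add: Q_Cons)
qed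

lemma Q_replicate_zero: "Q (replicate k (0\<^sub>v d)) = 0\<^sub>v d"
proof (induction k)
  case (Suc k)
  have "M *\<^sub>v 0\<^sub>v d = 0\<^sub>v d" by (rule eq_vecI) (auto simp: index_mult_M)
  with Suc show ?case by (subst replicate_Suc, subst Q_Cons) (auto simp: in_lists_conv_set all_set_conv_all_nth)
qed simp

lemma lists_box: "t \<in> lists (box r) \<Longrightarrow> t \<in> lists (carrier_vec d)"
  using int_box_carrier by fastforce

lemma mult_M_bound:
  assumes x: "x \<in> box r" and i: "i < d"
  shows "\<bar>(M *\<^sub>v x) $ i\<bar> \<le> int (mat_size M * r)"
proof -
  have "\<bar>(M *\<^sub>v x) $ i\<bar> \<le> (\<Sum>j<d. \<bar>M $$ (i, j) * x $ j\<bar>)"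
    using x i by (simp add: index_mult_M int_box_def sum_abs)
  also have "\<dots> \<le> (\<Sum>j<d. \<bar>M $$ (i, j)\<bar> * int r)"
    using x by (intro sum_mono) (auto simp: int_box_def abs_mult intro!: mult_left_mono)
  also have "\<dots> = (\<Sum>j<d. \<bar>M $$ (i, j)\<bar>) * int r" by (simp add: sum_distrib_right)
  also have "\<dots> \<le> int (mat_size M) * int r"
  proof (rule mult_right_mono)
    have "(\<Sum>j<d. \<bar>M $$ (i, j)\<bar>) \<le> (\<Sum>i<d. \<Sum>j<d. \<bar>M $$ (i, j)\<bar>)"
      using i by (intro member_le_sum[of i "{..<d}" "\<lambda>i. \<Sum>j<d. \<bar>M $$ (i, j)\<bar>"]) (auto intro: sum_nonneg)
    then show "(\<Sum>j<d. \<bar>M $$ (i, j)\<bar>) \<le> int (mat_size M)" by (simp add: mat_size_def)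
  qed simp
  finally show ?thesis by simp
qed

fun half_word :: "int vec list \<Rightarrow> int vec list" where
  "half_word [] = []"
| "half_word (a # t) = (half (Q (a # t)) - M *\<^sub>v half (Q t)) # half_word t"

lemma half_carrier [simp]: "x \<in> carrier_vec d \<Longrightarrow> half x \<in> carrier_vec d"
  unfolding half_def carrier_vec_def by simp

lemma half_index: "x \<in> carrier_vec d \<Longrightarrow> i < d \<Longrightarrow> half x $ i = sgn (x $ i) * (\<bar>x $ i\<bar> div 2)"
  unfolding half_def carrier_vec_def by simp

text \<open>The letters of \<open>half_word\<close> are dictated by the halved suffix values; the
  point is their size. Write x = 2 half x + e x with the entries of e x in {-1, 0, 1}. Then y = a +
  M z gives 2 (half y - M half z) = a + M (e z) - e y, with entries at most r + mat_size M + 1,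
  hence at most 2 r.\<close>

lemma half_word:
  assumes "t \<in> lists (box r)" "mat_size M + 1 \<le> r"
  shows "half_word t \<in> lists (box r) \<and> Q (half_word t) = half (Q t)"
  using assms(1)
proof (induction t)
  case Nil
  have "half (0\<^sub>v d) = 0\<^sub>v d" by (rule eq_vecI) (auto simp: half_def)
  then show ?case by simp
next
  case (Cons a t)
  let ?y = "Q (a # t)" and ?z = "Q t"
  let ?c = "half ?y - M *\<^sub>v half ?z"
  have a: "a \<in> box r" "a \<in> carrier_vec d" and t: "t \<in> lists (carrier_vec d)"
    using Cons.hyps(1) Cons.hyps(2) int_box_carrier lists_box by auto
  have y: "?y = a + M *\<^sub>v ?z" "?y \<in> carrier_vec d" "?z \<in> carrier_vec d" using a t by (auto simp: Q_Cons)
  define e where "e x = x - 2 \<cdot>\<^sub>v half x" for x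
  have e: "e x \<in> box 1" "e x \<in> carrier_vec d" "half x \<in> carrier_vec d"
    "\<And>i. i < d \<Longrightarrow> x $ i = 2 * half x $ i + e x $ i" if "x \<in> carrier_vec d" for x
  proof -
    have "\<bar>k - 2 * (sgn k * (\<bar>k\<bar> div 2))\<bar> \<le> 1" for k :: int by (cases "k = 0"; cases "k > 0") auto
    then show "e x \<in> box 1" using that by (auto simp: e_def int_box_def half_def)
    then show "e x \<in> carrier_vec d" by (rule int_box_carrier)
    show "half x \<in> carrier_vec d" using that by simp
    show "x $ i = 2 * half x $ i + e x $ i" if "i < d" for i
      using that \<open>x \<in> carrier_vec d\<close> by (simp add: e_def half_def)
  qed
  have c: "?c \<in> box r" unfolding int_box_def mem_Collect_eq
  proof (intro conjI allI impI)
    show "?c \<in> carrier_vec d" using e(3)[OF y(2)] e(3)[OF y(3)] by simp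
    fix i assume i: "i < d"
    have "?y $ i = 2 * half ?y $ i + e ?y $ i" by (rule e(4)[OF y(2) i])
    moreover have "?y $ i = a $ i + (M *\<^sub>v ?z) $ i" unfolding y(1) using y(3) a i by simp
    moreover have "(M *\<^sub>v ?z) $ i = 2 * (M *\<^sub>v half ?z) $ i + (M *\<^sub>v e ?z) $ i"
    proof -
      have "(M *\<^sub>v ?z) $ i = (\<Sum>j<d. M $$ (i, j) * (2 * half ?z $ j + e ?z $ j))"
        unfolding index_mult_M[OF y(3) i] by (rule sum.cong) (simp_all add: e(4)[OF y(3)])
      also have "\<dots> = 2 * (\<Sum>j<d. M $$ (i, j) * half ?z $ j) + (\<Sum>j<d. M $$ (i, j) * e ?z $ j)"
        by (simp add: sum.distrib sum_distrib_left algebra_simps)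
      finally show ?thesis unfolding index_mult_M[OF e(2)[OF y(3)] i] index_mult_M[OF e(3)[OF y(3)] i] .
    qed
    moreover have "\<bar>(M *\<^sub>v e ?z) $ i\<bar> \<le> int (mat_size M)" using mult_M_bound[OF e(1)[OF y(3)] i] by simp
    moreover have "\<bar>e ?y $ i\<bar> \<le> 1" "\<bar>a $ i\<bar> \<le> int r" using e(1)[OF y(2)] a i by (auto simp: int_box_def)
    moreover have "?c $ i = half ?y $ i - (M *\<^sub>v half ?z) $ i" using i e(3)[OF y(3)] by simp
    ultimately show "\<bar>?c $ i\<bar> \<le> int r" using assms(2) by linarith
  qed
  have IH: "half_word t \<in> lists (box r)" "Q (half_word t) = half ?z" using Cons by auto
  have "Q (half_word (a # t)) = ?c + M *\<^sub>v half ?z"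
    using IH lists_box c int_box_carrier by (auto simp: Q_Cons)
  also have "\<dots> = half ?y"
  proof (rule eq_vecI)
    have c: "half ?y \<in> carrier_vec d" "M *\<^sub>v half ?z \<in> carrier_vec d"
      using e(3)[OF y(2)] e(3)[OF y(3)] by simp_all
    then show "dim_vec (?c + M *\<^sub>v half ?z) = dim_vec (half ?y)" by simp
    show "(?c + M *\<^sub>v half ?z) $ i = half ?y $ i" if "i < dim_vec (half ?y)" for i
      using that c by simp
  qed
  finally show ?case using IH c by simp
qed

lemma drop_half_word: "drop i (half_word t) = half_word (drop i t)"
proof (induction t arbitrary: i)
  case (Cons a t)
  then show ?case by (cases i) auto
qed simp

lemma half_in_box: "x \<in> box r \<Longrightarrow> half x \<in> box (r div 2)"
proof -
  have "\<bar>sgn k * (\<bar>k\<bar> div 2)\<bar> \<le> int (r div 2)" if "\<bar>k\<bar> \<le> int r" for k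
    using zdiv_mono1[OF that, of 2] by (auto simp: abs_mult sgn_if zdiv_int)
  then show ?thesis if "x \<in> box r" using that unfolding int_box_def half_def by auto
qed

text \<open>The reason for the form 2 \<kappa> + 1 of \<open>cert_radius\<close>: a path that leaves
  the large box still leaves the box of radius \<kappa> after halving.\<close>

lemma half_in_boxD:
  assumes x: "x \<in> carrier_vec d" and h: "half x \<in> box r"
  shows "x \<in> box (2 * r + 1)"
proof -
  have *: "\<bar>k\<bar> \<le> 2 * int r + 1" if "\<bar>sgn k * (\<bar>k\<bar> div 2)\<bar> \<le> int r" for k
    using that by (cases "k = 0") (auto simp: abs_mult sgn_if split: if_splits)
  have b: "\<bar>x $ i\<bar> \<le> int (2 * r + 1)" if "i < d" for i
  proof -
    have "\<bar>half x $ i\<bar> \<le> int r" using h that by (simp add: int_box_def)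
    then have "\<bar>x $ i\<bar> \<le> 2 * int r + 1" unfolding half_index[OF x that] by (rule *)
    then show ?thesis by simp
  qed
  show ?thesis unfolding int_box_def mem_Collect_eq by (intro conjI allI impI x b)
qed

lemma same_sign_half:
  assumes "x \<in> carrier_vec d" "y \<in> carrier_vec d" "same_sign d (half x) (half y)"
  shows "same_sign d x y"
proof -
  have *: "0 < sgn a * (\<bar>a\<bar> div 2) \<Longrightarrow> 0 < a" "sgn a * (\<bar>a\<bar> div 2) < 0 \<Longrightarrow> a < 0" for a :: int
    by (cases "a = 0"; cases "a > 0"; simp)+
  have "0 < a * b" if "0 < (sgn a * (\<bar>a\<bar> div 2)) * (sgn b * (\<bar>b\<bar> div 2))" for a b :: int
    using that *[of a] *[of b] unfolding zero_less_mult_iff[of "sgn a * _"] zero_less_mult_iff[of a] by blast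
  then show ?thesis
    using assms(3) unfolding same_sign_def by (metis half_index[OF assms(1)] half_index[OF assms(2)])
qed

text \<open>The values of the suffixes of a word over \<open>box r\<close> form a path from 0 in the graph with the steps
  \<open>y \<mapsto> t + M y\<close>. \<open>A\<close> collects the values reached before, \<open>Z\<close> those reached after the path has become
  long enough for its sign pattern to be frozen, both within the box of radius \<open>cert_radius\<close>.\<close>

definition cert_radius :: "nat \<Rightarrow> nat \<Rightarrow> nat" where
  "cert_radius r \<theta> = 2 * (mat_size M * \<theta> + r + \<theta>) + 1"

text \<open>Only closure under steps inside the large box is demanded; the points of
  \<open>A\<close> and \<open>Z\<close> may be unreachable. So for finite sets the check is finite
  integer arithmetic, and paths that leave the large box are left to halving.\<close>

definition certificate :: "nat \<Rightarrow> nat \<Rightarrow> int vec set \<Rightarrow> int vec set \<Rightarrow> bool" where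
  "certificate r \<theta> A Z \<longleftrightarrow> 0\<^sub>v d \<in> A \<and> A \<subseteq> box \<theta> \<and>
     (\<forall>y\<in>A. \<forall>t\<in>box r. t + M *\<^sub>v y \<in> box (cert_radius r \<theta>) \<longrightarrow> t + M *\<^sub>v y \<in> A \<union> Z) \<and>
     (\<forall>y\<in>Z. \<forall>t\<in>box r. t + M *\<^sub>v y \<in> box (cert_radius r \<theta>) \<longrightarrow>
        t + M *\<^sub>v y \<in> Z \<and> same_sign d y (t + M *\<^sub>v y))"

text \<open>Letters are prepended, so time runs against the word: \<open>drop i t\<close> is the
  path at an earlier time, \<open>t\<close> its present end.\<close>

definition escape_radius :: "nat \<Rightarrow> nat \<Rightarrow> bool" where
  "escape_radius r K \<longleftrightarrow> (\<forall>t\<in>lists (box r). \<forall>i. Q (drop i t) \<notin> box K \<longrightarrow> same_sign d (Q t) (Q (drop i t)))"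

lemma drop_in_lists: "t \<in> lists S \<Longrightarrow> drop i t \<in> lists S"
  by (auto dest: in_set_dropD)

lemma take_in_lists: "t \<in> lists S \<Longrightarrow> take i t \<in> lists S"
  by (auto dest: in_set_takeD)

text \<open>Halving all values of a path (rounding towards 0) yields a path again, so that it suffices to
  look at paths within a fixed box.\<close>

lemma certificate_step:
  assumes cert: "certificate r \<theta> A Z" and r: "mat_size M + 1 \<le> r"
  shows "a # t \<in> lists (box r) \<Longrightarrow> \<forall>i. Q (drop i (a # t)) \<in> box R \<Longrightarrow>
    \<exists>i. Q (drop i (a # t)) \<notin> box (mat_size M * \<theta> + r + \<theta>) \<Longrightarrow> same_sign d (Q (a # t)) (Q t)"
proof (induction R arbitrary: a t rule: less_induct)
  case (less R)
  let ?\<kappa> = "mat_size M * \<theta> + r + \<theta>"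
  let ?K = "cert_radius r \<theta>"
  have K: "?K = 2 * ?\<kappa> + 1" by (simp add: cert_radius_def)
  show ?case
  proof (cases "\<forall>i. Q (drop i (a # t)) \<in> box ?K")
    \<comment> \<open>Halving shrinks the radius R that encloses the path, so the induction
      hypothesis applies; the point outside the large box becomes a point outside the box of radius
      \<kappa>.\<close>
    case False
    then obtain i where i: "Q (drop i (a # t)) \<notin> box ?K" by blast
    then have "\<not> R \<le> ?K" using less.prems(2) int_box_mono by blast
    have h: "half_word (a # t) \<in> lists (box r)" using half_word[OF less.prems(1) r] by blast
    have hQ: "Q (drop j (half_word (a # t))) = half (Q (drop j (a # t)))" for j
      using half_word[OF drop_in_lists[OF less.prems(1)] r] unfolding drop_half_word by blast
    have carr: "Q (drop j (a # t)) \<in> carrier_vec d" for j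
      using lists_box[OF drop_in_lists[OF less.prems(1)]] by simp
    have "same_sign d (Q (half_word (a # t))) (Q (half_word t))"
      unfolding half_word.simps
    proof (rule less.IH[of "R div 2"], unfold half_word.simps(2)[symmetric])
      show "R div 2 < R" using \<open>\<not> R \<le> ?K\<close> by simp
      show "half_word (a # t) \<in> lists (box r)" by (rule h)
      show "\<forall>j. Q (drop j (half_word (a # t))) \<in> box (R div 2)"
        unfolding hQ using less.prems(2) half_in_box by blast
      show "\<exists>j. Q (drop j (half_word (a # t))) \<notin> box ?\<kappa>"
        unfolding hQ using half_in_boxD[OF carr, of i ?\<kappa>] i unfolding K by blast
    qed
    then have "same_sign d (half (Q (a # t))) (half (Q t))" using hQ[of 0] hQ[of 1] by simp
    then show ?thesis using same_sign_half carr[of 0] carr[of 1] by simp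
  next
    case inK: True
    \<comment> \<open>Within the large box the closure conditions apply to every step: the path
      starts in \<open>A\<close>, and once in \<open>Z\<close> it stays there. For j \<le> i the
      suffix \<open>drop j t'\<close> is the later point, so membership in \<open>Z\<close> passes
      from i to j.\<close>
    have AZ: "Q (drop i t') \<in> A \<union> Z \<and> (j \<le> i \<longrightarrow> Q (drop i t') \<in> Z \<longrightarrow> Q (drop j t') \<in> Z)"
      if "t' \<in> lists (box r)" "\<forall>i. Q (drop i t') \<in> box ?K" for t' i j
      using that
    proof (induction t' arbitrary: i j)
      case Nil
      then show ?case using cert by (auto simp: certificate_def)
    next
      case (Cons b s)
      have bs: "b \<in> box r" "Q (b # s) = b + M *\<^sub>v Q s"
        using Cons.hyps int_box_carrier lists_box by (auto simp: Q_Cons)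
      have s: "\<forall>i. Q (drop i s) \<in> box ?K" using Cons.prems by (metis drop_Suc_Cons)
      have bK: "Q (b # s) \<in> box ?K" using Cons.prems[rule_format, of 0] by simp
      have IH: "Q (drop i s) \<in> A \<union> Z" "j \<le> i \<longrightarrow> Q (drop i s) \<in> Z \<longrightarrow> Q (drop j s) \<in> Z" for i j
        using Cons.IH[OF s, of i j] by auto
      have "Q s \<in> A \<union> Z" using IH(1)[of 0] by simp
      then have 1: "Q (b # s) \<in> A \<union> Z" "Q s \<in> Z \<Longrightarrow> Q (b # s) \<in> Z"
        using cert bs bK unfolding certificate_def by auto
      show ?case
      proof (cases i)
        case 0
        then show ?thesis using 1 by simp
      next
        case (Suc i')
        have 2: "Q (drop i' s) \<in> Z \<Longrightarrow> Q (b # s) \<in> Z" using IH(2)[of 0 i'] 1(2) by simp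
        show ?thesis
        proof (cases j)
          case 0
          then show ?thesis using Suc IH(1)[of i'] 2 by simp
        next
          case (Suc j')
          then show ?thesis using \<open>i = Suc i'\<close> IH(1)[of i'] IH(2)[of j' i'] by simp
        qed
      qed
    qed
    have at: "a \<in> box r" "t \<in> lists (box r)" "Q (a # t) = a + M *\<^sub>v Q t"
      using less.prems(1) Q_Cons[OF int_box_carrier lists_box, of a r t r] by auto
    have atK: "Q (a # t) \<in> box ?K" using inK[rule_format, of 0] by simp
    have tK: "\<forall>i. Q (drop i t) \<in> box ?K" using inK by (metis drop_Suc_Cons)
    obtain i where i: "Q (drop i (a # t)) \<notin> box ?\<kappa>" using less.prems(3) by blast
    have AK: "A \<subseteq> box ?\<kappa>" using cert int_box_mono[of \<theta> ?\<kappa> d] unfolding certificate_def by auto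
    \<comment> \<open>A point outside the box of radius \<kappa> is not in \<open>A\<close>, hence
      in \<open>Z\<close>, and so are all later ones. If it is the very last point, its predecessor
      cannot be in \<open>A\<close> either: a step from \<open>A\<close> reaches radius mat_size M *
      \<theta> + r at most, and \<kappa> is chosen to dominate this.\<close>
    have "Q t \<in> Z"
    proof (cases i)
      case (Suc i')
      then have "Q (drop i' t) \<notin> box ?\<kappa>" using i by simp
      then have "Q (drop i' t) \<in> Z" using AZ[OF at(2) tK, of i' 0] AK by auto
      then show ?thesis using AZ[OF at(2) tK, of i' 0] by simp
    next
      case 0
      show ?thesis
      proof (rule ccontr)
        assume "Q t \<notin> Z"
        then have "Q t \<in> A" using AZ[OF at(2) tK, of 0 0] by simp
        then have "Q t \<in> box \<theta>" using cert by (auto simp: certificate_def)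
        then have "M *\<^sub>v Q t \<in> box (mat_size M * \<theta>)"
          using mult_M_bound[of "Q t" \<theta>] int_box_carrier[of "Q t" d \<theta>] unfolding int_box_def mem_Collect_eq
          by auto
        then have "Q (a # t) \<in> box (r + mat_size M * \<theta>)" unfolding at(3) by (rule add_in_int_box[OF at(1)])
        then have "Q (a # t) \<in> box ?\<kappa>" using int_box_mono[of "r + mat_size M * \<theta>" ?\<kappa> d] by auto
        then show False using i 0 by simp
      qed
    qed
    then have "same_sign d (Q t) (Q (a # t))"
      using cert at atK unfolding certificate_def by auto
    then show ?thesis by (simp add: same_sign_def mult.commute)
  qed
qed

lemma same_sign_trans: "same_sign d x y \<Longrightarrow> same_sign d y z \<Longrightarrow> same_sign d x z"
  unfolding same_sign_def by (smt (verit, best) zero_less_mult_iff)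

lemma bounded_suffix_values:
  assumes "t \<in> lists (carrier_vec d)" shows "\<exists>R. \<forall>i. Q (drop i t) \<in> box R"
proof -
  have "\<exists>R. x \<in> box R" if "x \<in> carrier_vec d" for x
  proof (intro exI)
    have "nat \<bar>x $ i\<bar> \<le> (\<Sum>i<d. nat \<bar>x $ i\<bar>)" if "i < d" for i
      using that by (intro member_le_sum[of i "{..<d}" "\<lambda>i. nat \<bar>x $ i\<bar>"]) auto
    then have "\<bar>x $ i\<bar> \<le> int (\<Sum>i<d. nat \<bar>x $ i\<bar>)" if "i < d" for i
      using that nat_le_iff by blast
    then show "x \<in> box (\<Sum>i<d. nat \<bar>x $ i\<bar>)" using \<open>x \<in> carrier_vec d\<close> by (simp add: int_box_def)
  qed
  then have "\<forall>i. \<exists>R. Q (drop i t) \<in> box R" using assms by (meson Q_carrier drop_in_lists)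
  then obtain R where R: "\<And>i. Q (drop i t) \<in> box (R i)" by metis
  have "Q (drop i t) \<in> box (Max (R ` {..length t}))" for i
  proof -
    have "Q (drop i t) = Q (drop (min i (length t)) t)" by (simp add: min_def)
    moreover have "R (min i (length t)) \<le> Max (R ` {..length t})" by (intro Max_ge) auto
    ultimately show ?thesis using R[of "min i (length t)"] int_box_mono by (metis subsetD)
  qed
  then show ?thesis by blast
qed

lemma certificate_sound:
  assumes cert: "certificate r \<theta> A Z" and r: "mat_size M + 1 \<le> r"
  shows "escape_radius r (cert_radius r \<theta>)"
  unfolding escape_radius_def
proof (intro ballI allI impI)
  fix t i assume t: "t \<in> lists (box r)" and i: "Q (drop i t) \<notin> box (cert_radius r \<theta>)"
  let ?\<kappa> = "mat_size M * \<theta> + r + \<theta>"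
  have "box ?\<kappa> \<subseteq> box (cert_radius r \<theta>)" by (rule int_box_mono) (simp add: cert_radius_def)
  then have i\<kappa>: "Q (drop i t) \<notin> box ?\<kappa>" using i by blast
  have step: "same_sign d (Q (b # s)) (Q s)"
    if bs: "b # s \<in> lists (box r)" "\<exists>j. Q (drop j (b # s)) \<notin> box ?\<kappa>" for b s
  proof -
    obtain R where "\<forall>j. Q (drop j (b # s)) \<in> box R"
      using bounded_suffix_values[OF lists_box[OF bs(1)]] by blast
    then show ?thesis using certificate_step[OF cert r bs(1)] bs(2) by blast
  qed
  from t i\<kappa> show "same_sign d (Q t) (Q (drop i t))"
  proof (induction t arbitrary: i)
    case Nil
    then show ?case by simp
  next
    case (Cons a t)
    have s: "same_sign d (Q (a # t)) (Q t)" using step[of a t] Cons by auto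
    show ?case
    proof (cases i)
      \<comment> \<open>\<open>same_sign\<close> is reflexive only on vectors without zero entries;
        the step \<open>s\<close> shows that there are none.\<close>
      case 0
      then show ?thesis using s by (auto simp: same_sign_def zero_less_mult_iff)
    next
      case (Suc j)
      then show ?thesis using s Cons same_sign_trans by auto
    qed
  qed
qed

end

section \<open>Runs of automata and differences of words\<close>

lemma path_append: "path T p (u @ v) q \<longleftrightarrow> (\<exists>r. path T p u r \<and> path T r v q)"
  by (induction u arbitrary: p) auto

lemma path_closed:
  assumes "automaton_over \<Sigma> B" "path (set (transitions B)) p u q" "p < num_states B"
  shows "u \<in> lists \<Sigma> \<and> q < num_states B"
  using assms(2,3)
proof (induction u arbitrary: p)
  case (Cons a u)
  then obtain r where r: "(p, a, r) \<in> set (transitions B)" "path (set (transitions B)) r u q" by auto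
  then have "a \<in> \<Sigma>" "r < num_states B" using assms(1) unfolding automaton_over_def by auto
  then show ?case using Cons.IH[OF r(2)] by simp
qed simp

definition run_states :: "'a automaton \<Rightarrow> 'a list \<Rightarrow> nat set" where
  "run_states B u = {q. \<exists>p\<in>set (initials B). path (set (transitions B)) p u q}"

definition final_words :: "'a automaton \<Rightarrow> nat \<Rightarrow> 'a list set" where
  "final_words B q = {u. \<exists>r\<in>set (finals B). path (set (transitions B)) q u r}"

lemma recognized_append: "u @ v \<in> recognized B \<longleftrightarrow> (\<exists>q\<in>run_states B u. v \<in> final_words B q)"
  by (auto simp: recognized_def run_states_def final_words_def path_append)

lemma run_states_closed:
  assumes "automaton_over \<Sigma> B" shows "run_states B u \<subseteq> {..<num_states B}"
  using path_closed[OF assms] assms by (fastforce simp: run_states_def automaton_over_def)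

lemma recognized_lists: "automaton_over \<Sigma> B \<Longrightarrow> recognized B \<subseteq> lists \<Sigma>"
  using path_closed unfolding recognized_def automaton_over_def by fastforce

lemma index_le_recognized:
  assumes "automaton_over \<Sigma> B"
  shows "index_le S (recognized B) (2 ^ num_states B)"
proof (rule index_le_if_kernel)
  show "run_states B ` lists S \<subseteq> Pow {..<num_states B}" using run_states_closed[OF assms] by blast
  show "residual S (recognized B) u = residual S (recognized B) u'"
    if "run_states B u = run_states B u'" for u u'
    using that by (simp add: residual_def recognized_append)
qed (simp_all add: card_Pow)

text \<open>The shorter word is padded with \<open>z\<close>, meant to be the zero vector of the
  right dimension: trailing zeros do not change a value.\<close>

fun word_diff :: "int vec \<Rightarrow> int vec list \<Rightarrow> int vec list \<Rightarrow> int vec list" where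
  "word_diff z [] [] = []"
| "word_diff z (a # v) [] = (a - z) # word_diff z v []"
| "word_diff z [] (b # w) = (z - b) # word_diff z [] w"
| "word_diff z (a # v) (b # w) = (a - b) # word_diff z v w"

lemma drop_word_diff: "drop i (word_diff z v w) = word_diff z (drop i v) (drop i w)"
proof (induction z v w arbitrary: i rule: word_diff.induct)
  case (2 z a v)
  then show ?case by (cases i) auto
next
  case (3 z b w)
  then show ?case by (cases i) auto
next
  case (4 z a v b w)
  then show ?case by (cases i) auto
qed simp

lemma diff_in_int_box: "x \<in> int_box d r \<Longrightarrow> y \<in> int_box d r \<Longrightarrow> x - y \<in> int_box d (2 * r)"
  by (force simp: int_box_def)

context int_matrix
begin

lemma mult_M_diff:
  "x \<in> carrier_vec d \<Longrightarrow> y \<in> carrier_vec d \<Longrightarrow> M *\<^sub>v (x - y) = M *\<^sub>v x - M *\<^sub>v y"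
  by (rule mult_minus_distrib_mat_vec[OF M_carrier])

lemma Q_word_diff_aux:
  assumes "a \<in> carrier_vec d" "b \<in> carrier_vec d" "x \<in> carrier_vec d" "y \<in> carrier_vec d"
  shows "(a - b) + M *\<^sub>v (x - y) = (a + M *\<^sub>v x) - (b + M *\<^sub>v y)"
proof (rule eq_vecI)
  show "dim_vec (a - b + M *\<^sub>v (x - y)) = dim_vec (a + M *\<^sub>v x - (b + M *\<^sub>v y))" using assms by simp
  fix i assume "i < dim_vec (a + M *\<^sub>v x - (b + M *\<^sub>v y))"
  then have "i < d" by simp
  then show "(a - b + M *\<^sub>v (x - y)) $ i = (a + M *\<^sub>v x - (b + M *\<^sub>v y)) $ i"
    using assms by (simp add: mult_M_diff)
qed

lemma Q_Cons_word_diff: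
  assumes "a \<in> box r" "b \<in> box r" "x \<in> carrier_vec d" "y \<in> carrier_vec d"
    and "t \<in> lists (box (2 * r))" "Q t = x - y"
  shows "(a - b) # t \<in> lists (box (2 * r)) \<and> Q ((a - b) # t) = (a + M *\<^sub>v x) - (b + M *\<^sub>v y)"
proof
  show t: "(a - b) # t \<in> lists (box (2 * r))" using assms diff_in_int_box by simp
  have "Q ((a - b) # t) = (a - b) + M *\<^sub>v (x - y)"
    using Q_Cons[OF int_box_carrier lists_box, of "a - b" "2 * r" t "2 * r"] t assms(6) by simp
  then show "Q ((a - b) # t) = (a + M *\<^sub>v x) - (b + M *\<^sub>v y)"
    using Q_word_diff_aux assms(1-4) int_box_carrier by metis
qed

lemma mult_M_zero [simp]: "M *\<^sub>v 0\<^sub>v d = 0\<^sub>v d"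
  by (rule eq_vecI) (auto simp: index_mult_M)

lemma word_diff:
  assumes "v \<in> lists (box r)" "w \<in> lists (box r)"
  shows "word_diff (0\<^sub>v d) v w \<in> lists (box (2 * r)) \<and> Q (word_diff (0\<^sub>v d) v w) = Q v - Q w"
proof -
  have "z = 0\<^sub>v d \<Longrightarrow> v \<in> lists (box r) \<Longrightarrow> w \<in> lists (box r) \<Longrightarrow>
      word_diff z v w \<in> lists (box (2 * r)) \<and> Q (word_diff z v w) = Q v - Q w" for z
  proof (induction z v w rule: word_diff.induct)
    case (1 z)
    then show ?case by simp
  next
    case (2 z a v)
    then have v: "a \<in> box r" "a \<in> carrier_vec d" "v \<in> lists (carrier_vec d)" using int_box_carrier lists_box by auto
    show ?case using Q_Cons_word_diff[OF v(1) zero_in_int_box Q_carrier[OF v(3)] zero_carrier_vec, of "word_diff z v []"]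
        2 v Q_Cons[OF v(2,3)] by simp
  next
    case (3 z b w)
    then have w: "b \<in> box r" "b \<in> carrier_vec d" "w \<in> lists (carrier_vec d)" using int_box_carrier lists_box by auto
    show ?case using Q_Cons_word_diff[OF zero_in_int_box w(1) zero_carrier_vec Q_carrier[OF w(3)], of "word_diff z [] w"]
        3 w Q_Cons[OF w(2,3)] by simp
  next
    case (4 z a v b w)
    then have v: "a \<in> box r" "a \<in> carrier_vec d" "v \<in> lists (carrier_vec d)"
      and w: "b \<in> box r" "b \<in> carrier_vec d" "w \<in> lists (carrier_vec d)"
      using int_box_carrier lists_box by auto
    show ?case using Q_Cons_word_diff[OF v(1) w(1) Q_carrier[OF v(3)] Q_carrier[OF w(3)], of "word_diff z v w"]
        4 Q_Cons[OF v(2,3)] Q_Cons[OF w(2,3)] by simp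
  qed
  then show ?thesis using assms by blast
qed

text \<open>The difference word is a path that ends in 0. Had it left the box of radius K, all
  coordinates of its end would have a strict sign. Differences of letters account for the radius
  \<open>2 * r\<close>.\<close>

lemma equal_values_close:
  assumes K: "escape_radius (2 * r) K" and "0 < d"
    and v: "v \<in> lists (box r)" and w: "w \<in> lists (box r)" and eq: "Q v = Q w"
  shows "Q (drop i v) - Q (drop i w) \<in> box K"
proof (rule ccontr)
  let ?t = "word_diff (0\<^sub>v d) v w"
  assume "Q (drop i v) - Q (drop i w) \<notin> box K"
  then have "Q (drop i ?t) \<notin> box K"
    using word_diff[OF drop_in_lists[OF v] drop_in_lists[OF w]] by (simp add: drop_word_diff)
  then have "same_sign d (Q ?t) (Q (drop i ?t))"
    using K word_diff[OF v w] unfolding escape_radius_def by blast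
  moreover have "Q ?t = 0\<^sub>v d" using word_diff[OF v w] eq Q_carrier[OF lists_box[OF w]] by simp
  ultimately show False using \<open>0 < d\<close> by (auto simp: same_sign_def)
qed

section \<open>Congruences of finite index for signs and values\<close>

abbreviation nonneg_words :: "int vec list set" where
  "nonneg_words \<equiv> {w. Q w \<in> nonneg_vecs d}"

text \<open>If Q w is outside the box of radius K, its signs are those of Q (u w), whatever u is.
  Otherwise the answer is read off the set of those y in the box for which a suffix of value y makes
  the value nonnegative; this set is the kernel.\<close>

lemma index_le_nonneg_words:
  assumes K: "escape_radius s K" and r: "r \<le> s"
  shows "index_le (box r) nonneg_words (2 ^ ((2 * K + 1) ^ d))"
proof (rule index_le_if_kernel)
  let ?f = "\<lambda>u. {y \<in> box K. Q u + M ^\<^sub>m length u *\<^sub>v y \<in> nonneg_vecs d}"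
  show "?f ` lists (box r) \<subseteq> Pow (box K)" by blast
  show "finite (Pow (box K))" "card (Pow (box K)) \<le> 2 ^ ((2 * K + 1) ^ d)"
    using card_int_box[of d K] by (simp_all add: card_Pow)
  fix u u' assume u: "u \<in> lists (box r)" "u' \<in> lists (box r)" and eq: "?f u = ?f u'"
  have far: "Q (v @ w) \<in> nonneg_vecs d \<longleftrightarrow> Q w \<in> nonneg_vecs d"
    if "v \<in> lists (box r)" "w \<in> lists (box r)" "Q w \<notin> box K" for v w
  proof -
    have vw: "v @ w \<in> lists (box s)" using that(1,2) int_box_mono[OF r] by auto
    have "same_sign d (Q (v @ w)) (Q (drop (length v) (v @ w)))"
      by (rule K[unfolded escape_radius_def, rule_format, OF vw]) (use that(3) in simp)
    then have "0 < Q (v @ w) $ i * Q w $ i" if "i < d" for i using that by (simp add: same_sign_def)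
    then have "0 \<le> Q (v @ w) $ i \<longleftrightarrow> 0 \<le> Q w $ i" if "i < d" for i
      using that by (metis less_le_not_le linorder_not_le zero_less_mult_iff)
    moreover have "Q (v @ w) \<in> carrier_vec d" "Q w \<in> carrier_vec d"
      using lists_box[OF vw] lists_box[OF that(2)] by simp_all
    ultimately show ?thesis by (simp add: nonneg_vecs_def)
  qed
  have near: "Q (v @ w) \<in> nonneg_vecs d \<longleftrightarrow> Q w \<in> ?f v"
    if "v \<in> lists (box r)" "w \<in> lists (box r)" "Q w \<in> box K" for v w
    using that Q_append[OF lists_box lists_box, OF that(1,2)] by simp
  show "residual (box r) nonneg_words u = residual (box r) nonneg_words u'"
    unfolding residual_def mem_Collect_eq
  proof (intro Collect_cong conj_cong refl)
    fix w assume w: "w \<in> lists (box r)"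
    show "Q (u @ w) \<in> nonneg_vecs d \<longleftrightarrow> Q (u' @ w) \<in> nonneg_vecs d"
    proof (cases "Q w \<in> box K")
      case True
      then show ?thesis using near[OF u(1) w] near[OF u(2) w] eq by blast
    next
      case False
      then show ?thesis using far[OF u(1) w] far[OF u(2) w] by blast
    qed
  qed
qed

abbreviation value_words :: "int vec list set \<Rightarrow> int vec list set" where
  "value_words L \<equiv> {w. Q w \<in> Q ` L}"

text \<open>A subset construction that compares u w with an accepted word v = v1 v2, cut after
  \<open>length u\<close> letters. A pair holds a state of B at the cut and the carry s = Q v2 - Q
  w, which lies in the box of radius K by \<open>equal_values_close\<close>. The extra state
  \<open>num_states B\<close> means that v has ended before the cut, so that v2 is empty.\<close>

lemma index_le_value_words:
  assumes K: "escape_radius (2 * r) K" and "0 < d" and B: "automaton_over \<Sigma> B" and \<Sigma>: "\<Sigma> \<subseteq> box r"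
  shows "index_le (box r) (value_words (recognized B)) (2 ^ (Suc (num_states B) * (2 * K + 1) ^ d))"
proof (rule index_le_if_kernel)
  let ?n = "num_states B" and ?L = "recognized B"
  define f where "f u = {(q, s). q \<le> ?n \<and> s \<in> box K \<and>
     (q < ?n \<and> (\<exists>v\<in>lists \<Sigma>. q \<in> run_states B v \<and> Q u = Q v + M ^\<^sub>m length u *\<^sub>v s \<and> length v = length u) \<or>
      q = ?n \<and> (\<exists>v\<in>?L. Q u = Q v + M ^\<^sub>m length u *\<^sub>v s \<and> length v < length u))}" for u
  show "f ` lists (box r) \<subseteq> Pow ({..?n} \<times> box K)" by (auto simp: f_def)
  show "finite (Pow ({..?n} \<times> box K))" "card (Pow ({..?n} \<times> box K)) \<le> 2 ^ (Suc ?n * (2 * K + 1) ^ d)"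
    using card_int_box[of d K] by (simp_all add: card_Pow card_cartesian_product)
  have L: "?L \<subseteq> lists (box r)" using recognized_lists[OF B] lists_mono[OF \<Sigma>] by blast
  have key: "Q (u @ w) \<in> Q ` ?L \<longleftrightarrow> (\<exists>(q, s)\<in>f u. q < ?n \<and> (\<exists>v\<in>final_words B q. v \<in> lists \<Sigma> \<and> Q v = s + Q w) \<or>
      q = ?n \<and> 0\<^sub>v d = s + Q w)"
    if u: "u \<in> lists (box r)" and w: "w \<in> lists (box r)" for u w
  proof -
    have uw: "Q (u @ w) = Q u + M ^\<^sub>m length u *\<^sub>v Q w" using Q_append u w lists_box by blast
    have Qw: "Q w \<in> carrier_vec d" using w lists_box by simp
    show ?thesis
    proof
      assume "Q (u @ w) \<in> Q ` ?L"
      then obtain v where v: "v \<in> ?L" "Q (u @ w) = Q v" by blast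
      then have vr: "v \<in> lists (box r)" and v\<Sigma>: "v \<in> lists \<Sigma>" using L recognized_lists[OF B] by auto
      define v1 v2 where "v1 = take (length u) v" and "v2 = drop (length u) v"
      define s where "s = Q v2 - Q w"
      have v12: "v = v1 @ v2" by (simp add: v1_def v2_def)
      have vs: "v1 \<in> lists \<Sigma>" "v2 \<in> lists \<Sigma>" "v1 \<in> lists (carrier_vec d)" "v2 \<in> lists (carrier_vec d)"
        using v\<Sigma> vr lists_box[OF vr] unfolding v12 by auto
      have s: "s \<in> box K" "Q v2 = s + Q w"
      proof -
        have "u @ w \<in> lists (box r)" using u w by simp
        from equal_values_close[OF K \<open>0 < d\<close> vr this v(2)[symmetric], of "length u"]
        show "s \<in> box K" by (simp add: s_def v2_def)
        show "Q v2 = s + Q w" by (rule eq_vecI) (use Qw Q_carrier[OF vs(4)] in \<open>auto simp: s_def\<close>)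
      qed
      have sc: "s \<in> carrier_vec d" using s(1) by (rule int_box_carrier)
      have Qv: "Q v = Q v1 + M ^\<^sub>m length v1 *\<^sub>v Q v2" unfolding v12 by (rule Q_append[OF vs(3,4)])
      have cancel: "x = y" if "x + z = y + z" "x \<in> carrier_vec d" "y \<in> carrier_vec d" "z \<in> carrier_vec d"
        for x y z :: "int vec"
      proof (rule eq_vecI)
        show "dim_vec x = dim_vec y" using that by simp
        fix i assume "i < dim_vec y"
        then show "x $ i = y $ i" using arg_cong[OF that(1), of "\<lambda>v. v $ i"] that(2-4) by simp
      qed
      have Qu: "Q u \<in> carrier_vec d" "Q v1 \<in> carrier_vec d" using u lists_box vs(3) by auto
      have dist: "M ^\<^sub>m length u *\<^sub>v Q v2 = M ^\<^sub>m length u *\<^sub>v s + M ^\<^sub>m length u *\<^sub>v Q w"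
        unfolding s(2) by (rule mult_add_distrib_mat_vec[OF pow_M_carrier sc Qw])
      show "\<exists>(q, s)\<in>f u. q < ?n \<and> (\<exists>v\<in>final_words B q. v \<in> lists \<Sigma> \<and> Q v = s + Q w) \<or>
          q = ?n \<and> 0\<^sub>v d = s + Q w"
      proof (cases "length u \<le> length v")
        case True
        then have len: "length v1 = length u" by (simp add: v1_def)
        have eq: "Q u = Q v1 + M ^\<^sub>m length u *\<^sub>v s"
        proof (rule cancel[where z = "M ^\<^sub>m length u *\<^sub>v Q w"])
          show "Q u + M ^\<^sub>m length u *\<^sub>v Q w = Q v1 + M ^\<^sub>m length u *\<^sub>v s + M ^\<^sub>m length u *\<^sub>v Q w"
            using v(2) uw Qv dist len sc Qw Qu by (simp add: assoc_add_vec[of _ d])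
        qed (use sc Qw Qu in simp_all)
        obtain q where q: "q \<in> run_states B v1" "v2 \<in> final_words B q"
          using v(1) unfolding v12 recognized_append by blast
        have "q < ?n" using q(1) run_states_closed[OF B] by blast
        then have "(q, s) \<in> f u" using q(1) s(1) vs(1) eq len by (auto simp: f_def)
        then show ?thesis using \<open>q < ?n\<close> q(2) vs(2) s(2) by blast
      next
        case False
        then have v2: "v2 = []" "v1 = v" by (simp_all add: v1_def v2_def)
        have "M ^\<^sub>m length u *\<^sub>v 0\<^sub>v d = 0\<^sub>v d"
          by (rule eq_vecI) (simp_all add: index_mult_mat_vec)
        then have sw: "M ^\<^sub>m length u *\<^sub>v s + M ^\<^sub>m length u *\<^sub>v Q w = 0\<^sub>v d" using dist v2 by simp
        have eq: "Q u = Q v + M ^\<^sub>m length u *\<^sub>v s"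
        proof (rule cancel[where z = "M ^\<^sub>m length u *\<^sub>v Q w"])
          show "Q u + M ^\<^sub>m length u *\<^sub>v Q w = Q v + M ^\<^sub>m length u *\<^sub>v s + M ^\<^sub>m length u *\<^sub>v Q w"
            using v(2) uw sw Qu sc Qw v2 by (simp add: assoc_add_vec[of _ d])
        qed (use sc Qw Qu v2 in simp_all)
        have "(?n, s) \<in> f u" using eq s(1) v(1) False by (auto simp: f_def)
        moreover have "0\<^sub>v d = s + Q w" using s(2) v2 by simp
        ultimately show ?thesis by blast
      qed
    next
      assume "\<exists>(q, s)\<in>f u. q < ?n \<and> (\<exists>v\<in>final_words B q. v \<in> lists \<Sigma> \<and> Q v = s + Q w) \<or>
          q = ?n \<and> 0\<^sub>v d = s + Q w"
      then obtain q s where qs: "(q, s) \<in> f u" and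
        or: "q < ?n \<and> (\<exists>v\<in>final_words B q. v \<in> lists \<Sigma> \<and> Q v = s + Q w) \<or> q = ?n \<and> 0\<^sub>v d = s + Q w" by blast
      have sc: "s \<in> carrier_vec d" using qs int_box_carrier by (auto simp: f_def)
      have dist: "M ^\<^sub>m length u *\<^sub>v (s + Q w) = M ^\<^sub>m length u *\<^sub>v s + M ^\<^sub>m length u *\<^sub>v Q w"
        by (rule mult_add_distrib_mat_vec[OF pow_M_carrier sc Qw])
      from or show "Q (u @ w) \<in> Q ` ?L"
      proof
        assume "q < ?n \<and> (\<exists>v\<in>final_words B q. v \<in> lists \<Sigma> \<and> Q v = s + Q w)"
        then obtain v2 where v2: "v2 \<in> final_words B q" "v2 \<in> lists \<Sigma>" "Q v2 = s + Q w" and "q < ?n" by blast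
        obtain v1 where v1: "v1 \<in> lists \<Sigma>" "q \<in> run_states B v1" "Q u = Q v1 + M ^\<^sub>m length u *\<^sub>v s"
          "length v1 = length u" using qs \<open>q < ?n\<close> by (auto simp: f_def)
        have c: "v1 \<in> lists (carrier_vec d)" "v2 \<in> lists (carrier_vec d)"
          using lists_box lists_mono[OF \<Sigma>] v1(1) v2(2) by blast+
        have "Q (v1 @ v2) = Q v1 + M ^\<^sub>m length u *\<^sub>v (s + Q w)" using Q_append[OF c] v1(4) v2(3) by simp
        also have "\<dots> = Q (u @ w)" unfolding uw v1(3) dist
          using Q_carrier[OF c(1)] sc Qw by (simp add: assoc_add_vec[of _ d])
        finally show ?thesis using v1(2) v2(1) recognized_append[of v1 v2 B] by (metis imageI)
      next
        assume q: "q = ?n \<and> 0\<^sub>v d = s + Q w"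
        then obtain v where v: "v \<in> ?L" "Q u = Q v + M ^\<^sub>m length u *\<^sub>v s" using qs by (auto simp: f_def)
        have "Q v \<in> carrier_vec d" by (rule Q_carrier[OF lists_box]) (use v(1) L in blast)
        moreover have "M ^\<^sub>m length u *\<^sub>v 0\<^sub>v d = 0\<^sub>v d"
          by (rule eq_vecI) (simp_all add: index_mult_mat_vec)
        ultimately have "Q (u @ w) = Q v" unfolding uw v(2)
          using dist[unfolded q[THEN conjunct2, symmetric]] sc Qw by (simp add: assoc_add_vec[of _ d])
        then show ?thesis using v(1) by blast
      qed
    qed
  qed
  fix u u' assume u: "u \<in> lists (box r)" "u' \<in> lists (box r)" and eq: "f u = f u'"
  show "residual (box r) (value_words ?L) u = residual (box r) (value_words ?L) u'"
    unfolding residual_def mem_Collect_eq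
    by (intro Collect_cong conj_cong refl) (simp only: key[OF u(1)] key[OF u(2)] eq)
qed

text \<open>Beyond the length of w the suffixes of w are empty and have value 0, so the suffix
  values of v themselves lie in the box of radius K. Where such a value repeats together with a
  state, v can be cut without changing its value or its acceptance.\<close>

lemma short_preimage:
  assumes K: "escape_radius (2 * r) K" and "0 < d" and B: "automaton_over \<Sigma> B" and \<Sigma>: "\<Sigma> \<subseteq> box r"
    and w: "w \<in> lists (box r)" and "Q w \<in> Q ` recognized B"
  obtains v where "v \<in> recognized B" "Q v = Q w" "length v \<le> length w + num_states B * (2 * K + 1) ^ d"
proof -
  let ?L = "recognized B" and ?n = "num_states B"
  have L: "?L \<subseteq> lists (box r)" using recognized_lists[OF B] lists_mono[OF \<Sigma>] by blast
  let ?P = "\<lambda>v. v \<in> ?L \<and> Q v = Q w"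
  \<comment> \<open>The states chosen at different positions may belong to different runs; two equal
    ones suffice to glue the prefix of one run to the suffix of another.\<close>
  define q where "q v i = (SOME q. q \<in> run_states B (take i v) \<and> drop i v \<in> final_words B q)" for v i
  have q: "q v i \<in> run_states B (take i v) \<and> drop i v \<in> final_words B (q v i)" if "v \<in> ?L" for v i
  proof -
    have "take i v @ drop i v \<in> ?L" using that by simp
    then show ?thesis unfolding q_def recognized_append by (rule someI2_bex) auto
  qed
  obtain v0 where v0: "?P v0" using assms(6) by (metis imageE)
  obtain v where "?P v" "length v < length w + ?n * (2 * K + 1) ^ d"
  proof (rule short_word[of "{..<?n} \<times> box K" "?n * (2 * K + 1) ^ d" ?P "length w"
        "\<lambda>v i. (q v i, Q (drop i v))" v0])
    show "finite ({..<?n} \<times> box K)" "card ({..<?n} \<times> box K) \<le> ?n * (2 * K + 1) ^ d"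
      using card_int_box[of d K] by (simp_all add: card_cartesian_product)
    fix v i assume v: "?P v" and i: "length w \<le> i"
    have vr: "v \<in> lists (box r)" using v L by blast
    have "Q (drop i v) - Q (drop i w) \<in> box K"
      using equal_values_close[OF K \<open>0 < d\<close> vr w] v by blast
    moreover have "Q (drop i v) \<in> carrier_vec d" by (rule Q_carrier[OF lists_box[OF drop_in_lists[OF vr]]])
    ultimately have "Q (drop i v) \<in> box K" using i by simp
    moreover have "q v i < ?n" using q[of v i] v run_states_closed[OF B] by blast
    ultimately show "(q v i, Q (drop i v)) \<in> {..<?n} \<times> box K" by simp
  next
    fix v i j assume v: "?P v" and ij: "i < j" "j \<le> length v"
      and eq: "(q v i, Q (drop i v)) = (q v j, Q (drop j v))"
    have vr: "v \<in> lists (carrier_vec d)" using v L lists_box by blast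
    have "take i v @ drop j v \<in> ?L"
      using q[of v i] q[of v j] v eq unfolding recognized_append by auto
    moreover have "Q (take i v @ drop j v) = Q (take i v @ drop i v)"
      unfolding Q_append[OF take_in_lists[OF vr] drop_in_lists[OF vr]] using eq by (metis prod.inject)
    ultimately show "?P (take i v @ drop j v)" using v by simp
  qed (rule v0)
  then show thesis using that[of v] by simp
qed

text \<open>The topology lives on nonnegative vectors. Words whose value has a negative entry are no
  points of a neighbourhood and count as hit.\<close>

definition hit_words :: "int vec list set \<Rightarrow> int vec list set" where
  "hit_words L = {w. Q w \<in> nonneg_vecs d \<longrightarrow> Q w \<in> Q ` L}"

definition universal_words :: "nat \<Rightarrow> nat \<Rightarrow> int vec list set \<Rightarrow> int vec list set" where
  "universal_words r N L = {u \<in> L. Q u \<in> nonneg_vecs d \<and>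
     universal (box r) (hit_words L) (u @ replicate N (0\<^sub>v d))}"

text \<open>With c the number of points of the box of radius K, the exponent adds n for the
  residuals of B, c for nonnegativity and c + Suc n * c for \<open>hit_words\<close>.\<close>

definition state_bound :: "nat \<Rightarrow> nat \<Rightarrow> nat" where
  "state_bound n c = 2 ^ (n + 2 * c + Suc n * c)"

lemma index_le_hit_words:
  assumes K: "escape_radius (2 * r) K" and "0 < d" and B: "automaton_over \<Sigma> B" and \<Sigma>: "\<Sigma> \<subseteq> box r"
  defines "c \<equiv> (2 * K + 1) ^ d" and "n \<equiv> num_states B"
  shows "index_le (box r) (hit_words (recognized B)) (2 ^ (c + Suc n * c))"
proof -
  let ?L = "recognized B"
  obtain F where F: "\<forall>w\<in>lists (box r). residual (box r) nonneg_words w \<in> F" "finite F" "card F \<le> 2 ^ c"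
    by (rule index_leD_kernel[OF index_le_nonneg_words[OF K, of r]]) (auto simp: c_def)
  obtain G where G: "\<forall>w\<in>lists (box r). residual (box r) (value_words ?L) w \<in> G" "finite G" "card G \<le> 2 ^ (Suc n * c)"
    by (rule index_leD_kernel[OF index_le_value_words[OF K \<open>0 < d\<close> B \<Sigma>]]) (auto simp: c_def n_def)
  show ?thesis
  proof (rule index_le_if_kernel)
    show "(\<lambda>u. (residual (box r) nonneg_words u, residual (box r) (value_words ?L) u)) ` lists (box r) \<subseteq> F \<times> G"
      using F(1) G(1) by blast
    show "finite (F \<times> G)" using F(2) G(2) by blast
    show "card (F \<times> G) \<le> 2 ^ (c + Suc n * c)"
      unfolding card_cartesian_product power_add by (rule mult_le_mono[OF F(3) G(3)])
    fix u u' assume eq: "(residual (box r) nonneg_words u, residual (box r) (value_words ?L) u) =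
      (residual (box r) nonneg_words u', residual (box r) (value_words ?L) u')"
    have "residual (box r) (hit_words ?L) v =
        (lists (box r) - residual (box r) nonneg_words v) \<union> residual (box r) (value_words ?L) v" for v
      by (auto simp: residual_def hit_words_def)
    then show "residual (box r) (hit_words ?L) u = residual (box r) (hit_words ?L) u'" using eq by simp
  qed
qed

text \<open>Three residuals of u decide the class: for the language, for nonnegativity and for
  \<open>hit_words\<close>. The last is taken over the whole box, because the words behind the
  appended zeros range over the box and not only over \<Sigma>.\<close>

lemma index_le_universal_words:
  assumes K: "escape_radius (2 * r) K" and "0 < d" and B: "automaton_over \<Sigma> B" and \<Sigma>: "\<Sigma> \<subseteq> box r"
  shows "index_le \<Sigma> (universal_words r N (recognized B)) (state_bound (num_states B) ((2 * K + 1) ^ d))"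
proof -
  let ?L = "recognized B" and ?c = "(2 * K + 1) ^ d" and ?n = "num_states B"
  let ?f1 = "residual \<Sigma> ?L" and ?f2 = "residual \<Sigma> nonneg_words" and ?f3 = "residual (box r) (hit_words ?L)"
  obtain F where F: "\<forall>w\<in>lists \<Sigma>. ?f1 w \<in> F" "finite F" "card F \<le> 2 ^ ?n"
    by (rule index_leD_kernel[OF index_le_recognized[OF B, of \<Sigma>]])
  obtain G where G: "\<forall>w\<in>lists \<Sigma>. ?f2 w \<in> G" "finite G" "card G \<le> 2 ^ ?c"
    by (rule index_leD_kernel[OF index_le_subset[OF index_le_nonneg_words[OF K, of r] \<Sigma>]]) auto
  obtain H where H: "\<forall>w\<in>lists (box r). ?f3 w \<in> H" "finite H" "card H \<le> 2 ^ (?c + Suc ?n * ?c)"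
    by (rule index_leD_kernel[OF index_le_hit_words[OF K \<open>0 < d\<close> B \<Sigma>]])
  have sub: "lists \<Sigma> \<subseteq> lists (box r)" by (rule lists_mono[OF \<Sigma>])
  show ?thesis
  proof (rule index_le_if_kernel)
    show "(\<lambda>u. (?f1 u, ?f2 u, ?f3 u)) ` lists \<Sigma> \<subseteq> F \<times> G \<times> H" using F(1) G(1) H(1) sub by blast
    show "finite (F \<times> G \<times> H)" using F(2) G(2) H(2) by blast
    have "card (F \<times> G \<times> H) \<le> 2 ^ ?n * (2 ^ ?c * 2 ^ (?c + Suc ?n * ?c))"
      unfolding card_cartesian_product by (intro mult_le_mono F(3) G(3) H(3))
    also have "\<dots> = state_bound ?n ?c"
      unfolding state_bound_def power_add[symmetric] by (rule arg_cong[where f = "(^) 2"]) simp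
    finally show "card (F \<times> G \<times> H) \<le> state_bound ?n ?c" .
    fix u u' assume "(?f1 u, ?f2 u, ?f3 u) = (?f1 u', ?f2 u', ?f3 u')"
    then have eq: "?f1 u = ?f1 u'" "?f2 u = ?f2 u'" "?f3 u = ?f3 u'" by simp_all
    show "residual \<Sigma> (universal_words r N ?L) u = residual \<Sigma> (universal_words r N ?L) u'"
      unfolding residual_def[of _ "universal_words r N ?L"]
    proof (intro Collect_cong conj_cong refl)
      fix w assume w: "w \<in> lists \<Sigma>"
      have "w @ replicate N (0\<^sub>v d) \<in> lists (box r)" using w sub by (auto simp: in_lists_conv_set)
      then have "universal (box r) (hit_words ?L) (u @ w @ replicate N (0\<^sub>v d)) =
          universal (box r) (hit_words ?L) (u' @ w @ replicate N (0\<^sub>v d))"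
        by (intro universal_residual residual_append eq(3))
      moreover have "u @ w \<in> ?L \<longleftrightarrow> u' @ w \<in> ?L" "Q (u @ w) \<in> nonneg_vecs d \<longleftrightarrow> Q (u' @ w) \<in> nonneg_vecs d"
        using residual_mem[OF residual_append[OF eq(1) w]] residual_mem[OF residual_append[OF eq(2) w]]
        by simp_all
      ultimately show "u @ w \<in> universal_words r N ?L \<longleftrightarrow> u' @ w \<in> universal_words r N ?L"
        by (simp add: universal_words_def)
    qed
  qed
qed

text \<open>Makes universality a finite test: \<open>universal_short\<close> bounds the extensions
  w, \<open>short_preimage\<close> bounds the words v that hit their values, and
  \<open>state_bound\<close> dominates both bounds.\<close>

lemma universal_bounded:
  assumes K: "escape_radius (2 * r) K" and "0 < d" and B: "automaton_over \<Sigma> B" and \<Sigma>: "\<Sigma> \<subseteq> box r"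
    and u: "u \<in> lists (box r)" and N: "state_bound (num_states B) ((2 * K + 1) ^ d) \<le> N"
  shows "universal (box r) (hit_words (recognized B)) u \<longleftrightarrow>
    (\<forall>w\<in>lists (box r). length w \<le> N \<longrightarrow> Q (u @ w) \<in> nonneg_vecs d \<longrightarrow>
       (\<exists>v\<in>recognized B. length v \<le> length (u @ w) + N \<and> Q v = Q (u @ w)))" (is "?l \<longleftrightarrow> ?r")
proof
  let ?n = "num_states B" and ?c = "(2 * K + 1) ^ d"
  have "?n * ?c \<le> 2 ^ (?n * ?c)" by (simp add: less_imp_le)
  also have "\<dots> \<le> state_bound ?n ?c" unfolding state_bound_def by (intro power_increasing) auto
  finally have nc: "?n * ?c \<le> N" using N by simp
  show ?r if ?l
  proof (intro ballI impI)
    fix w assume w: "w \<in> lists (box r)" "Q (u @ w) \<in> nonneg_vecs d"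
    then have "Q (u @ w) \<in> Q ` recognized B" using \<open>?l\<close> unfolding universal_def hit_words_def by blast
    moreover have "u @ w \<in> lists (box r)" using u w(1) by simp
    ultimately obtain v where "v \<in> recognized B" "Q v = Q (u @ w)" "length v \<le> length (u @ w) + ?n * ?c"
      using short_preimage[OF K \<open>0 < d\<close> B \<Sigma>] by blast
    then show "\<exists>v\<in>recognized B. length v \<le> length (u @ w) + N \<and> Q v = Q (u @ w)" using nc by force
  qed
  show ?l if ?r
  proof (rule universal_short[OF index_le_hit_words[OF K \<open>0 < d\<close> B \<Sigma>] u])
    fix w assume w: "w \<in> lists (box r)" "length w < 2 ^ (?c + Suc ?n * ?c)"
    have "(2::nat) ^ (?c + Suc ?n * ?c) \<le> state_bound ?n ?c"
      unfolding state_bound_def by (intro power_increasing) auto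
    then have "length w \<le> N" using w(2) N by simp
    then show "u @ w \<in> hit_words (recognized B)" using that[rule_format, OF w(1)]
      unfolding hit_words_def mem_Collect_eq by (metis imageI)
  qed
qed

lemma universal_words_eq:
  assumes K: "escape_radius (2 * r) K" and "0 < d" and B: "automaton_over \<Sigma> B" and \<Sigma>: "\<Sigma> \<subseteq> box r"
    and N: "state_bound (num_states B) ((2 * K + 1) ^ d) \<le> N"
  shows "universal_words r N (recognized B) = {u \<in> recognized B. Q u \<in> nonneg_vecs d \<and>
     (\<exists>k. universal (box r) (hit_words (recognized B)) (u @ replicate k (0\<^sub>v d)))}"
proof -
  let ?n = "num_states B" and ?c = "(2 * K + 1) ^ d"
  have "(2::nat) ^ (?c + Suc ?n * ?c) \<le> state_bound ?n ?c"
    unfolding state_bound_def by (intro power_increasing) auto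
  then have idx: "index_le (box r) (hit_words (recognized B)) N"
    by (intro index_le_mono[OF index_le_hit_words[OF K \<open>0 < d\<close> B \<Sigma>]]) (use N in linarith)
  have "u \<in> lists (box r)" if "u \<in> recognized B" for u
    using that recognized_lists[OF B] lists_mono[OF \<Sigma>] by blast
  then show ?thesis
    using universal_replicate[OF idx _ zero_in_int_box] unfolding universal_words_def by blast
qed

end

section \<open>Spectral decomposition\<close>

text \<open>Over the rationals p is coprime to its derivative. The Bezout identity carries over to
  the complex numbers, where a double root would annihilate both.\<close>

lemma irreducible_no_double_root:
  fixes p :: "rat poly" and a :: complex
  assumes "irreducible p"
  shows "\<not> [:- a, 1:] ^ 2 dvd map_poly of_rat p"
proof
  assume "[:- a, 1:] ^ 2 dvd map_poly of_rat p"
  then obtain q where q: "map_poly of_rat p = [:- a, 1:] ^ 2 * q" by (elim dvdE)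
  have "poly (pderiv (X * X * q)) a = 0" if "poly X a = 0" for X
    by (simp add: pderiv_mult that)
  from this[of "[:- a, 1:]"] have root: "poly (map_poly of_rat p) a = 0" "poly (map_poly of_rat (pderiv p)) a = 0"
    unfolding of_rat_hom.map_poly_pderiv q power2_eq_square by simp_all
  have "p \<noteq> 0" "\<not> is_unit p" using assms by (auto simp: irreducible_def)
  then have deg: "degree p > 0" by (simp add: is_unit_iff_degree)
  then have "pderiv p \<noteq> 0" by (simp add: pderiv_eq_0_iff)
  have "\<not> p dvd pderiv p"
    using dvd_imp_degree_le[OF _ \<open>pderiv p \<noteq> 0\<close>, of p] deg by (auto simp: degree_pderiv)
  moreover have "prime_elem p" using assms by (rule irreducible_imp_prime_elem)
  ultimately have cop: "coprime p (pderiv p)" by (intro prime_elem_imp_coprime)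
  then obtain u v where uv: "u * p + v * pderiv p = 1"
    using bezout_coefficients_fst_snd[of p "pderiv p"] coprime_iff_gcd_eq_1 by metis
  interpret map_poly_hom: map_poly_comm_ring_hom "of_rat :: rat \<Rightarrow> complex" ..
  have "poly (map_poly of_rat (u * p + v * pderiv p)) a = (1 :: complex)" unfolding uv by simp
  then show False using root by (simp add: hom_distribs)
qed

lemma jordan_matrix_ones_pow:
  fixes ls :: "'a :: comm_ring_1 list"
  assumes "i < length ls" "j < length ls"
  shows "(jordan_matrix (map (\<lambda>a. (1, a)) ls) ^\<^sub>m k) $$ (i, j) = (if i = j then (ls ! i) ^ k else 0)"
proof -
  let ?B = "\<lambda>a :: 'a. mat 1 1 (\<lambda>_. a ^ k)"
  have block: "jordan_block 1 a ^\<^sub>m k = ?B a" for a :: 'a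
    unfolding jordan_block_pow by (rule eq_matI) auto
  have dims: "dim_row (diag_block_mat (map ?B ls)) = length ls \<and> dim_col (diag_block_mat (map ?B ls)) = length ls" for ls
    by (induction ls) (auto simp: Let_def)
  have "i < length ls \<Longrightarrow> j < length ls \<Longrightarrow>
      diag_block_mat (map ?B ls) $$ (i, j) = (if i = j then (ls ! i) ^ k else 0)" for ls i j
  proof (induction ls arbitrary: i j)
    case (Cons a ls)
    then show ?case using dims[of ls] by (auto simp: Let_def nth_Cons split: nat.splits)
  qed simp
  moreover have "jordan_matrix (map (\<lambda>a. (1, a)) ls) ^\<^sub>m k = diag_block_mat (map ?B ls)"
    unfolding jordan_matrix_pow by (simp add: comp_def block[unfolded One_nat_def])
  ultimately show ?thesis using assms by simp
qed

lemma det_zero_row: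
  fixes A :: "'a :: comm_ring_1 mat"
  assumes A: "A \<in> carrier_mat n n" and i: "i < n" and zero: "\<And>j. j < n \<Longrightarrow> A $$ (i, j) = 0"
  shows "det A = 0"
proof -
  have "(\<Prod>j = 0..<n. A $$ (j, p j)) = 0" if "p permutes {0..<n}" for p
    by (rule prod_zero[OF finite_atLeastLessThan], rule bexI[of _ i])
      (use i zero permutes_in_image[OF that, of i] in simp_all)
  then show ?thesis using A by (simp add: det_def')
qed

lemma det_pow_mat: "A \<in> carrier_mat n n \<Longrightarrow> det (A ^\<^sub>m k) = det A ^ k"
  by (induction k) (auto simp: det_mult[of _ n] mult.commute)

lemma geometric_decay_zero:
  fixes x :: real
  assumes "0 < r" "r < 1" "\<And>k. \<bar>x\<bar> \<le> C * r ^ k"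
  shows "x = 0"
proof -
  have "(\<lambda>k. C * r ^ k) \<longlonglongrightarrow> C * 0"
    by (intro tendsto_intros LIMSEQ_power_zero) (use assms in auto)
  then have "\<bar>x\<bar> \<le> C * 0" by (rule LIMSEQ_le_const) (use assms(3) in blast)
  then show ?thesis by simp
qed

lemma pow_mat_jordan:
  fixes A P R :: "complex mat"
  assumes P: "P \<in> carrier_mat n n" and R: "R \<in> carrier_mat n n" and ls: "length ls = n"
    and eq: "A ^\<^sub>m k = P * jordan_matrix (map (\<lambda>a. (1, a)) ls) ^\<^sub>m k * R"
    and ij: "i < n" "j < n"
  shows "(A ^\<^sub>m k) $$ (i, j) = (\<Sum>l<n. P $$ (i, l) * (ls ! l) ^ k * R $$ (l, j))"
proof -
  let ?J = "jordan_matrix (map (\<lambda>a. (1, a)) ls) ^\<^sub>m k"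
  have "sum_list (map fst (map (\<lambda>a. (1 :: nat, a)) ls)) = n" using ls by (simp add: comp_def sum_list_triv)
  then have J: "?J \<in> carrier_mat n n" by (metis jordan_matrix_carrier pow_carrier_mat)
  have PJ: "(P * ?J) $$ (i, l) = P $$ (i, l) * (ls ! l) ^ k" if "l < n" for l
  proof -
    have "(P * ?J) $$ (i, l) = (\<Sum>m<n. P $$ (i, m) * ?J $$ (m, l))"
      using P J ij that by (auto simp: scalar_prod_def atLeast0LessThan intro!: sum.cong)
    also have "\<dots> = (\<Sum>m<n. if m = l then P $$ (i, m) * (ls ! l) ^ k else 0)"
      by (rule sum.cong) (use jordan_matrix_ones_pow[of _ ls _ k] ls that in auto)
    finally show ?thesis using that by simp
  qed
  have "(A ^\<^sub>m k) $$ (i, j) = (\<Sum>l<n. (P * ?J) $$ (i, l) * R $$ (l, j))"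
    unfolding eq using P J R ij by (subst index_mult_mat) (auto simp: scalar_prod_def atLeast0LessThan intro!: sum.cong)
  also have "\<dots> = (\<Sum>l<n. P $$ (i, l) * (ls ! l) ^ k * R $$ (l, j))"
    by (rule sum.cong) (simp_all only: PJ lessThan_iff)
  finally show ?thesis .
qed

text \<open>An exponent above 1 and a root listed twice would both produce a square factor.\<close>

lemma irreducible_linear_factors_distinct:
  fixes p :: "rat poly" and n_as :: "(nat \<times> complex) list"
  assumes p: "irreducible p" and eq: "map_poly of_rat p = (\<Prod>(n, a)\<leftarrow>n_as. [:- a, 1:] ^ n)"
    and pos: "0 \<notin> fst ` set n_as"
  shows "n_as = map (\<lambda>a. (1, a)) (map snd n_as)" "distinct (map snd n_as)"
proof -
  have "fst x = 1" if "x \<in> set n_as" for x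
  proof (rule ccontr)
    obtain n a where x: "x = (n, a)" by force
    assume "fst x \<noteq> 1"
    moreover have "n \<noteq> 0" using pos that x by force
    ultimately have "2 \<le> n" using x by simp
    then have "[:- a, 1:] ^ 2 dvd [:- a, 1:] ^ n" by (rule le_imp_power_dvd)
    also have "\<dots> dvd map_poly of_rat p"
    proof -
      obtain xs ys where "n_as = xs @ (n, a) # ys" using \<open>x \<in> set n_as\<close> x split_list by metis
      then have "map_poly of_rat p =
          [:- a, 1:] ^ n * ((\<Prod>(n, a)\<leftarrow>xs. [:- a, 1:] ^ n) * (\<Prod>(n, a)\<leftarrow>ys. [:- a, 1:] ^ n))"
        unfolding eq by (simp only: map_append list.map prod_list.append prod_list.Cons case_prod_conv mult_ac)
      then show ?thesis by (metis dvd_triv_left)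
    qed
    finally show False using irreducible_no_double_root[OF p] by blast
  qed
  then have one: "n_as = map (\<lambda>a. (1, a)) (map snd n_as)"
    unfolding map_map by (intro map_idI[symmetric]) (auto simp: prod_eq_iff)
  then show "n_as = map (\<lambda>a. (1, a)) (map snd n_as)" .
  show "distinct (map snd n_as)"
  proof (rule ccontr)
    assume "\<not> distinct (map snd n_as)"
    then obtain xs ys zs a where d: "map snd n_as = xs @ [a] @ ys @ [a] @ zs"
      using not_distinct_decomp by blast
    have "map_poly of_rat p = (\<Prod>b\<leftarrow>map snd n_as. [:- b, 1:])"
      unfolding eq by (subst one) (simp add: comp_def)
    also have "\<dots> = [:- a, 1:] ^ 2 * ((\<Prod>b\<leftarrow>xs. [:- b, 1:]) * (\<Prod>b\<leftarrow>ys. [:- b, 1:]) * (\<Prod>b\<leftarrow>zs. [:- b, 1:]))"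
      unfolding d power2_eq_square map_append prod_list.append by (simp only: list.map prod_list.Cons prod_list.Nil mult_ac mult_1_right mult_1_left)
    finally show False using irreducible_no_double_root[OF p, of a] by (metis dvd_triv_left)
  qed
qed

text \<open>Simple roots make the Jordan form diagonal, so entries of the k-th power of M are linear
  combinations of k-th powers of eigenvalues. The functions p and q are the column of P and the row
  of R that belong to \<beta>. All other eigenvalues are conjugates of \<beta>, hence of modulus
  less than 1.\<close>

lemma pisot_spectral_complex:
  assumes M: "irreducible_pisot_unimodular d M" and \<beta>: "maximal_eigenvalue M \<beta>"
  obtains p q :: "nat \<Rightarrow> complex" and C r where "1 < \<beta>" "0 < r" "r < 1" "0 < d"
    "\<And>k i j. i < d \<Longrightarrow> j < d \<Longrightarrow> cmod (of_int ((M ^\<^sub>m k) $$ (i, j)) - of_real \<beta> ^ k * p i * q j) \<le> C * r ^ k"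
proof -
  let ?R = "map_mat rat_of_int M" and ?C = "map_mat complex_of_int M" and ?p = "char_poly (map_mat rat_of_int M)"
  have Mc: "M \<in> carrier_mat d d" and irr: "irreducible ?p"
    using M by (auto simp: irreducible_pisot_unimodular_def)
  obtain \<gamma> where \<gamma>: "maximal_eigenvalue M \<gamma>" "pisot_number \<gamma>"
    using M by (auto simp: irreducible_pisot_unimodular_def)
  have pC: "char_poly ?C = map_poly of_rat ?p"
  proof -
    have C: "?C = map_mat of_rat ?R" by (rule eq_matI) auto
    show ?thesis unfolding C by (rule of_rat_hom.char_poly_hom) (use Mc in simp)
  qed
  have pR: "char_poly (map_mat real_of_int M) = map_poly of_rat ?p"
  proof -
    have C: "map_mat real_of_int M = map_mat of_rat ?R" by (rule eq_matI) auto
    show ?thesis unfolding C by (rule of_rat_hom.char_poly_hom) (use Mc in simp)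
  qed
  have eigR: "eigenvalue (map_mat real_of_int M) x \<longleftrightarrow> poly (map_poly of_rat ?p) x = 0" for x
    using eigenvalue_root_char_poly[of "map_mat real_of_int M" d] Mc pR by simp
  have eigC: "eigenvalue ?C z \<longleftrightarrow> poly (map_poly of_rat ?p) z = 0" for z
    using eigenvalue_root_char_poly[of ?C d] Mc pC by simp
  have real_root: "poly (map_poly of_rat ?p) (complex_of_real x) = of_real (poly (map_poly of_rat ?p) x)" for x
  proof -
    have "complex_of_real (of_rat y) = of_rat y" for y
      by (cases y) (simp add: of_rat_rat)
    then have "map_poly of_rat ?p = (map_poly complex_of_real (map_poly of_rat ?p))"
      by (intro poly_eqI) (simp add: coeff_map_poly)
    then show ?thesis by (metis of_real_hom.poly_map_poly)
  qed
  have root: "poly (map_poly of_rat ?p) \<beta> = 0" using \<beta> eigR by (simp add: maximal_eigenvalue_def)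
  have root\<gamma>: "poly (map_poly of_rat ?p) \<gamma> = 0" using \<gamma> eigR by (simp add: maximal_eigenvalue_def)
  have "1 < \<gamma>" using \<gamma>(2) by (simp add: pisot_number_def)
  have "eigenvalue ?C (of_real \<beta>)" "eigenvalue ?C (of_real \<gamma>)"
    unfolding eigC real_root root root\<gamma> by simp_all
  \<comment> \<open>The given \<beta> and the Pisot number \<gamma> from the hypothesis on M are
    both maximal, so they bound each other.\<close>
  then have "cmod (of_real \<beta>) \<le> \<gamma>" "cmod (of_real \<gamma>) \<le> \<beta>"
    using \<gamma>(1) \<beta> unfolding maximal_eigenvalue_def by blast+
  then have "\<gamma> = \<beta>" using \<open>1 < \<gamma>\<close> by simp
  then have "1 < \<beta>" and pisot: "pisot_number \<beta>" using \<open>1 < \<gamma>\<close> \<gamma>(2) by auto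
  obtain as where "char_poly ?C = (\<Prod>a\<leftarrow>as. [:- a, 1:])"
    using char_poly_factorized[of ?C d] Mc by auto
  then obtain n_as where jnf: "jordan_nf ?C n_as"
    using jordan_nf_exists[of ?C d as] Mc by auto
  obtain P R where PR: "P \<in> carrier_mat d d" "R \<in> carrier_mat d d"
    and cp: "char_poly ?C = (\<Prod>(na, a)\<leftarrow>n_as. [:- a, 1:] ^ na)"
    and pow: "\<And>k. ?C ^\<^sub>m k = P * (jordan_matrix n_as)^\<^sub>m k * R"
    using jordan_nf_powE[of ?C d n_as] Mc jnf by (metis map_carrier_mat)
  define ls where "ls = map snd n_as"
  have ones: "n_as = map (\<lambda>a. (1, a)) ls" and dist: "distinct ls"
    unfolding ls_def using irreducible_linear_factors_distinct[OF irr cp[unfolded pC]] jnf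
    by (auto simp: jordan_nf_def)
  have cp_ls: "char_poly ?C = (\<Prod>a\<leftarrow>ls. [:- a, 1:])"
    unfolding cp by (subst ones) (simp add: comp_def)
  have len: "length ls = d"
  proof -
    have "degree (char_poly ?C) = d" using degree_monic_char_poly[of ?C d] Mc by simp
    moreover have "degree (\<Prod>a\<leftarrow>ls. [:- a, 1:]) = length ls" by (rule degree_linear_factors)
    ultimately show ?thesis using cp_ls by simp
  qed
  have roots: "poly (map_poly of_rat ?p) z = 0 \<longleftrightarrow> z \<in> set ls" for z :: complex
    unfolding pC[symmetric] cp_ls poly_prod_list prod_list_zero_iff by (auto simp: image_iff)
  obtain l0 where l0: "l0 < d" "ls ! l0 = of_real \<beta>"
    using roots[of "of_real \<beta>"] real_root[of \<beta>] root len by (auto simp: in_set_conv_nth)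
  have small: "cmod (ls ! l) < 1" if "l < d" "l \<noteq> l0" for l
  proof -
    have "ls ! l \<noteq> of_real \<beta>" using dist that l0 len by (metis nth_eq_iff_index_eq)
    moreover have "rat_conjugate \<beta> (ls ! l)"
      unfolding rat_conjugate_def using irr root roots[of "ls ! l"] that(1) len by (intro exI[of _ ?p]) auto
    ultimately show ?thesis using pisot by (simp add: pisot_number_def)
  qed
  \<comment> \<open>The entry 1/2 makes the set nonempty and r positive without any look at the
    other eigenvalues.\<close>
  define r where "r = Max (insert (1 / 2) ((\<lambda>l. cmod (ls ! l)) ` ({..<d} - {l0})))"
  have r: "0 < r" "r < 1" "\<And>l. l < d \<Longrightarrow> l \<noteq> l0 \<Longrightarrow> cmod (ls ! l) \<le> r"
  proof -
    have "1 / 2 \<le> r" unfolding r_def by (rule Max_ge) auto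
    then show "0 < r" by simp
    show "r < 1" unfolding r_def by (subst Max_less_iff) (use small in auto)
    show "cmod (ls ! l) \<le> r" if "l < d" "l \<noteq> l0" for l
      unfolding r_def by (rule Max_ge) (use that in auto)
  qed
  define C where "C = (\<Sum>i<d. \<Sum>j<d. \<Sum>l<d. cmod (P $$ (i, l)) * cmod (R $$ (l, j)))"
  have bound: "cmod (of_int ((M ^\<^sub>m k) $$ (i, j)) - of_real \<beta> ^ k * P $$ (i, l0) * R $$ (l0, j)) \<le> C * r ^ k"
    if ij: "i < d" "j < d" for k i j
  proof -
    let ?f = "\<lambda>l. P $$ (i, l) * (ls ! l) ^ k * R $$ (l, j)"
    have "map_mat complex_of_int (M ^\<^sub>m k) = ?C ^\<^sub>m k" using Mc by (rule of_int_hom.mat_hom_pow)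
    then have "of_int ((M ^\<^sub>m k) $$ (i, j)) = (?C ^\<^sub>m k) $$ (i, j)"
      using ij Mc by (metis carrier_matD index_map_mat(1) pow_carrier_mat)
    also have "\<dots> = (\<Sum>l<d. ?f l)"
      by (rule pow_mat_jordan[OF PR len _ ij]) (use pow ones in metis)
    also have "\<dots> = ?f l0 + (\<Sum>l\<in>{..<d} - {l0}. ?f l)" using l0(1) by (subst sum.remove[of _ l0]) auto
    finally have "of_int ((M ^\<^sub>m k) $$ (i, j)) - of_real \<beta> ^ k * P $$ (i, l0) * R $$ (l0, j) =
        (\<Sum>l\<in>{..<d} - {l0}. ?f l)" using l0(2) by (simp add: mult_ac)
    also have "cmod \<dots> \<le> (\<Sum>l\<in>{..<d} - {l0}. cmod (?f l))" by (rule norm_sum)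
    also have "\<dots> \<le> (\<Sum>l\<in>{..<d} - {l0}. cmod (P $$ (i, l)) * cmod (R $$ (l, j)) * r ^ k)"
    proof (rule sum_mono)
      fix l assume "l \<in> {..<d} - {l0}"
      then have "cmod (ls ! l) ^ k \<le> r ^ k" using r(3) by (intro power_mono) auto
      then have "cmod (P $$ (i, l)) * cmod (R $$ (l, j)) * cmod (ls ! l) ^ k
          \<le> cmod (P $$ (i, l)) * cmod (R $$ (l, j)) * r ^ k" by (intro mult_left_mono) auto
      then show "cmod (?f l) \<le> cmod (P $$ (i, l)) * cmod (R $$ (l, j)) * r ^ k"
        by (simp add: norm_mult norm_power mult_ac)
    qed
    also have "\<dots> \<le> (\<Sum>l<d. cmod (P $$ (i, l)) * cmod (R $$ (l, j)) * r ^ k)"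
      by (rule sum_mono2) (use r in auto)
    also have "\<dots> = (\<Sum>l<d. cmod (P $$ (i, l)) * cmod (R $$ (l, j))) * r ^ k" by (simp add: sum_distrib_right)
    also have "\<dots> \<le> C * r ^ k"
    proof (rule mult_right_mono)
      have "(\<Sum>l<d. cmod (P $$ (i, l)) * cmod (R $$ (l, j))) \<le>
          (\<Sum>j<d. \<Sum>l<d. cmod (P $$ (i, l)) * cmod (R $$ (l, j)))"
        using ij(2) by (intro member_le_sum[of j "{..<d}" "\<lambda>j. \<Sum>l<d. cmod (P $$ (i, l)) * cmod (R $$ (l, j))"])
          (auto intro: sum_nonneg)
      also have "\<dots> \<le> C" unfolding C_def
        using ij(1) by (intro member_le_sum[of i "{..<d}" "\<lambda>i. \<Sum>j<d. \<Sum>l<d. cmod (P $$ (i, l)) * cmod (R $$ (l, j))"])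
          (auto intro!: sum_nonneg)
      finally show "(\<Sum>l<d. cmod (P $$ (i, l)) * cmod (R $$ (l, j))) \<le> C" .
    qed (use r in simp)
    finally show ?thesis .
  qed
  show thesis by (rule that[OF \<open>1 < \<beta>\<close> r(1,2) _ bound]) (use l0 in simp_all)
qed

section \<open>Height along the eigenline and transversal contraction\<close>

lemma close_same_sign: "\<bar>a - b\<bar> \<le> e \<Longrightarrow> e < \<bar>b\<bar> \<Longrightarrow> 0 < a * b" for a b e :: real
  by (cases "0 < b") (auto intro: mult_pos_pos mult_neg_neg)

lemma same_sign_mult:
  fixes a b w h k :: real
  assumes "0 < a * (w * h)" "0 < b * (w * k)" "0 < h * k"
  shows "0 < a * b"
proof -
  have "w \<noteq> 0" using assms(1) by auto
  then have "0 < w ^ 2 * (h * k)" using assms(3) by simp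
  moreover have "0 < (a * b) * (w ^ 2 * (h * k))"
    using mult_pos_pos[OF assms(1,2)] by (simp add: power2_eq_square mult_ac)
  ultimately show ?thesis using zero_less_mult_pos2 by blast
qed

text \<open>The real form of the spectral data: the k-th power of M is \<beta>^k times the rank one
  matrix formed by the right eigenvector \<open>v\<close> and the left eigenvector \<open>c\<close>,
  up to an error that decays like r^k.\<close>

locale pisot_matrix = int_matrix +
  fixes \<beta> C r :: real and v c :: "nat \<Rightarrow> real"
  assumes \<beta>: "1 < \<beta>" and r: "0 < r" "r < 1" and d: "0 < d"
    and det: "det M \<in> {1, - 1}"
    and v: "i < d \<Longrightarrow> v i \<noteq> 0"
    and right: "i < d \<Longrightarrow> (\<Sum>j<d. real_of_int (M $$ (i, j)) * v j) = \<beta> * v i"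
    and left: "j < d \<Longrightarrow> (\<Sum>i<d. c i * real_of_int (M $$ (i, j))) = \<beta> * c j"
    and decay: "i < d \<Longrightarrow> j < d \<Longrightarrow> \<bar>real_of_int ((M ^\<^sub>m k) $$ (i, j)) - \<beta> ^ k * v i * c j\<bar> \<le> C * r ^ k"
begin

text \<open>The coordinate along \<open>v\<close> for the splitting into the eigenline and the
  invariant contracting hyperplane; it does not depend on the hyperplane \<open>P\<close> of the
  projection.\<close>

definition height :: "int vec \<Rightarrow> real" where
  "height x = (\<Sum>j<d. c j * real_of_int (x $ j))"

definition transversal :: "int vec \<Rightarrow> nat \<Rightarrow> real" where
  "transversal x i = real_of_int (x $ i) - v i * height x"

lemma C_nonneg: "0 \<le> C"
proof -
  have "0 \<le> C * r ^ 0" by (rule order_trans[OF abs_ge_zero decay[OF d d]])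
  then show ?thesis by simp
qed

lemma height_add: "x \<in> carrier_vec d \<Longrightarrow> y \<in> carrier_vec d \<Longrightarrow> height (x + y) = height x + height y"
  by (simp add: height_def sum.distrib distrib_left)

lemma height_mult_M:
  assumes "x \<in> carrier_vec d"
  shows "height (M *\<^sub>v x) = \<beta> * height x"
proof -
  have "height (M *\<^sub>v x) = (\<Sum>i<d. \<Sum>j<d. c i * real_of_int (M $$ (i, j)) * real_of_int (x $ j))"
    unfolding height_def by (rule sum.cong) (simp_all add: index_mult_M[OF assms] sum_distrib_left mult_ac)
  also have "\<dots> = (\<Sum>j<d. (\<Sum>i<d. c i * real_of_int (M $$ (i, j))) * real_of_int (x $ j))"
    by (subst sum.swap) (simp add: sum_distrib_right)
  also have "\<dots> = \<beta> * height x"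
    unfolding height_def sum_distrib_left by (rule sum.cong) (simp_all add: left mult_ac)
  finally show ?thesis .
qed

lemma height_zero [simp]: "height (0\<^sub>v d) = 0"
  by (simp add: height_def)

lemma height_Q: "u \<in> lists (carrier_vec d) \<Longrightarrow> height (Q u) = (\<Sum>k<length u. \<beta> ^ k * height (u ! k))"
proof (induction u)
  case (Cons a u)
  then have "height (Q (a # u)) = height a + \<beta> * (\<Sum>k<length u. \<beta> ^ k * height (u ! k))"
    by (simp add: Q_Cons height_add height_mult_M)
  also have "\<dots> = (\<Sum>k<length (a # u). \<beta> ^ k * height ((a # u) ! k))"
    unfolding list.size add_Suc_right add_0_right sum.lessThan_Suc_shift by (simp add: sum_distrib_left mult_ac)
  finally show ?case .
qed simp

lemma transversal_term:
  assumes x: "x \<in> box s" and i: "i < d"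
  shows "\<bar>real_of_int ((M ^\<^sub>m k *\<^sub>v x) $ i) - v i * (\<beta> ^ k * height x)\<bar> \<le> real d * C * real s * r ^ k"
proof -
  have xc: "x \<in> carrier_vec d" using x by (rule int_box_carrier)
  have "(M ^\<^sub>m k *\<^sub>v x) $ i = (\<Sum>j<d. (M ^\<^sub>m k) $$ (i, j) * x $ j)"
    using xc i pow_M_carrier[of k]
    by (auto simp: index_mult_mat_vec scalar_prod_def atLeast0LessThan intro!: sum.cong)
  then have "real_of_int ((M ^\<^sub>m k *\<^sub>v x) $ i) = (\<Sum>j<d. real_of_int ((M ^\<^sub>m k) $$ (i, j)) * real_of_int (x $ j))"
    by simp
  moreover have "v i * (\<beta> ^ k * height x) = (\<Sum>j<d. \<beta> ^ k * v i * c j * real_of_int (x $ j))"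
    unfolding height_def sum_distrib_left by (rule sum.cong) (simp_all add: mult_ac)
  ultimately have "real_of_int ((M ^\<^sub>m k *\<^sub>v x) $ i) - v i * (\<beta> ^ k * height x) =
      (\<Sum>j<d. (real_of_int ((M ^\<^sub>m k) $$ (i, j)) - \<beta> ^ k * v i * c j) * real_of_int (x $ j))"
    by (simp only: left_diff_distrib sum_subtractf)
  also have "\<bar>\<dots>\<bar> \<le> (\<Sum>j<d. \<bar>(real_of_int ((M ^\<^sub>m k) $$ (i, j)) - \<beta> ^ k * v i * c j) * real_of_int (x $ j)\<bar>)"
    by (rule sum_abs)
  also have "\<dots> \<le> (\<Sum>j<d. (C * r ^ k) * real s)"
  proof (rule sum_mono)
    fix j assume "j \<in> {..<d}"
    then have "\<bar>x $ j\<bar> \<le> int s" using x by (simp add: int_box_def)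
    then have "\<bar>real_of_int (x $ j)\<bar> \<le> real s" by linarith
    then show "\<bar>(real_of_int ((M ^\<^sub>m k) $$ (i, j)) - \<beta> ^ k * v i * c j) * real_of_int (x $ j)\<bar> \<le> C * r ^ k * real s"
      unfolding abs_mult using decay[OF i, of j k] \<open>j \<in> {..<d}\<close> by (intro mult_mono) auto
  qed
  finally show ?thesis by (simp add: mult_ac)
qed

text \<open>The sum of a geometric series: a letter of the box at position k has transversal part at
  most d C s r^k.\<close>

definition spread :: "nat \<Rightarrow> real" where
  "spread s = real d * C * real s / (1 - r)"

lemma spread_nonneg: "0 \<le> spread s"
  unfolding spread_def using C_nonneg r by simp

text \<open>All values over a bounded alphabet lie in a tube around the eigenline, however large
  their heights, because the transversal contributions of the positions are summable. Leading zeros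
  remove the first n terms of the series and leave the factor r^n.\<close>

lemma transversal_Q:
  assumes "u \<in> lists (box s)" and i: "i < d"
  shows "\<bar>transversal (Q (replicate n (0\<^sub>v d) @ u)) i\<bar> \<le> r ^ n * spread s"
proof -
  let ?w = "replicate n (0\<^sub>v d) @ u"
  have w: "?w \<in> lists (carrier_vec d)" using lists_box[OF assms(1)] by (auto simp: in_lists_conv_set)
  have len: "length ?w = n + length u" by simp
  define f where "f k = real_of_int ((M ^\<^sub>m k *\<^sub>v (?w ! k)) $ i) - v i * (\<beta> ^ k * height (?w ! k))" for k
  let ?b = "\<lambda>k. if k < n then 0 else real d * C * real s * r ^ k"
  have "transversal (Q ?w) i = (\<Sum>k<n + length u. f k)"
    unfolding transversal_def Q_index[OF w i] height_Q[OF w] len f_def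
    by (simp add: sum_subtractf sum_distrib_left)
  then have "\<bar>transversal (Q ?w) i\<bar> \<le> (\<Sum>k<n + length u. \<bar>f k\<bar>)" by simp
  also have "\<dots> \<le> (\<Sum>k<n + length u. ?b k)"
  proof (rule sum_mono)
    fix k assume k: "k \<in> {..<n + length u}"
    show "\<bar>f k\<bar> \<le> ?b k"
    proof (cases "k < n")
      case True
      then have "?w ! k \<in> box 0" by (simp add: nth_append)
      then show ?thesis using transversal_term[OF _ i, of "?w ! k" 0 k] True by (simp add: f_def)
    next
      case False
      then have "?w ! k \<in> box s" using k assms(1) by (auto simp: nth_append in_lists_conv_set)
      then show ?thesis using transversal_term[OF _ i, of "?w ! k" s k] False by (simp add: f_def)
    qed
  qed
  also have "(\<Sum>k<n + m. ?b k) = real d * C * real s * (r ^ n * (1 - r ^ m) / (1 - r))" for m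
  proof -
    have "(1 - r) * (\<Sum>k<n + m. ?b k) = real d * C * real s * (r ^ n * (1 - r ^ m))"
    proof (induction m)
      case (Suc m)
      have "(1 - r) * (\<Sum>k<n + Suc m. ?b k) = (1 - r) * (\<Sum>k<n + m. ?b k) + (1 - r) * (real d * C * real s * r ^ (n + m))"
        by (simp add: distrib_left)
      also have "\<dots> = real d * C * real s * (r ^ n * (1 - r ^ m)) + (1 - r) * (real d * C * real s * r ^ (n + m))"
        by (simp only: Suc)
      also have "\<dots> = real d * C * real s * (r ^ n * (1 - r ^ Suc m))"
        by (simp add: power_add algebra_simps)
      finally show ?case .
    qed simp
    then show ?thesis using r by (simp add: field_simps)
  qed
  also have "real d * C * real s * (r ^ n * (1 - r ^ length u) / (1 - r)) \<le> r ^ n * spread s"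
  proof -
    have "real d * C * real s * (r ^ n * (1 - r ^ length u) / (1 - r)) = (r ^ n * spread s) * (1 - r ^ length u)"
      by (simp add: spread_def)
    also have "\<dots> \<le> (r ^ n * spread s) * 1"
      using r spread_nonneg by (intro mult_left_mono) auto
    finally show ?thesis by simp
  qed
  finally show ?thesis .
qed

lemma height_bound: "x \<in> box s \<Longrightarrow> \<bar>height x\<bar> \<le> real s * (\<Sum>j<d. \<bar>c j\<bar>)"
proof -
  assume x: "x \<in> box s"
  have "\<bar>height x\<bar> \<le> (\<Sum>j<d. \<bar>c j * real_of_int (x $ j)\<bar>)" unfolding height_def by (rule sum_abs)
  also have "\<dots> \<le> (\<Sum>j<d. real s * \<bar>c j\<bar>)"
  proof (rule sum_mono)
    fix j assume "j \<in> {..<d}"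
    then have "\<bar>x $ j\<bar> \<le> int s" using x by (simp add: int_box_def)
    then have "\<bar>real_of_int (x $ j)\<bar> \<le> real s" by linarith
    then show "\<bar>c j * real_of_int (x $ j)\<bar> \<le> real s * \<bar>c j\<bar>"
      using mult_left_mono[of "\<bar>real_of_int (x $ j)\<bar>" "real s" "\<bar>c j\<bar>"] by (simp add: abs_mult mult.commute)
  qed
  finally show ?thesis by (simp add: sum_distrib_left)
qed

text \<open>Word values are split at a height T. Below T they are bounded and form \<open>A\<close>.
  From T on, v i times the height outweighs the transversal part, so the sign of the height fixes
  all signs. A step multiplies the height by \<beta> up to a bounded error, so a height beyond T
  keeps its sign and stays beyond T.\<close>

lemma certificate_exists:
  shows "\<exists>\<theta> A Z. finite A \<and> finite Z \<and> Z \<subseteq> carrier_vec d \<and> certificate s \<theta> A Z"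
proof -
  let ?h = "real s * (\<Sum>j<d. \<bar>c j\<bar>)"
  have h0: "0 \<le> ?h" by (simp add: sum_nonneg)
  define \<mu> where "\<mu> = Min ((\<lambda>i. \<bar>v i\<bar>) ` {..<d})"
  have \<mu>: "0 < \<mu>" "\<And>i. i < d \<Longrightarrow> \<mu> \<le> \<bar>v i\<bar>"
  proof -
    show "0 < \<mu>" unfolding \<mu>_def by (subst Min_gr_iff) (use d v in auto)
    show "\<mu> \<le> \<bar>v i\<bar>" if "i < d" for i unfolding \<mu>_def by (rule Min_le) (use that in auto)
  qed
  \<comment> \<open>The first summand makes T positive and the next estimate strict, the second
    gives T * \<mu> > \<open>spread s\<close> (signs follow the height), the third gives \<beta> * T
    - h \<ge> T (no return below T), where h bounds the height of a letter.\<close>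
  define T where "T = 1 + spread s / \<mu> + ?h / (\<beta> - 1)"
  have T1: "1 \<le> T" unfolding T_def using \<mu>(1) \<beta> h0 spread_nonneg by simp
  have T\<mu>: "spread s < T * \<mu>"
  proof -
    have "T * \<mu> = \<mu> + spread s + ?h / (\<beta> - 1) * \<mu>" unfolding T_def using \<mu>(1) by (simp add: algebra_simps)
    moreover have "0 \<le> ?h / (\<beta> - 1) * \<mu>" using \<mu>(1) \<beta> h0 by simp
    ultimately show ?thesis using \<mu>(1) by linarith
  qed
  have T\<beta>: "T \<le> \<beta> * T - ?h"
  proof -
    have "(\<beta> - 1) * T = (\<beta> - 1) * (1 + spread s / \<mu>) + ?h" unfolding T_def using \<beta> by (simp add: field_simps)
    moreover have "0 \<le> (\<beta> - 1) * (1 + spread s / \<mu>)" using \<beta> \<mu>(1) spread_nonneg by simp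
    ultimately show ?thesis by (simp add: algebra_simps)
  qed
  define \<theta> where "\<theta> = nat \<lceil>spread s + T * (\<Sum>i<d. \<bar>v i\<bar>)\<rceil>"
  define A where "A = {y. (\<exists>t\<in>lists (box s). y = Q t) \<and> \<bar>height y\<bar> < T}"
  define Z where "Z = {y \<in> box (cert_radius s \<theta>). (\<exists>t\<in>lists (box s). y = Q t) \<and> T \<le> \<bar>height y\<bar>}"
  have near: "\<bar>real_of_int (y $ i) - v i * height y\<bar> \<le> spread s" if "\<exists>t\<in>lists (box s). y = Q t" "i < d" for y i
    using that transversal_Q[of _ s i 0] by (auto simp: transversal_def)
  have carr: "y \<in> carrier_vec d" if "\<exists>t\<in>lists (box s). y = Q t" for y
    using that Q_carrier[OF lists_box] by blast
  have A_box: "A \<subseteq> box \<theta>"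
  proof
    fix y assume y: "y \<in> A"
    then have ex: "\<exists>t\<in>lists (box s). y = Q t" and hy: "\<bar>height y\<bar> < T" by (auto simp: A_def)
    have "\<bar>y $ i\<bar> \<le> int \<theta>" if i: "i < d" for i
    proof -
      have "\<bar>v i * height y\<bar> \<le> (\<Sum>i<d. \<bar>v i\<bar>) * T" unfolding abs_mult
        using hy i by (intro mult_mono member_le_sum[of i "{..<d}" "\<lambda>i. \<bar>v i\<bar>"]) (auto intro: sum_nonneg)
      then have "\<bar>real_of_int (y $ i)\<bar> \<le> spread s + T * (\<Sum>i<d. \<bar>v i\<bar>)"
        using near[OF ex i] by (simp add: mult.commute)
      then have "real_of_int \<bar>y $ i\<bar> \<le> real_of_int \<lceil>spread s + T * (\<Sum>i<d. \<bar>v i\<bar>)\<rceil>"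
        using le_of_int_ceiling[of "spread s + T * (\<Sum>i<d. \<bar>v i\<bar>)"] unfolding of_int_abs by (rule order_trans)
      then have "\<bar>y $ i\<bar> \<le> \<lceil>spread s + T * (\<Sum>i<d. \<bar>v i\<bar>)\<rceil>" unfolding of_int_le_iff .
      then show ?thesis unfolding \<theta>_def by linarith
    qed
    then show "y \<in> box \<theta>" using carr[OF ex] by (simp add: int_box_def)
  qed
  have step: "\<exists>t'\<in>lists (box s). t + M *\<^sub>v y = Q t'" "height (t + M *\<^sub>v y) = height t + \<beta> * height y"
    if yt: "\<exists>t\<in>lists (box s). y = Q t" "t \<in> box s" for y t
  proof -
    obtain u where u: "u \<in> lists (box s)" "y = Q u" using yt(1) by blast
    have "t + M *\<^sub>v y = Q (t # u)" using Q_Cons[OF int_box_carrier lists_box, OF yt(2) u(1)] u(2) by simp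
    moreover have "t # u \<in> lists (box s)" using u(1) yt(2) by simp
    ultimately show "\<exists>t'\<in>lists (box s). t + M *\<^sub>v y = Q t'" by blast
    show "height (t + M *\<^sub>v y) = height t + \<beta> * height y"
      by (simp only: height_add[OF int_box_carrier[OF yt(2)] mult_M_carrier[OF carr[OF yt(1)]]]
          height_mult_M[OF carr[OF yt(1)]])
  qed
  have sign: "0 < real_of_int (y $ i) * (v i * height y)" if "\<exists>t\<in>lists (box s). y = Q t" "T \<le> \<bar>height y\<bar>" "i < d" for y i
  proof -
    have "T * \<mu> \<le> \<bar>height y\<bar> * \<bar>v i\<bar>" using that(2) \<mu>(2)[OF that(3)] T1 \<mu>(1) by (intro mult_mono) auto
    then have big: "spread s < \<bar>v i * height y\<bar>" using T\<mu> by (simp add: abs_mult mult.commute)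
    have "\<bar>real_of_int (y $ i) - v i * height y\<bar> \<le> spread s" by (rule near[OF that(1,3)])
    with big show ?thesis by (rule close_same_sign[rotated])
  qed
  have "certificate s \<theta> A Z"
    unfolding certificate_def
  proof (intro conjI ballI impI)
    have "0\<^sub>v d = Q []" by simp
    then show "0\<^sub>v d \<in> A" unfolding A_def using T1 by (auto intro!: bexI[of _ "[]"])
    show "A \<subseteq> box \<theta>" by (rule A_box)
    show "t + M *\<^sub>v y \<in> A \<union> Z" if "y \<in> A" "t \<in> box s" "t + M *\<^sub>v y \<in> box (cert_radius s \<theta>)" for y t
      using step(1)[of y t] that by (force simp: A_def Z_def)
    fix y t assume y: "y \<in> Z" and t: "t \<in> box s" and yt: "t + M *\<^sub>v y \<in> box (cert_radius s \<theta>)"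
    have ex: "\<exists>t\<in>lists (box s). y = Q t" and hy: "T \<le> \<bar>height y\<bar>" using y by (auto simp: Z_def)
    note ht = step(2)[OF ex t] and ex' = step(1)[OF ex t]
    have hs: "\<bar>height t\<bar> \<le> ?h" by (rule height_bound[OF t])
    have \<beta>T: "\<beta> * T \<le> \<beta> * \<bar>height y\<bar>" using hy \<beta> by simp
    have big: "T \<le> \<bar>height (t + M *\<^sub>v y)\<bar>" and pos: "0 < height y * height (t + M *\<^sub>v y)"
    proof -
      have "(0 < height y \<and> T \<le> height (t + M *\<^sub>v y)) \<or> (height y < 0 \<and> height (t + M *\<^sub>v y) \<le> - T)"
      proof (cases "0 < height y")
        case True
        then show ?thesis using \<beta>T hs T\<beta> unfolding ht by auto
      next
        case False
        then have "height y < 0" "\<bar>height y\<bar> = - height y" using hy T1 by auto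
        then show ?thesis using \<beta>T hs T\<beta> unfolding ht by auto
      qed
      then show "T \<le> \<bar>height (t + M *\<^sub>v y)\<bar>" "0 < height y * height (t + M *\<^sub>v y)"
        using T1 by (auto simp: zero_less_mult_iff)
    qed
    show "t + M *\<^sub>v y \<in> Z" unfolding Z_def using yt ex' big by blast
    show "same_sign d y (t + M *\<^sub>v y)"
      unfolding same_sign_def
    proof (intro allI impI)
      fix i assume i: "i < d"
      have "0 < real_of_int (y $ i) * real_of_int ((t + M *\<^sub>v y) $ i)"
        by (rule same_sign_mult[OF sign[OF ex hy i] sign[OF ex' big i] pos])
      then show "0 < y $ i * (t + M *\<^sub>v y) $ i" by (metis of_int_0_less_iff of_int_mult)
    qed
  qed
  moreover have "finite A" using A_box card_int_box finite_subset by blast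
  moreover have "finite Z" "Z \<subseteq> carrier_vec d"
    unfolding Z_def using card_int_box int_box_carrier by auto
  ultimately show ?thesis by blast
qed

end

text \<open>Everything is read off the limit E of the powers of M divided by \<beta>^k. It is real
  because the powers have integer entries, and every row is nonzero by unimodularity. It has rank
  one, so \<open>v\<close> is a column through a nonzero entry of row 0 and \<open>c\<close> is row
  0 divided by that entry. The eigenvector equations hold since consecutive powers satisfy them up
  to a decaying error.\<close>

lemma pisot_spectral:
  assumes M: "irreducible_pisot_unimodular d M" and \<beta>: "maximal_eigenvalue M \<beta>"
  shows "\<exists>C r v c. pisot_matrix d M \<beta> C r v c"
proof -
  have Mc: "M \<in> carrier_mat d d" and det: "det M \<in> {1, - 1}"
    using M by (auto simp: irreducible_pisot_unimodular_def)
  interpret int_matrix d M by standard (rule Mc)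
  obtain p q :: "nat \<Rightarrow> complex" and C r where b: "1 < \<beta>" and r: "0 < r" "r < 1" and d: "0 < d"
    and bound: "\<And>k i j. i < d \<Longrightarrow> j < d \<Longrightarrow>
      cmod (of_int ((M ^\<^sub>m k) $$ (i, j)) - of_real \<beta> ^ k * p i * q j) \<le> C * r ^ k"
    by (rule pisot_spectral_complex[OF M \<beta>]) blast
  define E where "E i j = Re (p i * q j)" for i j
  have \<beta>k: "1 \<le> \<beta> ^ k" for k using b by (simp add: one_le_power)
  have E: "p i * q j = of_real (E i j)" if ij: "i < d" "j < d" for i j
  proof -
    have "Im (p i * q j) = 0"
    proof (rule geometric_decay_zero[OF r])
      fix k
      have "of_int ((M ^\<^sub>m k) $$ (i, j)) - of_real \<beta> ^ k * p i * q j =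
          complex_of_real (real_of_int ((M ^\<^sub>m k) $$ (i, j))) - of_real (\<beta> ^ k) * (p i * q j)"
        by (simp add: mult.assoc)
      then have "Im (of_int ((M ^\<^sub>m k) $$ (i, j)) - of_real \<beta> ^ k * p i * q j) = - (\<beta> ^ k * Im (p i * q j))"
        by (simp del: of_real_power add: algebra_simps)
      then have "\<beta> ^ k * \<bar>Im (p i * q j)\<bar> \<le> C * r ^ k"
        using abs_Im_le_cmod[of "of_int ((M ^\<^sub>m k) $$ (i, j)) - of_real \<beta> ^ k * p i * q j"] bound[OF ij, of k] b
        by (simp add: abs_mult)
      moreover have "1 * \<bar>Im (p i * q j)\<bar> \<le> \<beta> ^ k * \<bar>Im (p i * q j)\<bar>" by (rule mult_right_mono[OF \<beta>k]) simp
      ultimately show "\<bar>Im (p i * q j)\<bar> \<le> C * r ^ k" by simp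
    qed
    then show ?thesis by (simp add: E_def complex_eq_iff)
  qed
  have decay: "\<bar>real_of_int ((M ^\<^sub>m k) $$ (i, j)) - \<beta> ^ k * E i j\<bar> \<le> C * r ^ k" if ij: "i < d" "j < d" for i j k
  proof -
    have "of_int ((M ^\<^sub>m k) $$ (i, j)) - of_real \<beta> ^ k * p i * q j =
        complex_of_real (real_of_int ((M ^\<^sub>m k) $$ (i, j)) - \<beta> ^ k * E i j)"
      using E[OF ij] by (simp add: mult.assoc)
    then show ?thesis using bound[OF ij, of k] by (metis norm_of_real)
  qed
  have C0: "0 \<le> C * r ^ k" for k using order_trans[OF abs_ge_zero decay[OF d d]] .
  have row: "\<exists>j<d. E i j \<noteq> 0" if i: "i < d" for i
  proof (rule ccontr) \<comment> \<open>otherwise row \<open>i\<close> of the integer matrix \<open>M\<^sup>k\<close> tends to 0, so it vanishes for some \<open>k\<close>\<close>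
    assume "\<not> (\<exists>j<d. E i j \<noteq> 0)"
    then have zero: "\<And>j. j < d \<Longrightarrow> E i j = 0" by blast
    have "(\<lambda>k. C * r ^ k) \<longlonglongrightarrow> C * 0"
      by (intro tendsto_intros LIMSEQ_power_zero) (use r in auto)
    then have "eventually (\<lambda>k. C * r ^ k < 1) sequentially" by (rule order_tendstoD) simp
    then obtain k where k: "C * r ^ k < 1" unfolding eventually_sequentially by blast
    have "(M ^\<^sub>m k) $$ (i, j) = 0" if "j < d" for j
    proof -
      have "\<bar>real_of_int ((M ^\<^sub>m k) $$ (i, j))\<bar> < 1" using decay[OF i that, of k] zero[OF that] k by simp
      then show ?thesis by linarith
    qed
    then have "det (M ^\<^sub>m k) = 0" by (rule det_zero_row[OF pow_M_carrier i])
    then show False using det det_pow_mat[OF Mc, of k] by auto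
  qed
  obtain j0 where j0: "j0 < d" "E 0 j0 \<noteq> 0" using row[OF d] by blast
  define v where "v i = E i j0" for i
  define c where "c j = E 0 j / E 0 j0" for j
  have E_vc: "E i j = v i * c j" if ij: "i < d" "j < d" for i j
  proof -
    have "complex_of_real (E i j * E 0 j0) = complex_of_real (E i j0 * E 0 j)"
      using E[OF ij] E[OF d j0(1)] E[OF ij(1) j0(1)] E[OF d ij(2)] by (metis mult.assoc mult.commute of_real_mult)
    then have "E i j * E 0 j0 = E i j0 * E 0 j" by (simp only: of_real_eq_iff)
    then show ?thesis using j0(2) by (simp add: v_def c_def field_simps)
  qed
  have v: "v i \<noteq> 0" if "i < d" for i
    using row[OF that] E_vc[OF that] by auto
  have pow_left: "(M ^\<^sub>m Suc k) $$ (i, j) = (\<Sum>l<d. (M ^\<^sub>m k) $$ (i, l) * M $$ (l, j))" if "i < d" "j < d" for i j k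
    using that Mc pow_M_carrier[of k] 
    by (subst pow_mat.simps(2)) (auto simp: scalar_prod_def atLeast0LessThan intro!: sum.cong simp del: pow_mat.simps)
  have pow_right: "(M ^\<^sub>m Suc k) $$ (i, j) = (\<Sum>l<d. M $$ (i, l) * (M ^\<^sub>m k) $$ (l, j))" if "i < d" "j < d" for i j k
    using that Mc pow_M_carrier[of k] unfolding pow_M_Suc
    by (auto simp: scalar_prod_def atLeast0LessThan intro!: sum.cong)
  have decay_sum: "\<bar>\<beta> ^ k * ((\<Sum>l<d. F l * a l) - \<beta> * G)\<bar> \<le> (C * (\<Sum>l<d. \<bar>a l\<bar>) + C * r) * r ^ k"
    if F: "\<And>l. l < d \<Longrightarrow> \<bar>X l - \<beta> ^ k * F l\<bar> \<le> C * r ^ k" and G: "\<bar>Y - \<beta> ^ Suc k * G\<bar> \<le> C * r ^ Suc k"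
      and XY: "Y = (\<Sum>l<d. X l * a l)" for F a G X Y k
  proof -
    have "\<beta> ^ k * ((\<Sum>l<d. F l * a l) - \<beta> * G) = (Y - \<beta> ^ Suc k * G) - (\<Sum>l<d. (X l - \<beta> ^ k * F l) * a l)"
      unfolding XY by (simp add: algebra_simps sum_subtractf sum_distrib_left)
    also have "\<bar>\<dots>\<bar> \<le> \<bar>Y - \<beta> ^ Suc k * G\<bar> + \<bar>\<Sum>l<d. (X l - \<beta> ^ k * F l) * a l\<bar>" by (rule abs_triangle_ineq4)
    also have "\<bar>\<Sum>l<d. (X l - \<beta> ^ k * F l) * a l\<bar> \<le> (\<Sum>l<d. \<bar>(X l - \<beta> ^ k * F l) * a l\<bar>)" by (rule sum_abs)
    also have "\<dots> \<le> (\<Sum>l<d. C * r ^ k * \<bar>a l\<bar>)"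
      using F by (intro sum_mono) (simp add: abs_mult mult_right_mono)
    finally show ?thesis using G by (simp add: algebra_simps sum_distrib_left)
  qed
  have eigen_zero: "(\<Sum>l<d. F l * a l) = \<beta> * G"
    if "\<And>k l. l < d \<Longrightarrow> \<bar>X k l - \<beta> ^ k * F l\<bar> \<le> C * r ^ k" "\<And>k. \<bar>Y k - \<beta> ^ k * G\<bar> \<le> C * r ^ k"
      "\<And>k. Y (Suc k) = (\<Sum>l<d. X k l * a l)" for F a G and X :: "nat \<Rightarrow> nat \<Rightarrow> real" and Y :: "nat \<Rightarrow> real"
  proof -
    have "(\<Sum>l<d. F l * a l) - \<beta> * G = 0"
    proof (rule geometric_decay_zero[OF r])
      fix k
      have "1 * \<bar>(\<Sum>l<d. F l * a l) - \<beta> * G\<bar> \<le> \<beta> ^ k * \<bar>(\<Sum>l<d. F l * a l) - \<beta> * G\<bar>"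
        by (rule mult_right_mono[OF \<beta>k]) simp
      also have "\<dots> = \<bar>\<beta> ^ k * ((\<Sum>l<d. F l * a l) - \<beta> * G)\<bar>" using b by (simp add: abs_mult)
      also have "\<dots> \<le> (C * (\<Sum>l<d. \<bar>a l\<bar>) + C * r) * r ^ k"
        by (rule decay_sum[of "X k" k F "Y (Suc k)" G a]) (use that in blast)+
      finally show "\<bar>(\<Sum>l<d. F l * a l) - \<beta> * G\<bar> \<le> (C * (\<Sum>l<d. \<bar>a l\<bar>) + C * r) * r ^ k" by simp
    qed
    then show ?thesis by simp
  qed
  have right: "(\<Sum>l<d. real_of_int (M $$ (i, l)) * v l) = \<beta> * v i" if i: "i < d" for i
  proof -
    have "(\<Sum>l<d. E l j0 * real_of_int (M $$ (i, l))) = \<beta> * E i j0"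
      by (rule eigen_zero[where X = "\<lambda>k l. real_of_int ((M ^\<^sub>m k) $$ (l, j0))" and Y = "\<lambda>k. real_of_int ((M ^\<^sub>m k) $$ (i, j0))"])
        (use decay j0(1) i pow_right[OF i j0(1)] in \<open>simp_all add: mult.commute\<close>)
    then show ?thesis by (simp add: v_def mult.commute)
  qed
  have left: "(\<Sum>l<d. c l * real_of_int (M $$ (l, j))) = \<beta> * c j" if j: "j < d" for j
  proof -
    have "(\<Sum>l<d. E 0 l * real_of_int (M $$ (l, j))) = \<beta> * E 0 j"
      by (rule eigen_zero[where X = "\<lambda>k l. real_of_int ((M ^\<^sub>m k) $$ (0, l))" and Y = "\<lambda>k. real_of_int ((M ^\<^sub>m k) $$ (0, j))"])
        (use decay d j pow_left[OF d j] in simp_all)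
    then show ?thesis by (simp add: c_def sum_divide_distrib[symmetric])
  qed
  have "\<bar>real_of_int ((M ^\<^sub>m k) $$ (i, j)) - \<beta> ^ k * v i * c j\<bar> \<le> C * r ^ k" if "i < d" "j < d" for i j k
    using decay[OF that, of k] E_vc[OF that] by (simp add: mult.assoc)
  then have "pisot_matrix d M \<beta> C r v c"
    using b r d det v right left by unfold_locales
  then show ?thesis by blast
qed

section \<open>Coordinate boxes as neighbourhoods\<close>

lemma openin_coordinate_box:
  assumes "P \<subseteq> carrier_vec d"
  shows "openin (subtopology (real_vec_topology d) P) {x \<in> P. \<forall>i<d. \<bar>x $ i - b i\<bar> < e}"
proof -
  let ?f = "\<lambda>(x :: real vec) i. if i < d then x $ i else 0"
  have open_W: "openin (powertop_real UNIV) {g. \<forall>i\<in>{..<d}. g i \<in> {b i - e<..<b i + e}}" (is "openin _ ?W")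
    unfolding euclidean_product_topology open_openin[symmetric]
    by (rule product_topology_basis'[of "{..<d}" "\<lambda>i. {b i - e<..<b i + e}" "\<lambda>i. i"]) auto
  then have "openin (Euclidean_space d) (?W \<inter> {x. \<forall>i\<ge>d. x i = 0})"
    unfolding Euclidean_space_def by (rule openin_subtopology_Int)
  then have "openin (real_vec_topology d) (?f -` (?W \<inter> {x. \<forall>i\<ge>d. x i = 0}) \<inter> carrier_vec d)"
    unfolding real_vec_topology_def openin_pullback_topology by blast
  then have "openin (subtopology (real_vec_topology d) P) ((?f -` (?W \<inter> {x. \<forall>i\<ge>d. x i = 0}) \<inter> carrier_vec d) \<inter> P)"
    by (rule openin_subtopology_Int)
  also have "(?f -` (?W \<inter> {x. \<forall>i\<ge>d. x i = 0}) \<inter> carrier_vec d) \<inter> P = {x \<in> P. \<forall>i<d. \<bar>x $ i - b i\<bar> < e}"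
    using assms by (auto simp: abs_diff_less_iff)
  finally show ?thesis .
qed

lemma openin_contains_coordinate_box:
  fixes b :: "real vec"
  assumes U: "openin (subtopology (real_vec_topology d) P) U" and b: "b \<in> U" and P: "P \<subseteq> carrier_vec d"
  obtains e where "0 < e" "{x \<in> P. \<forall>i<d. \<bar>x $ i - b $ i\<bar> < e} \<subseteq> U"
proof -
  let ?f = "\<lambda>(x :: real vec) i. if i < d then x $ i else 0"
  obtain T where T: "openin (real_vec_topology d) T" "U = T \<inter> P"
    using U unfolding openin_subtopology by blast
  obtain W where W: "openin (Euclidean_space d) W" "T = ?f -` W \<inter> carrier_vec d"
    using T(1) unfolding real_vec_topology_def openin_pullback_topology by blast
  obtain V where V: "openin (powertop_real UNIV) V" "W = V \<inter> {x. \<forall>i\<ge>d. x i = 0}"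
    using W(1) unfolding Euclidean_space_def openin_subtopology by blast
  have "?f b \<in> V" using b T(2) W(2) V(2) by auto
  from product_topology_open_contains_basis[OF V(1) this]
  obtain X where X: "?f b \<in> (\<Pi>\<^sub>E i\<in>UNIV. X i)" "\<And>i. openin euclideanreal (X i)" "(\<Pi>\<^sub>E i\<in>UNIV. X i) \<subseteq> V"
    by blast
  have "\<exists>e>0. \<forall>y. \<bar>y - ?f b i\<bar> < e \<longrightarrow> y \<in> X i" for i
  proof -
    have "open (X i)" "?f b i \<in> X i" using X(1,2) by (auto simp: PiE_iff)
    then show ?thesis unfolding open_dist dist_real_def by blast
  qed
  then obtain e where e: "\<And>i. 0 < e i" "\<And>i y. \<bar>y - ?f b i\<bar> < e i \<Longrightarrow> y \<in> X i" by metis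
  define e0 where "e0 = Min (insert 1 (e ` {..<d}))"
  have e0: "0 < e0" "\<And>i. i < d \<Longrightarrow> e0 \<le> e i" unfolding e0_def using e(1) by auto
  have "x \<in> U" if x: "x \<in> P" "\<forall>i<d. \<bar>x $ i - b $ i\<bar> < e0" for x
  proof -
    have "?f x i \<in> X i" for i
    proof (cases "i < d")
      case True
      then show ?thesis using e(2)[of "?f x i" i] x(2) e0(2)[OF True] by force
    next
      case False
      have "?f b i \<in> X i" using X(1) by (auto simp: PiE_iff)
      then show ?thesis using False by simp
    qed
    then have "?f x \<in> V" using X(3) by (auto simp: PiE_iff)
    then show ?thesis using x(1) P unfolding T(2) W(2) V(2) by auto
  qed
  then show thesis using that[OF e0(1)] by blast
qed

context int_matrix
begin

text \<open>The determinant is its own inverse, so the adjugate times the determinant is an integral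
  inverse.\<close>

lemma pow_M_inverse:
  assumes "det M \<in> {1, - 1}"
  obtains N where "N \<in> carrier_mat d d" "M ^\<^sub>m n * N = 1\<^sub>m d" "N * M ^\<^sub>m n = 1\<^sub>m d"
proof -
  let ?A = "M ^\<^sub>m n" and ?e = "det (M ^\<^sub>m n)"
  have adj: "adj_mat ?A \<in> carrier_mat d d" "?A * adj_mat ?A = ?e \<cdot>\<^sub>m 1\<^sub>m d" "adj_mat ?A * ?A = ?e \<cdot>\<^sub>m 1\<^sub>m d"
    using adj_mat[OF pow_M_carrier[of n]] by simp_all
  have "?e * ?e = (det M * det M) ^ n"
    unfolding det_pow_mat[OF M_carrier] by (simp add: power_mult_distrib)
  then have e: "?e * ?e = 1" using assms by auto
  have sm: "?e \<cdot>\<^sub>m (?e \<cdot>\<^sub>m 1\<^sub>m d) = 1\<^sub>m d" by (rule eq_matI) (use e in auto)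
  show thesis
  proof
    show "?e \<cdot>\<^sub>m adj_mat ?A \<in> carrier_mat d d" using adj(1) by simp
    show "?A * (?e \<cdot>\<^sub>m adj_mat ?A) = 1\<^sub>m d"
      using mult_smult_distrib[OF pow_M_carrier adj(1)] adj(2) sm by simp
    show "(?e \<cdot>\<^sub>m adj_mat ?A) * ?A = 1\<^sub>m d"
      using mult_smult_assoc_mat[OF adj(1) pow_M_carrier] adj(3) sm by simp
  qed
qed

end

context pisot_matrix
begin

text \<open>Round the points \<open>\<beta>\<^sup>-\<^sup>k s v\<close> of the eigenline and take the discrepancies between consecutive
  roundings as letters.\<close>

lemma near_line_value:
  "(\<And>i. i < d \<Longrightarrow> \<bar>s * v i\<bar> < \<beta> ^ n / 2) \<Longrightarrow> z \<in> carrier_vec d \<Longrightarrow>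
    (\<And>i. i < d \<Longrightarrow> \<bar>real_of_int (z $ i) - s * v i\<bar> \<le> 1 / 2) \<Longrightarrow>
    \<exists>w\<in>lists (box (1 + mat_size M)). Q w = z"
proof (induction n arbitrary: s z)
  \<comment> \<open>The parameter n bounds the number of divisions by \<beta> after which the point
    of the line rounds to 0; there the word ends.\<close>
  case 0
  have "z $ i = 0" if "i < d" for i
  proof -
    have "\<bar>s * v i\<bar> < 1 / 2" using 0(1)[OF that] by simp
    then have "\<bar>real_of_int (z $ i)\<bar> < 1" using 0(3)[OF that] by linarith
    then show ?thesis by linarith
  qed
  then have "Q [] = z" using 0(2) by (intro eq_vecI) simp_all
  then show ?case by (intro bexI[of _ "[]"]) auto
next
  case (Suc n)
  define y where "y = vec d (\<lambda>i. round (s / \<beta> * v i))"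
  have yc: "y \<in> carrier_vec d" by (simp add: y_def)
  have y: "\<bar>real_of_int (y $ i) - s / \<beta> * v i\<bar> \<le> 1 / 2" if "i < d" for i
    using of_int_round_abs_le[of "s / \<beta> * v i"] that by (simp add: y_def)
  have small: "\<bar>s / \<beta> * v i\<bar> < \<beta> ^ n / 2" if "i < d" for i
    using Suc.prems(1)[OF that] \<beta> by (simp add: abs_mult field_simps)
  obtain w where w: "w \<in> lists (box (1 + mat_size M))" "Q w = y"
    using Suc.IH[OF small yc y] by blast
  \<comment> \<open>As M v = \<beta> v, this letter is (z - s v) - M (y - (s / \<beta>) v). The
    errors of z and y are at most 1/2, so its entries do not exceed 1/2 + mat_size M; hence the
    alphabet of radius \<open>1 + mat_size M\<close>.\<close>
  define t where "t = z - M *\<^sub>v y"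
  have tc: "t \<in> carrier_vec d" using Suc.prems(2) yc by (simp add: t_def)
  have t: "\<bar>t $ i\<bar> \<le> int (1 + mat_size M)" if i: "i < d" for i
  proof -
    have "(\<Sum>j<d. real_of_int (M $$ (i, j)) * (s / \<beta> * v j)) = s / \<beta> * (\<Sum>j<d. real_of_int (M $$ (i, j)) * v j)"
      by (simp add: sum_distrib_left mult_ac)
    also have "\<dots> = s * v i" unfolding right[OF i] using \<beta> by simp
    finally have sv: "s * v i = (\<Sum>j<d. real_of_int (M $$ (i, j)) * (s / \<beta> * v j))" ..
    have ti: "t $ i = z $ i - (M *\<^sub>v y) $ i" using i Suc.prems(2) yc by (simp add: t_def)
    have "real_of_int (t $ i) = (real_of_int (z $ i) - s * v i) -
        (\<Sum>j<d. real_of_int (M $$ (i, j)) * (real_of_int (y $ j) - s / \<beta> * v j))"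
      unfolding ti index_mult_M[OF yc i] right_diff_distrib sum_subtractf sv[symmetric] by simp
    also have "\<bar>\<dots>\<bar> \<le> \<bar>real_of_int (z $ i) - s * v i\<bar> +
        \<bar>\<Sum>j<d. real_of_int (M $$ (i, j)) * (real_of_int (y $ j) - s / \<beta> * v j)\<bar>" by (rule abs_triangle_ineq4)
    also have "\<bar>\<Sum>j<d. real_of_int (M $$ (i, j)) * (real_of_int (y $ j) - s / \<beta> * v j)\<bar> \<le>
        (\<Sum>j<d. \<bar>real_of_int (M $$ (i, j)) * (real_of_int (y $ j) - s / \<beta> * v j)\<bar>)" by (rule sum_abs)
    also have "\<dots> \<le> (\<Sum>j<d. \<bar>real_of_int (M $$ (i, j))\<bar> * 1)"
    proof (rule sum_mono)
      fix j assume "j \<in> {..<d}"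
      then have "\<bar>real_of_int (y $ j) - s / \<beta> * v j\<bar> \<le> 1" using y[of j] by simp
      then show "\<bar>real_of_int (M $$ (i, j)) * (real_of_int (y $ j) - s / \<beta> * v j)\<bar> \<le> \<bar>real_of_int (M $$ (i, j))\<bar> * 1"
        unfolding abs_mult by (rule mult_left_mono) simp
    qed
    also have "\<dots> \<le> (\<Sum>i<d. \<Sum>j<d. \<bar>real_of_int (M $$ (i, j))\<bar>)"
      using i by (subst mult_1_right, intro member_le_sum[of i "{..<d}" "\<lambda>i. \<Sum>j<d. \<bar>real_of_int (M $$ (i, j))\<bar>"])
        (auto intro: sum_nonneg)
    also have "\<dots> = real (mat_size M)" by (simp add: mat_size_def)
    finally have "\<bar>real_of_int (t $ i)\<bar> \<le> 1 / 2 + real (mat_size M)" using Suc.prems(3)[OF i] by simp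
    then show ?thesis by linarith
  qed
  have "t \<in> box (1 + mat_size M)" using t tc by (simp add: int_box_def)
  then have "t # w \<in> lists (box (1 + mat_size M))" using w(1) by simp
  moreover have "Q (t # w) = t + M *\<^sub>v y" using Q_Cons[OF tc lists_box[OF w(1)]] w(2) by simp
  moreover have "t + M *\<^sub>v y = z" unfolding t_def by (rule eq_vecI) (use Suc.prems(2) yc in simp_all)
  ultimately show ?case by (intro bexI[of _ "t # w"]) simp_all
qed

definition eigen_vec :: "real vec" where
  "eigen_vec = vec d v"

lemma eigen_vec: "eigen_vec \<in> eigenspace d M \<beta>" "eigen_vec \<noteq> 0\<^sub>v d"
proof -
  have "(map_mat real_of_int M *\<^sub>v vec d v) $ i = (\<beta> \<cdot>\<^sub>v vec d v) $ i" if "i < d" for i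
    using right[OF that] that
    by (simp add: index_mult_mat_vec scalar_prod_def atLeast0LessThan)
  then have "map_mat real_of_int M *\<^sub>v vec d v = \<beta> \<cdot>\<^sub>v vec d v" by (intro eq_vecI) simp_all
  then show "eigen_vec \<in> eigenspace d M \<beta>" by (simp add: eigenspace_def eigen_vec_def)
  have "eigen_vec $ 0 \<noteq> 0" using v[OF d] d by (simp add: eigen_vec_def)
  then show "eigen_vec \<noteq> 0\<^sub>v d" using d by auto
qed

end

section \<open>The projection and the characterization of interior points\<close>

text \<open>Both candidates for \<pi> x lie in P and differ from x by an element of E, so their
  difference is in P \<inter> E.\<close>

lemma projection_along_line:
  fixes a e x :: "real vec"
  assumes P: "P = {x \<in> carrier_vec d. a \<bullet> x = 0}" and a: "a \<in> carrier_vec d"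
    and \<pi>: "projection_along d P E \<pi>" and e: "e \<in> E" "e \<noteq> 0\<^sub>v d"
    and E: "\<And>x y k. x \<in> E \<Longrightarrow> y \<in> E \<Longrightarrow> x - k \<cdot>\<^sub>v y \<in> E" "E \<subseteq> carrier_vec d" and x: "x \<in> carrier_vec d"
  shows "a \<bullet> e \<noteq> 0" "\<pi> x = x - ((a \<bullet> x) / (a \<bullet> e)) \<cdot>\<^sub>v e"
proof -
  have PE: "P \<inter> E = {0\<^sub>v d}" and px: "\<pi> x \<in> P" "x - \<pi> x \<in> E"
    using \<pi> x by (auto simp: projection_along_def)
  have ec: "e \<in> carrier_vec d" using e E by blast
  show ae: "a \<bullet> e \<noteq> 0" using PE e ec by (auto simp: P)
  let ?k = "(a \<bullet> x) / (a \<bullet> e)"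
  let ?y = "x - ?k \<cdot>\<^sub>v e - \<pi> x"
  have pc: "\<pi> x \<in> carrier_vec d" "a \<bullet> \<pi> x = 0" using px(1) by (auto simp: P)
  have yc: "?y \<in> carrier_vec d" using x ec pc by simp
  have "a \<bullet> ?y = a \<bullet> (x - ?k \<cdot>\<^sub>v e) - a \<bullet> \<pi> x"
    by (rule scalar_prod_minus_distrib[of _ d]) (use a x ec pc in simp_all)
  also have "a \<bullet> (x - ?k \<cdot>\<^sub>v e) = a \<bullet> x - a \<bullet> (?k \<cdot>\<^sub>v e)"
    by (rule scalar_prod_minus_distrib[of _ d]) (use a x ec pc in simp_all)
  also have "a \<bullet> (?k \<cdot>\<^sub>v e) = ?k * (a \<bullet> e)" using a ec by (simp add: scalar_prod_smult_distrib)
  finally have "?y \<in> P" using yc ae pc by (simp add: P)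
  moreover have "?y = (x - \<pi> x) - ?k \<cdot>\<^sub>v e" by (rule eq_vecI) (use x ec pc in simp_all)
  then have "?y \<in> E" using E(1)[OF px(2) e(1)] by simp
  ultimately have y0: "?y = 0\<^sub>v d" using PE by blast
  show "\<pi> x = x - ?k \<cdot>\<^sub>v e"
  proof (rule eq_vecI)
    show "dim_vec (\<pi> x) = dim_vec (x - ?k \<cdot>\<^sub>v e)" using pc x ec by simp
    fix i assume "i < dim_vec (x - ?k \<cdot>\<^sub>v e)"
    then have i: "i < d" using ec by simp
    have "?y $ i = 0" unfolding y0 using i by simp
    then show "\<pi> x $ i = (x - ?k \<cdot>\<^sub>v e) $ i" using i x ec pc by simp
  qed
qed

context pisot_matrix
begin

text \<open>\<alpha> is the normal vector of P, rescaled to take the value 1 on \<open>v\<close>.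
  Unlike the coefficients \<open>c\<close> of the height it depends on P.\<close>

lemma projection_formula:
  assumes P: "hyperplane d P" and \<pi>: "projection_along d P (eigenspace d M \<beta>) \<pi>"
  obtains \<alpha> :: "nat \<Rightarrow> real" where "(\<Sum>j<d. \<alpha> j * v j) = 1"
    "\<And>x i. x \<in> carrier_vec d \<Longrightarrow> i < d \<Longrightarrow> \<pi> x $ i = x $ i - (\<Sum>j<d. \<alpha> j * x $ j) * v i"
    "\<And>x. x \<in> carrier_vec d \<Longrightarrow> \<pi> x \<in> P" "P \<subseteq> carrier_vec d"
proof -
  obtain a where a: "a \<in> carrier_vec d" and Peq: "P = {x \<in> carrier_vec d. a \<bullet> x = 0}"
    using P unfolding hyperplane_def by blast
  have E: "x - k \<cdot>\<^sub>v y \<in> eigenspace d M \<beta>" if "x \<in> eigenspace d M \<beta>" "y \<in> eigenspace d M \<beta>" for x y k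
  proof -
    let ?A = "map_mat real_of_int M"
    have A: "?A \<in> carrier_mat d d" by simp
    have xy: "x \<in> carrier_vec d" "y \<in> carrier_vec d" "?A *\<^sub>v x = \<beta> \<cdot>\<^sub>v x" "?A *\<^sub>v y = \<beta> \<cdot>\<^sub>v y"
      using that by (auto simp: eigenspace_def)
    have "?A *\<^sub>v (x - k \<cdot>\<^sub>v y) = ?A *\<^sub>v x - ?A *\<^sub>v (k \<cdot>\<^sub>v y)"
      by (rule mult_minus_distrib_mat_vec[OF A]) (use xy in simp_all)
    also have "?A *\<^sub>v (k \<cdot>\<^sub>v y) = k \<cdot>\<^sub>v (?A *\<^sub>v y)" by (rule mult_mat_vec[OF A xy(2)])
    finally have "?A *\<^sub>v (x - k \<cdot>\<^sub>v y) = \<beta> \<cdot>\<^sub>v (x - k \<cdot>\<^sub>v y)"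
      unfolding xy by (intro eq_vecI) (use xy(1,2) in \<open>simp_all add: algebra_simps\<close>)
    then show ?thesis using xy by (simp add: eigenspace_def)
  qed
  have Ec: "eigenspace d M \<beta> \<subseteq> carrier_vec d" by (auto simp: eigenspace_def)
  note line = projection_along_line[OF Peq a \<pi> eigen_vec E Ec]
  let ?e = "eigen_vec"
  have ec: "?e \<in> carrier_vec d" by (simp add: eigen_vec_def)
  have ae: "a \<bullet> ?e \<noteq> 0" by (rule line(1)[OF _ _ zero_carrier_vec])
  have dot: "a \<bullet> x = (\<Sum>j<d. a $ j * x $ j)" if "x \<in> carrier_vec d" for x
    using that by (simp add: scalar_prod_def atLeast0LessThan)
  define \<alpha> where "\<alpha> j = a $ j / (a \<bullet> ?e)" for j
  have \<alpha>: "(\<Sum>j<d. \<alpha> j * x $ j) = (a \<bullet> x) / (a \<bullet> ?e)" if "x \<in> carrier_vec d" for x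
    unfolding dot[OF that] sum_divide_distrib \<alpha>_def by (rule sum.cong) simp_all
  show thesis
  proof
    have "(\<Sum>j<d. \<alpha> j * ?e $ j) = 1" unfolding \<alpha>[OF ec] using ae by simp
    then show "(\<Sum>j<d. \<alpha> j * v j) = 1" by (simp add: eigen_vec_def)
    show "\<pi> x $ i = x $ i - (\<Sum>j<d. \<alpha> j * x $ j) * v i" if "x \<in> carrier_vec d" "i < d" for x i
      unfolding \<alpha>[OF that(1)] using line(2)[OF _ _ that(1)] that ec by (simp add: eigen_vec_def)
    show "\<pi> x \<in> P" if "x \<in> carrier_vec d" for x using \<pi> that by (auto simp: projection_along_def)
    show "P \<subseteq> carrier_vec d" by (auto simp: Peq)
  qed
qed

lemma pow_M_right: "i < d \<Longrightarrow> (\<Sum>j<d. real_of_int ((M ^\<^sub>m k) $$ (i, j)) * v j) = \<beta> ^ k * v i"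
proof (induction k arbitrary: i)
  case 0
  have "(\<Sum>j<d. real_of_int ((M ^\<^sub>m 0) $$ (i, j)) * v j) = (\<Sum>j<d. if j = i then v j else 0)"
    by (rule sum.cong) (use 0 in auto)
  then show ?case using 0 by simp
next
  case (Suc k)
  have "(M ^\<^sub>m Suc k) $$ (i, j) = (\<Sum>l<d. M $$ (i, l) * (M ^\<^sub>m k) $$ (l, j))" if "j < d" for j
    using that Suc.prems M_carrier pow_M_carrier[of k] unfolding pow_M_Suc
    by (auto simp: scalar_prod_def atLeast0LessThan intro!: sum.cong)
  note Mk = this
  have "(\<Sum>j<d. real_of_int ((M ^\<^sub>m Suc k) $$ (i, j)) * v j) =
      (\<Sum>j<d. \<Sum>l<d. real_of_int (M $$ (i, l)) * (real_of_int ((M ^\<^sub>m k) $$ (l, j)) * v j))"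
  proof (rule sum.cong[OF refl])
    fix j assume "j \<in> {..<d}"
    then have j: "j < d" by simp
    show "real_of_int ((M ^\<^sub>m Suc k) $$ (i, j)) * v j =
        (\<Sum>l<d. real_of_int (M $$ (i, l)) * (real_of_int ((M ^\<^sub>m k) $$ (l, j)) * v j))"
      unfolding Mk[OF j] by (simp add: sum_distrib_right mult.assoc)
  qed
  also have "\<dots> = (\<Sum>l<d. real_of_int (M $$ (i, l)) * (\<Sum>j<d. real_of_int ((M ^\<^sub>m k) $$ (l, j)) * v j))"
    by (subst sum.swap) (simp add: sum_distrib_left)
  also have "\<dots> = (\<Sum>l<d. \<beta> ^ k * (real_of_int (M $$ (i, l)) * v l))"
    by (rule sum.cong) (use Suc.IH in simp_all)
  also have "\<dots> = \<beta> ^ Suc k * v i" using right[OF Suc.prems] by (simp add: sum_distrib_left[symmetric])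
  finally show ?case .
qed

text \<open>Appending k zeros and w to u changes the value by the power of M with exponent
  \<open>length u + k\<close>, applied to Q w. If Q u is interior, the projection of this change
  tends to 0 uniformly in w, so a large k keeps all these values in the given open set. Conversely,
  if y projects close to Q u, then y - Q u is close to the eigenline; the inverse power of M
  enlarges this distance by a bounded factor only, and \<open>near_line_value\<close> supplies
  w.\<close>

lemma interior_iff:
  assumes P: "hyperplane d P" and \<pi>: "projection_along d P (eigenspace d M \<beta>) \<pi>"
    and L: "L \<subseteq> lists (box \<rho>)" and \<rho>: "1 + mat_size M \<le> \<rho>" and u: "u \<in> L"
  shows "Q u \<in> proj_interior d P \<pi> (Q ` L) \<longleftrightarrow> Q u \<in> nonneg_vecs d \<and>
    (\<exists>k. universal (box \<rho>) (hit_words L) (u @ replicate k (0\<^sub>v d)))"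
proof -
  obtain \<alpha> where \<alpha>: "(\<Sum>j<d. \<alpha> j * v j) = 1"
    and \<pi>i: "\<And>x i. x \<in> carrier_vec d \<Longrightarrow> i < d \<Longrightarrow> \<pi> x $ i = x $ i - (\<Sum>j<d. \<alpha> j * x $ j) * v i"
    and \<pi>P: "\<And>x. x \<in> carrier_vec d \<Longrightarrow> \<pi> x \<in> P" and Pc: "P \<subseteq> carrier_vec d"
    by (rule projection_formula[OF P \<pi>]) blast
  define pr where "pr x i = real_of_int (x $ i) - (\<Sum>j<d. \<alpha> j * real_of_int (x $ j)) * v i" for x i
  have \<pi>_pr: "\<pi> (map_vec real_of_int x) $ i = pr x i" if "x \<in> carrier_vec d" "i < d" for x i
    using \<pi>i[of "map_vec real_of_int x" i] that by (simp add: pr_def)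
  have \<pi>_in: "\<pi> (map_vec real_of_int x) \<in> P" if "x \<in> carrier_vec d" for x
    using \<pi>P[of "map_vec real_of_int x"] that by simp
  have pr_add: "pr (x + y) i = pr x i + pr y i" if "x \<in> carrier_vec d" "y \<in> carrier_vec d" "i < d" for x y i
    using that by (simp add: pr_def sum.distrib algebra_simps)
  \<comment> \<open>A bound for the norm of \<pi>. As \<pi> kills v, it applies to the distance from
    any point of the eigenline in place of the norm.\<close>
  define K0 where "K0 = 1 + (\<Sum>j<d. \<bar>\<alpha> j\<bar>) * (\<Sum>j<d. \<bar>v j\<bar>)"
  have K0: "1 \<le> K0" unfolding K0_def by (simp add: sum_nonneg)
  have pr_bound: "\<bar>pr z i\<bar> \<le> K0 * \<eta>"
    if "\<And>j. j < d \<Longrightarrow> \<bar>real_of_int (z $ j) - s * v j\<bar> \<le> \<eta>" "i < d" for z s \<eta> i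
  proof -
    let ?\<delta> = "\<lambda>j. real_of_int (z $ j) - s * v j"
    have "0 \<le> \<eta>" using order_trans[OF abs_ge_zero that(1)[OF that(2)]] .
    have "(\<Sum>j<d. \<alpha> j * ?\<delta> j) = (\<Sum>j<d. \<alpha> j * real_of_int (z $ j)) - s * (\<Sum>j<d. \<alpha> j * v j)"
      by (simp add: right_diff_distrib sum_subtractf sum_distrib_left mult_ac)
    then have A: "(\<Sum>j<d. \<alpha> j * ?\<delta> j) = (\<Sum>j<d. \<alpha> j * real_of_int (z $ j)) - s" unfolding \<alpha> by simp
    have "pr z i = ?\<delta> i - (\<Sum>j<d. \<alpha> j * ?\<delta> j) * v i"
      unfolding pr_def A by (simp only: left_diff_distrib)
    also have "\<bar>\<dots>\<bar> \<le> \<bar>?\<delta> i\<bar> + \<bar>(\<Sum>j<d. \<alpha> j * ?\<delta> j) * v i\<bar>" by (rule abs_triangle_ineq4)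
    also have "\<bar>(\<Sum>j<d. \<alpha> j * ?\<delta> j) * v i\<bar> \<le> ((\<Sum>j<d. \<bar>\<alpha> j\<bar>) * \<eta>) * (\<Sum>j<d. \<bar>v j\<bar>)"
      unfolding abs_mult
    proof (rule mult_mono)
      have "\<bar>\<Sum>j<d. \<alpha> j * ?\<delta> j\<bar> \<le> (\<Sum>j<d. \<bar>\<alpha> j * ?\<delta> j\<bar>)" by (rule sum_abs)
      also have "\<dots> \<le> (\<Sum>j<d. \<bar>\<alpha> j\<bar> * \<eta>)"
        using that(1) by (intro sum_mono) (simp add: abs_mult mult_left_mono)
      finally show "\<bar>\<Sum>j<d. \<alpha> j * ?\<delta> j\<bar> \<le> (\<Sum>j<d. \<bar>\<alpha> j\<bar>) * \<eta>" by (simp add: sum_distrib_right)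
      show "\<bar>v i\<bar> \<le> (\<Sum>j<d. \<bar>v j\<bar>)"
        using that(2) by (intro member_le_sum[of i "{..<d}" "\<lambda>j. \<bar>v j\<bar>"]) auto
    qed (use \<open>0 \<le> \<eta>\<close> in \<open>simp_all add: sum_nonneg\<close>)
    finally have "\<bar>pr z i\<bar> \<le> \<bar>?\<delta> i\<bar> + ((\<Sum>j<d. \<bar>\<alpha> j\<bar>) * \<eta>) * (\<Sum>j<d. \<bar>v j\<bar>)" by simp
    also have "\<dots> \<le> \<eta> + ((\<Sum>j<d. \<bar>\<alpha> j\<bar>) * \<eta>) * (\<Sum>j<d. \<bar>v j\<bar>)" using that(1)[OF that(2)] by simp
    also have "\<dots> = K0 * \<eta>" by (simp add: K0_def algebra_simps)
    finally show ?thesis .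
  qed
  have ur: "u \<in> lists (box \<rho>)" using u L by blast
  have uc: "u \<in> lists (carrier_vec d)" by (rule lists_box[OF ur])
  have Qu: "Q u \<in> carrier_vec d" using uc by simp
  have u0: "u @ replicate k (0\<^sub>v d) \<in> lists (carrier_vec d)" for k using uc by (auto simp: in_lists_conv_set)
  have Qu0: "Q (u @ replicate k (0\<^sub>v d)) = Q u" for k
  proof -
    have "M ^\<^sub>m length u *\<^sub>v 0\<^sub>v d = 0\<^sub>v d" by (rule eq_vecI) (simp_all add: index_mult_mat_vec)
    then show ?thesis using Q_append[OF uc, of "replicate k (0\<^sub>v d)"] Q_replicate_zero[of k] Qu
      by (simp add: in_lists_conv_set)
  qed
  have Qw: "Q ((u @ replicate k (0\<^sub>v d)) @ w) = Q u + M ^\<^sub>m (length u + k) *\<^sub>v Q w"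
    if "w \<in> lists (carrier_vec d)" for k w
    using Q_append[OF u0 that] Qu0 by simp
  show ?thesis
  proof
    assume "Q u \<in> proj_interior d P \<pi> (Q ` L)"
    then obtain U where U: "openin (subtopology (real_vec_topology d) P) U"
      and QuU: "Q u \<in> proj_preimage d \<pi> U" and sub: "proj_preimage d \<pi> U \<subseteq> Q ` L"
      unfolding proj_interior_def by blast
    have nn: "Q u \<in> nonneg_vecs d" and "\<pi> (map_vec real_of_int (Q u)) \<in> U"
      using QuU by (simp_all add: proj_preimage_def)
    from openin_contains_coordinate_box[OF U this(2) Pc]
    obtain e where e: "0 < e" "{x \<in> P. \<forall>i<d. \<bar>x $ i - \<pi> (map_vec real_of_int (Q u)) $ i\<bar> < e} \<subseteq> U" by blast
    have "(\<lambda>k. K0 * (r ^ k * spread \<rho>)) \<longlonglongrightarrow> K0 * (0 * spread \<rho>)"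
      by (intro tendsto_intros LIMSEQ_power_zero) (use r in auto)
    then have "eventually (\<lambda>k. K0 * (r ^ k * spread \<rho>) < e) sequentially"
      by (rule order_tendstoD) (use e in simp)
    then obtain n0 where n0: "\<And>k. n0 \<le> k \<Longrightarrow> K0 * (r ^ k * spread \<rho>) < e"
      unfolding eventually_sequentially by blast
    have "universal (box \<rho>) (hit_words L) (u @ replicate n0 (0\<^sub>v d))"
      unfolding universal_def hit_words_def mem_Collect_eq
    proof (intro ballI impI)
      fix w assume w: "w \<in> lists (box \<rho>)"
      let ?y = "Q ((u @ replicate n0 (0\<^sub>v d)) @ w)"
      assume y: "?y \<in> nonneg_vecs d"
      let ?n = "length u + n0"
      define z where "z = Q (replicate ?n (0\<^sub>v d) @ w)"
      have wc: "w \<in> lists (carrier_vec d)" by (rule lists_box[OF w])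
      have z: "z = M ^\<^sub>m ?n *\<^sub>v Q w"
        using Q_append[of "replicate ?n (0\<^sub>v d)" w] wc Q_replicate_zero[of ?n]
        by (simp add: z_def in_lists_conv_set)
      have zc: "z \<in> carrier_vec d" unfolding z using wc by simp
      have yz: "?y = Q u + z" unfolding z by (rule Qw[OF wc])
      have yc: "?y \<in> carrier_vec d" using y by (simp add: nonneg_vecs_def)
      have "\<bar>pr z i\<bar> < e" if "i < d" for i
      proof -
        have "\<bar>pr z i\<bar> \<le> K0 * (r ^ ?n * spread \<rho>)"
        proof (rule pr_bound[OF _ that])
          show "\<bar>real_of_int (z $ j) - height z * v j\<bar> \<le> r ^ ?n * spread \<rho>" if "j < d" for j
            using transversal_Q[OF w that, of ?n] by (simp add: z_def transversal_def mult.commute)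
        qed
        then show ?thesis using n0[of ?n] by simp
      qed
      then have "\<forall>i<d. \<bar>\<pi> (map_vec real_of_int ?y) $ i - \<pi> (map_vec real_of_int (Q u)) $ i\<bar> < e"
        using \<pi>_pr[OF yc] \<pi>_pr[OF Qu] pr_add[OF Qu zc] unfolding yz by simp
      then have "\<pi> (map_vec real_of_int ?y) \<in> U" using e(2) \<pi>_in[OF yc] by blast
      then have "?y \<in> proj_preimage d \<pi> U" using y by (simp add: proj_preimage_def)
      then show "?y \<in> Q ` L" using sub by blast
    qed
    then show "Q u \<in> nonneg_vecs d \<and> (\<exists>k. universal (box \<rho>) (hit_words L) (u @ replicate k (0\<^sub>v d)))"
      using nn by blast
  next
    assume "Q u \<in> nonneg_vecs d \<and> (\<exists>k. universal (box \<rho>) (hit_words L) (u @ replicate k (0\<^sub>v d)))"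
    then obtain k where nn: "Q u \<in> nonneg_vecs d"
      and univ: "universal (box \<rho>) (hit_words L) (u @ replicate k (0\<^sub>v d))" by blast
    define n where "n = length u + k"
    obtain N where N: "N \<in> carrier_mat d d" "M ^\<^sub>m n * N = 1\<^sub>m d" "N * M ^\<^sub>m n = 1\<^sub>m d"
      by (rule pow_M_inverse[OF det])
    interpret N: int_matrix d N by standard (rule N(1))
    \<comment> \<open>So small that N, the inverse of the power of M, maps points within e of the
      eigenline to points within 1/2 of it, the tolerance of \<open>near_line_value\<close>.\<close>
    define e where "e = 1 / (2 * (real (mat_size N) + 1))"
    have e: "0 < e" "real (mat_size N) * e \<le> 1 / 2" by (simp_all add: e_def field_simps)
    define U where "U = {x \<in> P. \<forall>i<d. \<bar>x $ i - pr (Q u) i\<bar> < e}"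
    have "openin (subtopology (real_vec_topology d) P) U" unfolding U_def by (rule openin_coordinate_box[OF Pc])
    moreover have "Q u \<in> proj_preimage d \<pi> U"
      using nn \<pi>_in[OF Qu] \<pi>_pr[OF Qu] e(1) by (simp add: proj_preimage_def U_def)
    moreover have "proj_preimage d \<pi> U \<subseteq> Q ` L"
    proof
      fix y assume "y \<in> proj_preimage d \<pi> U"
      then have y: "y \<in> nonneg_vecs d" and yU: "\<pi> (map_vec real_of_int y) \<in> U" by (simp_all add: proj_preimage_def)
      have yc: "y \<in> carrier_vec d" using y by (simp add: nonneg_vecs_def)
      define z0 where "z0 = y - Q u"
      have z0c: "z0 \<in> carrier_vec d" using yc Qu by (simp add: z0_def)
      have yz0: "y = Q u + z0" unfolding z0_def by (rule eq_vecI) (use yc Qu in simp_all)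
      define s0 where "s0 = (\<Sum>j<d. \<alpha> j * real_of_int (z0 $ j))"
      have near0: "\<bar>real_of_int (z0 $ i) - s0 * v i\<bar> \<le> e" if "i < d" for i
      proof -
        have "\<bar>\<pi> (map_vec real_of_int y) $ i - pr (Q u) i\<bar> < e" using yU that by (simp add: U_def)
        then have "\<bar>pr y i - pr (Q u) i\<bar> < e" unfolding \<pi>_pr[OF yc that] .
        then have "\<bar>pr z0 i\<bar> < e" unfolding yz0 using pr_add[OF Qu z0c that] by simp
        then show ?thesis by (simp add: pr_def s0_def)
      qed
      define z where "z = N *\<^sub>v z0"
      have zc: "z \<in> carrier_vec d" using N.mult_M_carrier[OF z0c] by (simp add: z_def)
      have Nv: "(\<Sum>j<d. real_of_int (N $$ (i, j)) * v j) = v i / \<beta> ^ n" if i: "i < d" for i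
      proof -
        have NM: "(\<Sum>l<d. N $$ (i, l) * (M ^\<^sub>m n) $$ (l, j)) = (if i = j then 1 else 0)" if "j < d" for j
        proof -
          have "(N * M ^\<^sub>m n) $$ (i, j) = (\<Sum>l<d. N $$ (i, l) * (M ^\<^sub>m n) $$ (l, j))"
            using i that N(1) pow_M_carrier[of n]
            by (auto simp: scalar_prod_def atLeast0LessThan intro!: sum.cong)
          then show ?thesis unfolding N(3) using i that by simp
        qed
        have "\<beta> ^ n * (\<Sum>l<d. real_of_int (N $$ (i, l)) * v l) =
            (\<Sum>l<d. real_of_int (N $$ (i, l)) * (\<Sum>j<d. real_of_int ((M ^\<^sub>m n) $$ (l, j)) * v j))"
          unfolding sum_distrib_left[of "\<beta> ^ n"] by (rule sum.cong) (simp_all only: pow_M_right lessThan_iff mult.left_commute)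
        also have "\<dots> = (\<Sum>j<d. real_of_int (\<Sum>l<d. N $$ (i, l) * (M ^\<^sub>m n) $$ (l, j)) * v j)"
          unfolding sum_distrib_left of_int_sum sum_distrib_right
          by (subst sum.swap) (intro sum.cong refl, simp)
        also have "\<dots> = (\<Sum>j<d. if i = j then v j else 0)" by (rule sum.cong) (simp_all add: NM)
        also have "\<dots> = v i" using i by simp
        finally show ?thesis using \<beta> by (simp add: field_simps)
      qed
      have near: "\<bar>real_of_int (z $ i) - (s0 / \<beta> ^ n) * v i\<bar> \<le> 1 / 2" if i: "i < d" for i
      proof -
        have "(\<Sum>j<d. real_of_int (N $$ (i, j)) * (s0 * v j)) = s0 * (v i / \<beta> ^ n)"
          unfolding Nv[OF i, symmetric] by (simp add: sum_distrib_left mult_ac)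
        then have "real_of_int (z $ i) - (s0 / \<beta> ^ n) * v i =
            (\<Sum>j<d. real_of_int (N $$ (i, j)) * (real_of_int (z0 $ j) - s0 * v j))"
          unfolding z_def N.index_mult_M[OF z0c i] by (simp add: right_diff_distrib sum_subtractf)
        also have "\<bar>\<dots>\<bar> \<le> (\<Sum>j<d. \<bar>real_of_int (N $$ (i, j)) * (real_of_int (z0 $ j) - s0 * v j)\<bar>)" by (rule sum_abs)
        also have "\<dots> \<le> (\<Sum>j<d. \<bar>real_of_int (N $$ (i, j))\<bar> * e)"
          using near0 by (intro sum_mono) (simp add: abs_mult mult_left_mono)
        also have "\<dots> = (\<Sum>j<d. \<bar>real_of_int (N $$ (i, j))\<bar>) * e" by (simp add: sum_distrib_right)
        also have "\<dots> \<le> (\<Sum>i<d. \<Sum>j<d. \<bar>real_of_int (N $$ (i, j))\<bar>) * e"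
          using i e(1) by (intro mult_right_mono member_le_sum[of i "{..<d}" "\<lambda>i. \<Sum>j<d. \<bar>real_of_int (N $$ (i, j))\<bar>"])
            (auto intro: sum_nonneg)
        also have "(\<Sum>i<d. \<Sum>j<d. \<bar>real_of_int (N $$ (i, j))\<bar>) = real (mat_size N)" by (simp add: mat_size_def)
        finally show ?thesis using e(2) by simp
      qed
      \<comment> \<open>Only the distance of z from the line is controlled, not its position along
        the line; m is a sufficient number of rounding steps.\<close>
      obtain m where m: "2 * (\<bar>s0 / \<beta> ^ n\<bar> * (\<Sum>i<d. \<bar>v i\<bar>)) < \<beta> ^ m"
        using real_arch_pow[OF \<beta>] by blast
      have "\<bar>s0 / \<beta> ^ n * v i\<bar> < \<beta> ^ m / 2" if "i < d" for i
      proof -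
        have "\<bar>s0 / \<beta> ^ n\<bar> * \<bar>v i\<bar> \<le> \<bar>s0 / \<beta> ^ n\<bar> * (\<Sum>i<d. \<bar>v i\<bar>)"
          using that by (intro mult_left_mono member_le_sum[of i "{..<d}" "\<lambda>i. \<bar>v i\<bar>"]) auto
        then show ?thesis using m unfolding abs_mult by linarith
      qed
      then obtain w where w: "w \<in> lists (box (1 + mat_size M))" "Q w = z"
        using near_line_value[OF _ zc near] by blast
      have w\<rho>: "w \<in> lists (box \<rho>)" using w(1) lists_mono[OF int_box_mono[OF \<rho>]] by blast
      have "M ^\<^sub>m n *\<^sub>v z = z0"
        unfolding z_def using assoc_mult_mat_vec[OF pow_M_carrier[of n] N(1) z0c] N(2) z0c by simp
      then have "y = Q ((u @ replicate k (0\<^sub>v d)) @ w)"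
        using Qw[OF lists_box[OF w\<rho>], of k] w(2) yz0 by (simp add: n_def)
      moreover have "(u @ replicate k (0\<^sub>v d)) @ w \<in> hit_words L"
        using univ w\<rho> unfolding universal_def by blast
      ultimately show "y \<in> Q ` L" using y unfolding hit_words_def by simp
    qed
    ultimately show "Q u \<in> proj_interior d P \<pi> (Q ` L)" unfolding proj_interior_def by blast
  qed
qed

end

section \<open>The algorithm\<close>

lemma computable_dec [computable_intros]: "computable A \<Longrightarrow> computable (\<lambda>x. dec (A x))"
  by (rule computable_by_code_comp[where F = dec and G = "\<lambda>n. n"]) (auto intro: rec_fun_proj)

lemma computable_enc [computable_intros]: "computable A \<Longrightarrow> computable (\<lambda>x. enc (A x))"
  by (simp only: computable_enc_iff)

text \<open>The algorithm works on lists of coefficients, which carry a bijective coding;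
  \<open>list_of_vec\<close> relates them to vectors.\<close>

definition dot_list :: "int list \<Rightarrow> int list \<Rightarrow> int" where
  "dot_list x y = sum_list (map (\<lambda>(a, b). a * b) (zip x y))"

definition add_list :: "int list \<Rightarrow> int list \<Rightarrow> int list" where
  "add_list x y = map (\<lambda>(a, b). a + b) (zip x y)"

definition mult_list :: "int list list \<Rightarrow> int list \<Rightarrow> int list" where
  "mult_list Ms y = map (\<lambda>r. dot_list r y) Ms"

definition value_list :: "int list list \<Rightarrow> int list list \<Rightarrow> int list" where
  "value_list Ms u = foldr (\<lambda>a y. add_list a (mult_list Ms y)) u (replicate (length Ms) 0)"

definition size_lists :: "int list list \<Rightarrow> nat" where
  "size_lists xs = nat (sum_list (map (\<lambda>x. sum_list (map abs x)) xs))"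

definition box_list :: "nat \<Rightarrow> nat \<Rightarrow> int list list" where
  "box_list d r = List.n_lists d (map (\<lambda>k. int k + - int r) [0..<2 * r + 1])"

definition small_list :: "nat \<Rightarrow> int list \<Rightarrow> bool" where
  "small_list r x \<longleftrightarrow> (\<forall>a\<in>set x. \<bar>a\<bar> \<le> int r)"

definition radius_list :: "int list list \<Rightarrow> nat \<Rightarrow> nat \<Rightarrow> nat" where
  "radius_list Ms s \<theta> = 2 * (size_lists Ms * \<theta> + s + \<theta>) + 1"

text \<open>The triple holds \<theta> and the elements of \<open>A\<close> and \<open>Z\<close>; the
  length conditions make its lists stand for vectors of the dimension of M.\<close>

definition certificate_list :: "int list list \<Rightarrow> nat \<Rightarrow> nat \<times> int list list \<times> int list list \<Rightarrow> bool" where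
  "certificate_list Ms s c \<longleftrightarrow>
     replicate (length Ms) 0 \<in> set (fst (snd c)) \<and>
     (\<forall>y\<in>set (fst (snd c)). length y = length Ms \<and> small_list (fst c) y) \<and>
     (\<forall>y\<in>set (snd (snd c)). length y = length Ms) \<and>
     (\<forall>y\<in>set (fst (snd c)). \<forall>t\<in>set (box_list (length Ms) s).
        small_list (radius_list Ms s (fst c)) (add_list t (mult_list Ms y)) \<longrightarrow>
        add_list t (mult_list Ms y) \<in> set (fst (snd c)) \<or> add_list t (mult_list Ms y) \<in> set (snd (snd c))) \<and>
     (\<forall>y\<in>set (snd (snd c)). \<forall>t\<in>set (box_list (length Ms) s).
        small_list (radius_list Ms s (fst c)) (add_list t (mult_list Ms y)) \<longrightarrow>
        add_list t (mult_list Ms y) \<in> set (snd (snd c)) \<and>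
        (\<forall>p\<in>set (zip y (add_list t (mult_list Ms y))). 0 < fst p * snd p))"

text \<open>Entries beyond the end of the list are 0.\<close>

definition entry :: "nat \<Rightarrow> nat list \<Rightarrow> nat" where
  "entry i b = foldl (\<lambda>_ y. y) 0 (map snd (filter (\<lambda>p. fst p = i) (zip [0..<length b] b)))"

definition code_alphabet :: "nat list \<Rightarrow> int list list" where
  "code_alphabet b = dec (entry 1 b)"

text \<open>The fold carries the states reachable so far. Entry 3 decodes to a list of codes of
  transitions, in which a transition is looked up by its code.\<close>

definition accepts_list :: "nat list \<Rightarrow> int list list \<Rightarrow> bool" where
  "accepts_list b u \<longleftrightarrow> (\<exists>q\<in>set (foldl (\<lambda>S a. filter (\<lambda>q. \<exists>p\<in>set S. enc [p, enc a, q] \<in> set (dec (entry 3 b) :: nat list))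
      [0..<entry 0 b]) (dec (entry 2 b)) u). q \<in> set (dec (entry 4 b) :: nat list))"

definition nonneg_list :: "int list \<Rightarrow> bool" where
  "nonneg_list x \<longleftrightarrow> (\<forall>a\<in>set x. 0 \<le> a)"

text \<open>One radius for all purposes: it covers the letters, the alphabet of
  \<open>near_line_value\<close> and the requirement of \<open>half_word\<close>.\<close>

definition letter_radius :: "int list list \<Rightarrow> nat list \<Rightarrow> nat" where
  "letter_radius Ms b = 1 + size_lists Ms + size_lists (code_alphabet b)"

text \<open>This is \<open>state_bound\<close> at the certified radius, which is certified for the
  doubled alphabet because differences of letters occur.\<close>

definition bound_list :: "int list list \<Rightarrow> nat list \<Rightarrow> nat \<Rightarrow> nat" where
  "bound_list Ms b \<theta> = 2 ^ (entry 0 b + 2 * (2 * radius_list Ms (2 * letter_radius Ms b) \<theta> + 1) ^ length Ms +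
     Suc (entry 0 b) * (2 * radius_list Ms (2 * letter_radius Ms b) \<theta> + 1) ^ length Ms)"

text \<open>All quantifiers of this test are bounded; \<open>N\<close> replaces both the unknown number of appended zeros
  and the unbounded lengths of the words \<open>w\<close> and \<open>v\<close>.\<close>

definition interior_test :: "int list list \<Rightarrow> nat list \<Rightarrow> nat \<Rightarrow> int list list \<Rightarrow> bool" where
  "interior_test Ms b N u \<longleftrightarrow> accepts_list b u \<and> nonneg_list (value_list Ms u) \<and>
     (\<forall>w\<in>set (words_upto (box_list (length Ms) (letter_radius Ms b)) N).
        nonneg_list (value_list Ms ((u @ replicate N (replicate (length Ms) 0)) @ w)) \<longrightarrow>
        (\<exists>v\<in>set (words_upto (code_alphabet b) (length ((u @ replicate N (replicate (length Ms) 0)) @ w) + N)).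
           accepts_list b v \<and> value_list Ms v = value_list Ms ((u @ replicate N (replicate (length Ms) 0)) @ w)))"

definition nerode_code :: "int list list \<Rightarrow> nat \<Rightarrow> (int list list \<Rightarrow> bool) \<Rightarrow> nat list" where
  "nerode_code As N X =
     [length (words_upto As N), enc As,
      enc (map fst (filter (\<lambda>p. \<forall>w\<in>set (words_upto As N). X w = X (snd p @ w))
         (zip [0..<length (words_upto As N)] (words_upto As N)))),
      enc (concat (map (\<lambda>p. concat (map (\<lambda>a.
         map (\<lambda>q. [fst p, enc a, fst q])
           (filter (\<lambda>q. \<forall>w\<in>set (words_upto As N). X ((snd p @ [a]) @ w) = X (snd q @ w))
              (zip [0..<length (words_upto As N)] (words_upto As N)))) As))
         (zip [0..<length (words_upto As N)] (words_upto As N)))),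
      enc (map fst (filter (\<lambda>p. X (snd p)) (zip [0..<length (words_upto As N)] (words_upto As N))))]"

text \<open>The bound serves unsquared as number of zeros and length bound in the test, and squared
  as word length of the Nerode automaton.\<close>

definition interior_code :: "nat \<times> int list list \<times> int list list \<Rightarrow> int list list \<times> nat list \<Rightarrow> nat list" where
  "interior_code c x = nerode_code (code_alphabet (snd x))
     (bound_list (fst x) (snd x) (fst c) * bound_list (fst x) (snd x) (fst c))
     (interior_test (fst x) (snd x) (bound_list (fst x) (snd x) (fst c)))"

section \<open>Computability of the steps of the algorithm\<close>

lemma decidable_iff [computable_intros]:
  assumes "decidable P" "decidable R"
  shows "decidable (\<lambda>x. P x = R x)"
proof -
  have "decidable (\<lambda>x. (P x \<longrightarrow> R x) \<and> (R x \<longrightarrow> P x))" by (intro computable_intros assms)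
  then show ?thesis by (simp add: iff_conv_conj_imp)
qed

lemma computable_dot_list [computable_intros]:
  "computable A \<Longrightarrow> computable B \<Longrightarrow> computable (\<lambda>x. dot_list (A x) (B x))"
  unfolding dot_list_def by (intro computable_intros)

lemma computable_add_list [computable_intros]:
  "computable A \<Longrightarrow> computable B \<Longrightarrow> computable (\<lambda>x. add_list (A x) (B x))"
  unfolding add_list_def by (intro computable_intros)

lemma computable_mult_list [computable_intros]:
  assumes "computable A" "computable B"
  shows "computable (\<lambda>x. mult_list (A x) (B x))"
  unfolding mult_list_def by (intro computable_intros assms computable_comp[OF assms(2)])

lemma computable_value_list [computable_intros]:
  assumes "computable A" "computable B"
  shows "computable (\<lambda>x. value_list (A x) (B x))"
  unfolding value_list_def by (intro computable_intros assms computable_comp[OF assms(1)])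

lemma computable_size_lists [computable_intros]:
  "computable A \<Longrightarrow> computable (\<lambda>x. size_lists (A x))"
  unfolding size_lists_def by (intro computable_intros)

lemma computable_box_list [computable_intros]:
  assumes "computable A" "computable B"
  shows "computable (\<lambda>x. box_list (A x) (B x))"
  unfolding box_list_def by (intro computable_intros assms computable_comp[OF assms(2)])

lemma decidable_small_list [computable_intros]:
  assumes "computable A" "computable B"
  shows "decidable (\<lambda>x. small_list (A x) (B x))"
  unfolding small_list_def by (intro computable_intros assms computable_comp[OF assms(1)])

lemma computable_radius_list [computable_intros]:
  "computable A \<Longrightarrow> computable B \<Longrightarrow> computable C \<Longrightarrow> computable (\<lambda>x. radius_list (A x) (B x) (C x))"
  unfolding radius_list_def by (intro computable_intros)

lemma decidable_certificate_list [computable_intros]: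
  assumes "computable A" "computable B" "computable C"
  shows "decidable (\<lambda>x. certificate_list (A x) (B x) (C x))"
  unfolding certificate_list_def
  by (intro computable_intros assms computable_comp[OF assms(1)] computable_comp[OF assms(2)] computable_comp[OF assms(3)])

lemma computable_entry [computable_intros]: "computable A \<Longrightarrow> computable (\<lambda>x. entry i (A x))"
  unfolding entry_def by (intro computable_intros)

lemma computable_code_alphabet [computable_intros]: "computable A \<Longrightarrow> computable (\<lambda>x. code_alphabet (A x))"
  unfolding code_alphabet_def by (intro computable_intros)

lemma decidable_accepts_list [computable_intros]:
  assumes "computable A" "computable B"
  shows "decidable (\<lambda>x. accepts_list (A x) (B x))"
  unfolding accepts_list_def by (intro computable_intros assms computable_comp[OF assms(1)])

lemma decidable_nonneg_list [computable_intros]: "computable A \<Longrightarrow> decidable (\<lambda>x. nonneg_list (A x))"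
  unfolding nonneg_list_def by (intro computable_intros)

lemma computable_letter_radius [computable_intros]:
  "computable A \<Longrightarrow> computable B \<Longrightarrow> computable (\<lambda>x. letter_radius (A x) (B x))"
  unfolding letter_radius_def by (intro computable_intros)

lemma computable_bound_list [computable_intros]:
  "computable A \<Longrightarrow> computable B \<Longrightarrow> computable C \<Longrightarrow> computable (\<lambda>x. bound_list (A x) (B x) (C x))"
  unfolding bound_list_def by (intro computable_intros)

lemma computable_words_upto [computable_intros]:
  assumes "computable A" "computable B"
  shows "computable (\<lambda>x. words_upto (A x) (B x))"
  unfolding words_upto_def by (intro computable_intros assms computable_comp[OF assms(1)])

lemma decidable_interior_test [computable_intros]:
  assumes "computable A" "computable B" "computable C" "computable D"
  shows "decidable (\<lambda>x. interior_test (A x) (B x) (C x) (D x))"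
  unfolding interior_test_def
  by (intro computable_intros assms computable_comp[OF assms(1)] computable_comp[OF assms(2)]
      computable_comp[OF assms(3)] computable_comp[OF assms(4)])

lemma computable_nerode_code:
  assumes A: "computable A" and N: "computable N" and X: "decidable (\<lambda>z. X (fst z) (snd z))"
  shows "computable (\<lambda>x. nerode_code (A x) (N x) (X x))"
proof -
  have X': "decidable (\<lambda>z. X (F z) (G z))" if "computable F" "computable G" for F G
    using decidable_comp[OF X computable_Pair[OF that]] by simp
  show ?thesis unfolding nerode_code_def
    by (intro computable_intros assms X' computable_comp[OF A] computable_comp[OF N])
qed

lemma computable_interior_code [computable_intros]:
  assumes "computable A" "computable B"
  shows "computable (\<lambda>x. interior_code (A x) (B x))"
  unfolding interior_code_def
  by (intro computable_intros computable_nerode_code assms computable_comp[OF assms(1)] computable_comp[OF assms(2)])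

lemma interior_code_recursive:
  "\<exists>f. \<forall>x y. (\<exists>c. certificate_list (dec x) (2 * letter_radius (dec x) (dec y)) (dec c)) \<longrightarrow>
     computes f [x, y] (enc (interior_code
       (dec (LEAST c. certificate_list (dec x) (2 * letter_radius (dec x) (dec y)) (dec c))) (dec x, dec y)))"
proof -
  have "decidable (\<lambda>z. certificate_list (dec (fst (snd z)))
      (2 * letter_radius (dec (fst (snd z))) (dec (snd (snd z)))) (dec (fst z)))"
    by (intro computable_intros)
  moreover have "computable (\<lambda>z. interior_code (dec (fst z)) (dec (fst (snd z)), dec (snd (snd z))))"
    by (intro computable_intros)
  ultimately show ?thesis
    using computable_partial_Least[of "\<lambda>c z. certificate_list (dec (fst z))
        (2 * letter_radius (dec (fst z)) (dec (snd z))) (dec c)"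
      "\<lambda>c z. interior_code (dec c) (dec (fst z), dec (snd z))"] by simp
qed

section \<open>Codes of matrices and automata\<close>

lemma list_of_vec_eq_iff [simp]: "list_of_vec x = list_of_vec y \<longleftrightarrow> x = y"
  by (metis vec_list)

lemma vec_code_enc: "vec_code x = enc (list_of_vec x)"
  by (simp add: vec_code_def enc_list_def enc_int_def)

lemma enc_nat_list: "enc (xs :: nat list) = list_encode xs"
proof -
  have "map enc xs = xs" by (rule map_idI) simp
  then show ?thesis by (simp add: enc_list_def)
qed

lemma list_encode_vec_codes: "list_encode (map vec_code xs) = enc (map list_of_vec xs)"
  unfolding enc_list_def[of "map list_of_vec xs"] map_map comp_def vec_code_enc ..

lemma mat_code_enc: "mat_code M = enc (map list_of_vec (rows M))"
  unfolding mat_code_def by (rule list_encode_vec_codes)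

definition automaton_entries :: "int vec automaton \<Rightarrow> nat list" where
  "automaton_entries B = [num_states B, enc (map list_of_vec (alphabet B)), enc (initials B),
     enc (map (\<lambda>(p, a, q). [p, enc (list_of_vec a), q]) (transitions B)), enc (finals B)]"

lemma automaton_code_enc: "automaton_code B = enc (automaton_entries B)"
proof -
  have "enc (map (\<lambda>(p, a, q). [p, enc (list_of_vec a), q]) (transitions B)) =
      list_encode (map (\<lambda>(p, a, q). list_encode [p, vec_code a, q]) (transitions B))"
    unfolding enc_list_def[of "map _ (transitions B)"] map_map
    by (intro arg_cong[where f = list_encode] map_cong)
      (auto simp: enc_nat_list vec_code_enc simp del: list_encode.simps)
  then show ?thesis
    by (simp only: automaton_entries_def automaton_code_def enc_nat_list list_encode_vec_codes)
qed

lemma entry_simps: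
  "entry 0 [a0, a1, a2, a3, a4] = a0" "entry 1 [a0, a1, a2, a3, a4] = a1" "entry 2 [a0, a1, a2, a3, a4] = a2"
  "entry 3 [a0, a1, a2, a3, a4] = a3" "entry 4 [a0, a1, a2, a3, a4] = a4"
  by (simp_all add: entry_def upt_rec)

lemma code_alphabet_entries: "code_alphabet (automaton_entries B) = map list_of_vec (alphabet B)"
  by (simp add: code_alphabet_def automaton_entries_def entry_simps[unfolded One_nat_def])

lemma accepts_list_iff:
  assumes B: "automaton_over \<Sigma> B"
  shows "accepts_list (automaton_entries B) (map list_of_vec u) \<longleftrightarrow> u \<in> recognized B"
proof -
  let ?T = "map (\<lambda>(p, a, q). [p, enc (list_of_vec a), q]) (transitions B)"
  let ?step = "\<lambda>S a. filter (\<lambda>q. \<exists>p\<in>set S. enc [p, enc a, q] \<in> set (dec (enc ?T) :: nat list)) [0..<num_states B]"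
  have trans: "enc [p, enc (list_of_vec a), q] \<in> set (dec (enc ?T) :: nat list) \<longleftrightarrow> (p, a, q) \<in> set (transitions B)" for p a q
  proof -
    have "enc ?T = enc (map enc ?T)" unfolding enc_list_def[of ?T] enc_nat_list ..
    then have "(dec (enc ?T) :: nat list) = map enc ?T" by (simp only: dec_enc)
    moreover have "enc x \<in> set (map enc xs) \<longleftrightarrow> x \<in> set xs" for x :: "nat list" and xs by auto
    ultimately have "enc [p, enc (list_of_vec a), q] \<in> set (dec (enc ?T) :: nat list) \<longleftrightarrow>
        [p, enc (list_of_vec a), q] \<in> set ?T" by (simp only:)
    also have "\<dots> \<longleftrightarrow> (p, a, q) \<in> set (transitions B)" by force
    finally show ?thesis .
  qed
  have step: "q \<in> set (foldl ?step S (map list_of_vec u)) \<longleftrightarrow> (\<exists>p\<in>set S. path (set (transitions B)) p u q)" for q S u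
  proof (induction u arbitrary: S)
    case (Cons a u)
    have "r \<in> set (?step S (list_of_vec a)) \<longleftrightarrow> (\<exists>p\<in>set S. (p, a, r) \<in> set (transitions B))" for r
      using B unfolding set_filter mem_Collect_eq trans by (auto simp: automaton_over_def)
    then show ?case using Cons[of "?step S (list_of_vec a)"] by (simp del: set_filter) blast
  qed simp
  have "accepts_list (automaton_entries B) (map list_of_vec u) \<longleftrightarrow>
      (\<exists>q\<in>set (foldl ?step (initials B) (map list_of_vec u)). q \<in> set (finals B))"
    unfolding accepts_list_def automaton_entries_def entry_simps dec_enc[of "initials B"] dec_enc[of "finals B"] ..
  also have "\<dots> \<longleftrightarrow> u \<in> recognized B"
    unfolding recognized_def mem_Collect_eq Bex_def[of "set (foldl _ _ _)"] step by blast
  finally show ?thesis .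
qed

lemma map_words_upto: "words_upto (map f As) N = map (map f) (words_upto As N)"
proof -
  have "List.n_lists n (map f As) = map (map f) (List.n_lists n As)" for n
    by (induction n) (simp_all add: map_concat comp_def)
  then show ?thesis by (simp add: words_upto_def map_concat comp_def)
qed

text \<open>The two constructions run through the same lists in the same order, so the output is
  literally the code of an automaton. Agreement of the predicates on words over \<open>As\<close>
  suffices, since all words inspected are concatenations of such words.\<close>

lemma nerode_code_entries:
  fixes As :: "int vec list"
  assumes X: "\<And>w. w \<in> lists (set As) \<Longrightarrow> Y (map list_of_vec w) \<longleftrightarrow> X w"
  shows "nerode_code (map list_of_vec As) N Y = automaton_entries (nerode_automaton As N X)"
proof -
  let ?f = "list_of_vec :: int vec \<Rightarrow> int list"
  define W where "W = words_upto As N"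
  have W: "w \<in> lists (set As)" if "w \<in> set W" for w using that by (simp add: W_def set_words_upto)
  have W': "words_upto (map ?f As) N = map (map ?f) W" by (simp add: W_def map_words_upto)
  define E where "E = zip [0..<length W] W"
  have E_snd: "snd p \<in> lists (set As)" if "p \<in> set E" for p
    using set_zip_rightD[of "fst p" "snd p" "[0..<length W]" W] that W unfolding E_def by simp
  have zipf: "zip [0..<length (map (map ?f) W)] (map (map ?f) W) = map (\<lambda>p. (fst p, map ?f (snd p))) E"
    by (simp add: E_def zip_map2 case_prod_beta)
  have enum: "List.enumerate 0 W = E" by (simp add: E_def enumerate_eq_zip)
  have Xa: "Y (map ?f u @ map ?f w) = X (u @ w)" if "u \<in> lists (set As)" "w \<in> lists (set As)" for u w
    using X[of "u @ w"] that by simp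
  let ?B = "nerode_automaton As N X"
  have ini: "map fst (filter (\<lambda>p. \<forall>w\<in>set (map (map ?f) W). Y w = Y (snd p @ w)) (map (\<lambda>p. (fst p, map ?f (snd p))) E))
      = initials ?B"
  proof -
    have "filter (\<lambda>p. \<forall>w\<in>set W. Y (map ?f w) = Y (map ?f (snd p) @ map ?f w)) E =
        filter (\<lambda>p. \<forall>w\<in>set W. X w = X (snd p @ w)) E"
      by (rule filter_cong) (use X W Xa E_snd in auto)
    then show ?thesis
      unfolding nerode_automaton_def Let_def W_def[symmetric] enum automaton.select_convs
      by (simp add: filter_map comp_def case_prod_unfold)
  qed
  have fin: "map fst (filter (\<lambda>p. Y (snd p)) (map (\<lambda>p. (fst p, map ?f (snd p))) E)) = finals ?B"
  proof -
    have "filter (\<lambda>p. Y (map ?f (snd p))) E = filter (\<lambda>p. X (snd p)) E"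
      by (rule filter_cong) (use X E_snd in auto)
    then show ?thesis
      unfolding nerode_automaton_def Let_def W_def[symmetric] enum automaton.select_convs
      by (simp add: filter_map comp_def case_prod_unfold)
  qed
  have trans: "concat (map (\<lambda>p. concat (map (\<lambda>a. map (\<lambda>q. [fst p, enc a, fst q])
      (filter (\<lambda>q. \<forall>w\<in>set (map (map ?f) W). Y ((snd p @ [a]) @ w) = Y (snd q @ w))
         (map (\<lambda>p. (fst p, map ?f (snd p))) E))) (map ?f As))) (map (\<lambda>p. (fst p, map ?f (snd p))) E)) =
      map (\<lambda>(p, a, q). [p, enc (?f a), q]) (transitions ?B)"
  proof -
    have flt: "filter (\<lambda>q. \<forall>w\<in>set W. Y ((map ?f (snd p) @ [?f a]) @ map ?f w) = Y (map ?f (snd q) @ map ?f w)) E =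
        filter (\<lambda>q. \<forall>w\<in>set W. X ((snd p @ [a]) @ w) = X (snd q @ w)) E" if "p \<in> set E" "a \<in> set As" for p a
    proof (rule filter_cong[OF refl])
      fix q assume q: "q \<in> set E"
      have "snd p @ [a] \<in> lists (set As)" using E_snd[OF that(1)] that(2) by simp
      then have "Y ((map ?f (snd p) @ [?f a]) @ map ?f w) = X ((snd p @ [a]) @ w)" if "w \<in> set W" for w
        using Xa[of "snd p @ [a]" w] W[OF that] by simp
      then show "(\<forall>w\<in>set W. Y ((map ?f (snd p) @ [?f a]) @ map ?f w) = Y (map ?f (snd q) @ map ?f w)) =
          (\<forall>w\<in>set W. X ((snd p @ [a]) @ w) = X (snd q @ w))"
        using Xa[OF E_snd[OF q] W] by auto
    qed
    have "map (\<lambda>(p, a, q). [p, enc (?f a), q]) (transitions ?B) =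
        concat (map (\<lambda>p. concat (map (\<lambda>a. map (\<lambda>q. [fst p, enc (?f a), fst q])
          (filter (\<lambda>q. \<forall>w\<in>set W. X ((snd p @ [a]) @ w) = X (snd q @ w)) E)) As)) E)"
      unfolding nerode_automaton_def Let_def W_def[symmetric] enum automaton.select_convs
      by (simp add: map_concat comp_def case_prod_unfold)
    also have "\<dots> = concat (map (\<lambda>p. concat (map (\<lambda>a. map (\<lambda>q. [fst p, enc (?f a), fst q])
          (filter (\<lambda>q. \<forall>w\<in>set W. Y ((map ?f (snd p) @ [?f a]) @ map ?f w) = Y (map ?f (snd q) @ map ?f w)) E)) As)) E)"
      by (intro arg_cong[where f = concat] map_cong refl) (simp only: flt)
    finally show ?thesis by (simp add: filter_map comp_def)
  qed
  show ?thesis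
    unfolding nerode_code_def automaton_entries_def W' zipf ini fin trans
    by (simp add: num_states_nerode alphabet_nerode W_def)
qed

section \<open>Correctness of the list computations\<close>

context int_matrix
begin

abbreviation "rows_list \<equiv> map list_of_vec (rows M)"

lemma length_rows_list [simp]: "length rows_list = d"
  by simp

lemma mult_list_rows: "y \<in> carrier_vec d \<Longrightarrow> mult_list rows_list (list_of_vec y) = list_of_vec (M *\<^sub>v y)"
proof (rule nth_equalityI)
  assume y: "y \<in> carrier_vec d"
  show "length (mult_list rows_list (list_of_vec y)) = length (list_of_vec (M *\<^sub>v y))" by (simp add: mult_list_def)
  fix i assume "i < length (mult_list rows_list (list_of_vec y))"
  then have i: "i < d" by (simp add: mult_list_def)
  have "mult_list rows_list (list_of_vec y) ! i = dot_list (list_of_vec (row M i)) (list_of_vec y)"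
    using i by (simp add: mult_list_def)
  also have "\<dots> = (\<Sum>j<d. M $$ (i, j) * y $ j)"
    using y i by (simp add: dot_list_def sum_list_sum_nth list_of_vec_index atLeast0LessThan)
  also have "\<dots> = list_of_vec (M *\<^sub>v y) ! i" using i y by (simp add: list_of_vec_index index_mult_M)
  finally show "mult_list rows_list (list_of_vec y) ! i = list_of_vec (M *\<^sub>v y) ! i" .
qed

lemma add_list_of_vec:
  "x \<in> carrier_vec d \<Longrightarrow> y \<in> carrier_vec d \<Longrightarrow> add_list (list_of_vec x) (list_of_vec y) = list_of_vec (x + y)"
  by (rule nth_equalityI) (auto simp: add_list_def list_of_vec_index)

lemma value_list_rows: "u \<in> lists (carrier_vec d) \<Longrightarrow> value_list rows_list (map list_of_vec u) = list_of_vec (Q u)"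
proof (induction u)
  case Nil
  then show ?case by (simp add: value_list_def)
next
  case (Cons a u)
  have "value_list rows_list (map list_of_vec (a # u)) =
      add_list (list_of_vec a) (mult_list rows_list (value_list rows_list (map list_of_vec u)))"
    by (simp add: value_list_def)
  also have "\<dots> = list_of_vec (a + M *\<^sub>v Q u)"
    using Cons by (simp add: mult_list_rows add_list_of_vec)
  finally show ?case using Cons by (simp add: Q_Cons)
qed

lemma size_lists_rows: "size_lists rows_list = mat_size M"
proof -
  have "sum_list (map (\<lambda>x. sum_list (map abs x)) rows_list) = (\<Sum>i<d. \<Sum>j<d. \<bar>M $$ (i, j)\<bar>)"
    by (simp add: sum_list_sum_nth atLeast0LessThan list_of_vec_index)
  also have "\<dots> = int (mat_size M)" by (simp add: mat_size_def)
  finally show ?thesis by (simp add: size_lists_def)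
qed

lemma set_box_list: "set (box_list d r) = list_of_vec ` box r"
proof -
  have "set (map (\<lambda>k. int k + - int r) [0..<2 * r + 1]) = {- int r..int r}"
  proof (intro equalityI subsetI)
    fix k assume "k \<in> {- int r..int r}"
    then have "k = int (nat (k + int r)) + - int r" "nat (k + int r) < 2 * r + 1" by auto
    then show "k \<in> set (map (\<lambda>k. int k + - int r) [0..<2 * r + 1])" 
      unfolding set_map set_upt by (intro image_eqI[of _ _ "nat (k + int r)"]) auto
  qed auto
  then have "set (box_list d r) = {xs. set xs \<subseteq> {- int r..int r} \<and> length xs = d}"
    unfolding box_list_def set_n_lists by auto
  also have "\<dots> = list_of_vec ` box r"
  proof (intro equalityI subsetI)
    fix xs assume "xs \<in> {xs. set xs \<subseteq> {- int r..int r} \<and> length xs = d}"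
    then have "vec_of_list xs \<in> box r" unfolding in_int_box_iff_list list_vec .
    then have "list_of_vec (vec_of_list xs) \<in> list_of_vec ` box r" by (rule imageI)
    then show "xs \<in> list_of_vec ` box r" unfolding list_vec .
  next
    fix xs assume "xs \<in> list_of_vec ` box r"
    then show "xs \<in> {xs. set xs \<subseteq> {- int r..int r} \<and> length xs = d}" using in_int_box_iff_list by blast
  qed
  finally show ?thesis .
qed

lemma small_list_iff: "x \<in> carrier_vec d \<Longrightarrow> small_list r (list_of_vec x) \<longleftrightarrow> x \<in> box r"
  unfolding small_list_def all_set_conv_all_nth int_box_def by (simp add: list_of_vec_index)

lemma nonneg_list_iff: "x \<in> carrier_vec d \<Longrightarrow> nonneg_list (list_of_vec x) \<longleftrightarrow> x \<in> nonneg_vecs d"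
  unfolding nonneg_list_def all_set_conv_all_nth nonneg_vecs_def by (simp add: list_of_vec_index)

lemma in_box_size_lists:
  assumes "x \<in> set xs" "x \<in> carrier_vec d"
  shows "x \<in> box (size_lists (map list_of_vec xs))"
proof -
  have "\<bar>x $ i\<bar> \<le> int (size_lists (map list_of_vec xs))" if "i < d" for i
  proof -
    have "\<bar>x $ i\<bar> \<in> set (map abs (list_of_vec x))"
      using that assms(2) nth_mem[of i "list_of_vec x"] by (auto simp: list_of_vec_index)
    then have "\<bar>x $ i\<bar> \<le> sum_list (map abs (list_of_vec x))" by (rule member_le_sum_list) auto
    also have "\<dots> \<le> sum_list (map (\<lambda>x. sum_list (map abs x)) (map list_of_vec xs))"
      by (rule member_le_sum_list) (use assms(1) in \<open>auto intro!: sum_list_nonneg\<close>)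
    finally show ?thesis unfolding size_lists_def by linarith
  qed
  then show ?thesis using assms(2) by (simp add: int_box_def)
qed

lemma certificate_list_iff:
  assumes A: "set Al = list_of_vec ` A" "A \<subseteq> carrier_vec d" and Z: "set Zl = list_of_vec ` Z" "Z \<subseteq> carrier_vec d"
  shows "certificate_list rows_list s (\<theta>, Al, Zl) \<longleftrightarrow> certificate s \<theta> A Z"
proof -
  have mem: "list_of_vec x \<in> list_of_vec ` S \<longleftrightarrow> x \<in> S" for x and S :: "int vec set" by auto
  have step: "add_list (list_of_vec t) (mult_list rows_list (list_of_vec y)) = list_of_vec (t + M *\<^sub>v y)"
    if "y \<in> carrier_vec d" "t \<in> box s" for y t
    using that int_box_carrier by (simp add: mult_list_rows add_list_of_vec)
  have small: "small_list K (list_of_vec (t + M *\<^sub>v y)) \<longleftrightarrow> t + M *\<^sub>v y \<in> box K"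
    if "y \<in> carrier_vec d" "t \<in> box s" for y t K
    using that int_box_carrier by (intro small_list_iff) simp
  have sign: "(\<forall>p\<in>set (zip (list_of_vec y) (list_of_vec (t + M *\<^sub>v y))). 0 < fst p * snd p) \<longleftrightarrow> same_sign d y (t + M *\<^sub>v y)"
    if "y \<in> carrier_vec d" "t \<in> box s" for y t
    unfolding all_set_conv_all_nth same_sign_def using that by (simp add: list_of_vec_index)
  have rad: "radius_list rows_list s \<theta> = cert_radius s \<theta>"
    by (simp add: radius_list_def cert_radius_def size_lists_rows)
  have zero: "replicate d 0 = list_of_vec (0\<^sub>v d :: int vec)" by simp
  have boxA: "(\<forall>y\<in>A. dim_vec y = d \<and> small_list \<theta> (list_of_vec y)) \<longleftrightarrow> A \<subseteq> box \<theta>"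
  proof -
    have "dim_vec y = d" "small_list \<theta> (list_of_vec y) \<longleftrightarrow> y \<in> box \<theta>" if "y \<in> A" for y
      using small_list_iff[of y] A(2) that by auto
    then show ?thesis unfolding subset_eq by (intro ball_cong refl) simp
  qed
  have dimZ: "\<forall>y\<in>Z. dim_vec y = d" using Z(2) by auto
  have c1: "(\<forall>y\<in>A. \<forall>t\<in>box s. small_list K (add_list (list_of_vec t) (mult_list rows_list (list_of_vec y))) \<longrightarrow>
      add_list (list_of_vec t) (mult_list rows_list (list_of_vec y)) \<in> list_of_vec ` A \<or>
      add_list (list_of_vec t) (mult_list rows_list (list_of_vec y)) \<in> list_of_vec ` Z) \<longleftrightarrow>
      (\<forall>y\<in>A. \<forall>t\<in>box s. t + M *\<^sub>v y \<in> box K \<longrightarrow> t + M *\<^sub>v y \<in> A \<union> Z)" for K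
    by (intro ball_cong refl) (use A(2) in \<open>simp add: step small mem subset_iff\<close>)
  have c2: "(\<forall>y\<in>Z. \<forall>t\<in>box s. small_list K (add_list (list_of_vec t) (mult_list rows_list (list_of_vec y))) \<longrightarrow>
      add_list (list_of_vec t) (mult_list rows_list (list_of_vec y)) \<in> list_of_vec ` Z \<and>
      (\<forall>p\<in>set (zip (list_of_vec y) (add_list (list_of_vec t) (mult_list rows_list (list_of_vec y)))). 0 < fst p * snd p)) \<longleftrightarrow>
      (\<forall>y\<in>Z. \<forall>t\<in>box s. t + M *\<^sub>v y \<in> box K \<longrightarrow> t + M *\<^sub>v y \<in> Z \<and> same_sign d y (t + M *\<^sub>v y))" for K
    by (intro ball_cong refl) (use Z(2) in \<open>simp add: step small mem sign subset_iff\<close>)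
  show ?thesis
    unfolding certificate_list_def certificate_def length_rows_list fst_conv snd_conv A(1) Z(1) set_box_list rad zero mem
      ball_simps length_list_of_vec c1 c2 boxA using dimZ by simp
qed

lemma interior_test_iff:
  assumes K: "escape_radius (2 * r) K" and "0 < d" and B: "automaton_over \<Sigma> B" and \<Sigma>: "\<Sigma> \<subseteq> box r"
    and N: "state_bound (num_states B) ((2 * K + 1) ^ d) \<le> N"
    and r: "r = letter_radius rows_list (automaton_entries B)" and u: "u \<in> lists (carrier_vec d)"
  shows "interior_test rows_list (automaton_entries B) N (map list_of_vec u) \<longleftrightarrow>
    u \<in> universal_words r N (recognized B)"
proof (cases "u \<in> recognized B")
  case False
  then show ?thesis by (simp add: interior_test_def universal_words_def accepts_list_iff[OF B])
next
  \<comment> \<open>Membership in the language places the letters of u in the box, as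
    \<open>universal_bounded\<close> requires.\<close>
  case True
  have L: "recognized B \<subseteq> lists (box r)" using recognized_lists[OF B] lists_mono[OF \<Sigma>] by blast
  let ?u = "u @ replicate N (0\<^sub>v d)"
  have u0: "?u \<in> lists (box r)" using True L by (auto simp: in_lists_conv_set)
  have uw: "(map list_of_vec u @ replicate N (replicate d 0)) @ map list_of_vec w = map list_of_vec (?u @ w)" for w :: "int vec list"
    by simp
  have inner: "(nonneg_list (value_list rows_list ((map list_of_vec u @ replicate N (replicate d 0)) @ map list_of_vec w)) \<longrightarrow>
      (\<exists>v\<in>set (words_upto (map list_of_vec (alphabet B)) (length ((map list_of_vec u @ replicate N (replicate d 0)) @ map list_of_vec w) + N)).
        accepts_list (automaton_entries B) v \<and>
        value_list rows_list v = value_list rows_list ((map list_of_vec u @ replicate N (replicate d 0)) @ map list_of_vec w))) \<longleftrightarrow>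
      (Q (?u @ w) \<in> nonneg_vecs d \<longrightarrow> (\<exists>v\<in>recognized B. length v \<le> length (?u @ w) + N \<and> Q v = Q (?u @ w)))"
    if w: "w \<in> lists (box r)" for w
  proof -
    have uwc: "?u @ w \<in> lists (carrier_vec d)" using lists_box[OF u0] lists_box[OF w] by simp
    have val: "value_list rows_list (map list_of_vec (?u @ w)) = list_of_vec (Q (?u @ w))" by (rule value_list_rows[OF uwc])
    have nn: "nonneg_list (list_of_vec (Q (?u @ w))) \<longleftrightarrow> Q (?u @ w) \<in> nonneg_vecs d"
      by (rule nonneg_list_iff[OF Q_carrier[OF uwc]])
    have alpha: "set (alphabet B) = \<Sigma>" using B by (simp add: automaton_over_def)
    have ex: "(\<exists>v\<in>set (words_upto (map list_of_vec (alphabet B)) m). accepts_list (automaton_entries B) v \<and>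
        value_list rows_list v = list_of_vec x) \<longleftrightarrow> (\<exists>v\<in>recognized B. length v \<le> m \<and> Q v = x)" for m x
    proof -
      have "(\<exists>v\<in>set (words_upto (map list_of_vec (alphabet B)) m). accepts_list (automaton_entries B) v \<and>
        value_list rows_list v = list_of_vec x) \<longleftrightarrow>
        (\<exists>v\<in>set (words_upto (alphabet B) m). v \<in> recognized B \<and> value_list rows_list (map list_of_vec v) = list_of_vec x)"
        by (simp add: map_words_upto accepts_list_iff[OF B])
      also have "\<dots> \<longleftrightarrow> (\<exists>v\<in>recognized B. length v \<le> m \<and> value_list rows_list (map list_of_vec v) = list_of_vec x)"
        unfolding set_words_upto alpha using recognized_lists[OF B] by blast
      also have "\<dots> \<longleftrightarrow> (\<exists>v\<in>recognized B. length v \<le> m \<and> Q v = x)"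
        using value_list_rows[OF lists_box] L by (intro bex_cong refl) (metis list_of_vec_eq_iff subsetD)
      finally show ?thesis .
    qed
    have len: "length (map list_of_vec (?u @ w)) = length (?u @ w)" by simp
    show ?thesis unfolding uw val nn ex len ..
  qed
  have ball: "(\<forall>w\<in>set (words_upto (box_list d r) N). F w) \<longleftrightarrow> (\<forall>w\<in>lists (box r). length w \<le> N \<longrightarrow> F (map list_of_vec w))" for F
    unfolding set_words_upto set_box_list lists_image
  proof (intro iffI ballI impI)
    fix w assume *: "\<forall>w\<in>{w \<in> map list_of_vec ` lists (box r). length w \<le> N}. F w"
      and w: "w \<in> lists (box r)" "length w \<le> N"
    have "map list_of_vec w \<in> map list_of_vec ` lists (box r)" by (rule imageI[OF w(1)])
    then show "F (map list_of_vec w)" using * w(2) by simp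
  next
    fix x assume *: "\<forall>w\<in>lists (box r). length w \<le> N \<longrightarrow> F (map list_of_vec w)"
      and x: "x \<in> {w \<in> map list_of_vec ` lists (box r). length w \<le> N}"
    from x obtain w where w: "w \<in> lists (box r)" "x = map list_of_vec w" by blast
    then show "F x" using * x by simp
  qed
  have "interior_test rows_list (automaton_entries B) N (map list_of_vec u) \<longleftrightarrow>
      Q u \<in> nonneg_vecs d \<and> universal (box r) (hit_words (recognized B)) ?u"
    unfolding interior_test_def accepts_list_iff[OF B] value_list_rows[OF u] nonneg_list_iff[OF Q_carrier[OF u]]
      r[symmetric] length_rows_list ball code_alphabet_entries universal_bounded[OF K \<open>0 < d\<close> B \<Sigma> u0 N]
    using True inner by (simp only: simp_thms) blast
  then show ?thesis using True by (simp add: universal_words_def)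
qed

end

text \<open>The first claim makes the search terminate. The second holds for every certificate, so
  the search may stop at the first one. The automaton is fixed before \<beta>, P and \<pi> are
  chosen, because \<open>interior_iff\<close> describes interior words without them.\<close>

lemma interior_automaton:
  assumes M: "irreducible_pisot_unimodular d M" and \<Sigma>: "\<Sigma> \<subseteq> carrier_vec d" and B: "automaton_over \<Sigma> B"
  defines "Ms \<equiv> map list_of_vec (rows M)" and "b \<equiv> automaton_entries B"
  shows "\<exists>c. certificate_list Ms (2 * letter_radius Ms b) (dec c)"
    and "certificate_list Ms (2 * letter_radius Ms b) c \<Longrightarrow>
      \<exists>B'. interior_code c (Ms, b) = automaton_entries B' \<and> automaton_over \<Sigma> B' \<and>
        (\<forall>\<beta> P \<pi>. maximal_eigenvalue M \<beta> \<and> hyperplane d P \<and> projection_along d P (eigenspace d M \<beta>) \<pi>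
           \<longrightarrow> recognized B' = interior_language d M P \<pi> (recognized B))"
proof -
  have Mc: "M \<in> carrier_mat d d" using M by (simp add: irreducible_pisot_unimodular_def)
  interpret int_matrix d M by standard (rule Mc)
  define r where "r = letter_radius Ms b"
  have alpha: "set (alphabet B) = \<Sigma>" using B by (simp add: automaton_over_def)
  have r: "r = 1 + mat_size M + size_lists (map list_of_vec (alphabet B))"
    by (simp add: r_def Ms_def b_def letter_radius_def size_lists_rows code_alphabet_entries)
  have \<Sigma>r: "\<Sigma> \<subseteq> box r"
  proof
    fix a assume "a \<in> \<Sigma>"
    then have "a \<in> box (size_lists (map list_of_vec (alphabet B)))" using in_box_size_lists alpha \<Sigma> by blast
    then show "a \<in> box r" using int_box_mono[of "size_lists (map list_of_vec (alphabet B))" r d] by (auto simp: r)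
  qed
  obtain \<beta>0 where "maximal_eigenvalue M \<beta>0" using M by (auto simp: irreducible_pisot_unimodular_def)
  then obtain C0 r0 v0 c0 where pis: "pisot_matrix d M \<beta>0 C0 r0 v0 c0" using pisot_spectral[OF M] by blast
  then have d: "0 < d" by (simp add: pisot_matrix_def pisot_matrix_axioms_def)
  show "\<exists>c. certificate_list Ms (2 * letter_radius Ms b) (dec c)"
  proof -
    obtain \<theta> A Z where AZ: "finite A" "finite Z" "Z \<subseteq> carrier_vec d" "certificate (2 * r) \<theta> A Z"
      using pisot_matrix.certificate_exists[OF pis, of "2 * r"] by blast
    obtain Al Zl where l: "set Al = list_of_vec ` A" "set Zl = list_of_vec ` Z"
      using AZ(1,2) finite_list[of "list_of_vec ` A"] finite_list[of "list_of_vec ` Z"] by auto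
    have Ac: "A \<subseteq> carrier_vec d" using AZ(4) int_box_carrier by (auto simp: certificate_def)
    have "certificate_list Ms (2 * r) (\<theta>, Al, Zl)"
      unfolding Ms_def certificate_list_iff[OF l(1) Ac l(2) AZ(3)] by (rule AZ(4))
    then have "certificate_list Ms (2 * letter_radius Ms b) (dec (enc (\<theta>, Al, Zl)))" by (simp add: r_def)
    then show ?thesis by blast
  qed
  assume cert: "certificate_list Ms (2 * letter_radius Ms b) c"
  obtain \<theta> Al Zl where c: "c = (\<theta>, Al, Zl)" by (metis prod_cases3)
  define A Z where "A = vec_of_list ` set Al" and "Z = vec_of_list ` set Zl"
  have lens: "\<And>y. y \<in> set Al \<Longrightarrow> length y = d" "\<And>y. y \<in> set Zl \<Longrightarrow> length y = d"
    using cert unfolding certificate_list_def c Ms_def length_rows_list fst_conv snd_conv by blast+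
  have AZ: "set Al = list_of_vec ` A" "A \<subseteq> carrier_vec d" "set Zl = list_of_vec ` Z" "Z \<subseteq> carrier_vec d"
    unfolding A_def Z_def image_image list_vec image_ident carrier_vec_def
    using lens by (simp_all add: image_subset_iff)
  have "certificate (2 * r) \<theta> A Z"
    using cert certificate_list_iff[OF AZ, of "2 * r" \<theta>] unfolding c Ms_def r_def by simp
  moreover have "mat_size M + 1 \<le> 2 * r" using r by simp
  ultimately have K: "escape_radius (2 * r) (cert_radius (2 * r) \<theta>)" by (rule certificate_sound)
  let ?K = "cert_radius (2 * r) \<theta>" and ?L = "recognized B"
  define N where "N = state_bound (num_states B) ((2 * ?K + 1) ^ d)"
  have bound: "bound_list Ms b \<theta> = N"
    unfolding bound_list_def r_def[symmetric] N_def state_bound_def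
    by (simp add: Ms_def b_def automaton_entries_def entry_simps radius_list_def cert_radius_def size_lists_rows)
  have \<Sigma>c: "lists (set (alphabet B)) \<subseteq> lists (carrier_vec d)" unfolding alpha by (rule lists_mono[OF \<Sigma>])
  define B' where "B' = nerode_automaton (alphabet B) (N * N) (\<lambda>w. w \<in> universal_words r N ?L)"
  have code: "interior_code c (Ms, b) = automaton_entries B'"
    unfolding interior_code_def c fst_conv snd_conv bound B'_def
    unfolding b_def code_alphabet_entries
  proof (rule nerode_code_entries)
    fix w assume "w \<in> lists (set (alphabet B))"
    then have "w \<in> lists (carrier_vec d)" using \<Sigma>c by blast
    then show "interior_test Ms (automaton_entries B) N (map list_of_vec w) \<longleftrightarrow> w \<in> universal_words r N ?L"
      unfolding Ms_def by (intro interior_test_iff[OF K d B \<Sigma>r]) (simp_all add: N_def r_def Ms_def b_def)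
  qed
  have over: "automaton_over \<Sigma> B'" unfolding B'_def alpha[symmetric] by (rule automaton_over_nerode)
  have "universal_words r N ?L \<subseteq> lists (set (alphabet B))"
    unfolding alpha universal_words_def using recognized_lists[OF B] by blast
  moreover have "index_le (set (alphabet B)) (universal_words r N ?L) N"
    unfolding alpha N_def by (rule index_le_universal_words[OF K d B \<Sigma>r])
  ultimately have rec: "recognized B' = universal_words r N ?L"
    unfolding B'_def by (rule recognized_nerode) simp
  have "recognized B' = interior_language d M P \<pi> ?L"
    if \<beta>: "maximal_eigenvalue M \<beta>" and P: "hyperplane d P" and \<pi>: "projection_along d P (eigenspace d M \<beta>) \<pi>" for \<beta> P \<pi>
  proof -
    obtain C r1 v1 c1 where "pisot_matrix d M \<beta> C r1 v1 c1" using pisot_spectral[OF M \<beta>] by blast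
    then interpret p: pisot_matrix d M \<beta> C r1 v1 c1 .
    have L: "?L \<subseteq> lists (box r)" using recognized_lists[OF B] lists_mono[OF \<Sigma>r] by blast
    have r1: "1 + mat_size M \<le> r" using r by simp
    have "recognized B' = {u \<in> ?L. Q u \<in> nonneg_vecs d \<and>
       (\<exists>k. universal (box r) (hit_words ?L) (u @ replicate k (0\<^sub>v d)))}"
      unfolding rec by (rule universal_words_eq[OF K d B \<Sigma>r]) (simp add: N_def)
    also have "\<dots> = interior_language d M P \<pi> ?L"
      unfolding interior_language_def using p.interior_iff[OF P \<pi> L r1] by (intro Collect_cong conj_cong refl) simp
    finally show ?thesis .
  qed
  then show "\<exists>B'. interior_code c (Ms, b) = automaton_entries B' \<and> automaton_over \<Sigma> B' \<and>
        (\<forall>\<beta> P \<pi>. maximal_eigenvalue M \<beta> \<and> hyperplane d P \<and> projection_along d P (eigenspace d M \<beta>) \<pi>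
           \<longrightarrow> recognized B' = interior_language d M P \<pi> (recognized B))"
    using code over by blast
qed

theorem theorem5p12:
  shows
    "(\<forall>d M \<beta> P \<pi> \<Sigma> L.
        irreducible_pisot_unimodular d M \<and> maximal_eigenvalue M \<beta> \<and>
        hyperplane d P \<and> projection_along d P (eigenspace d M \<beta>) \<pi> \<and>
        finite \<Sigma> \<and> \<Sigma> \<subseteq> carrier_vec d \<and> regular_language \<Sigma> L
        \<longrightarrow> regular_language \<Sigma> (interior_language d M P \<pi> L) \<and>
            word_value M ` interior_language d M P \<pi> L = proj_interior d P \<pi> (word_value M ` L))
     \<and>
     (\<exists>f. \<forall>d M \<Sigma> B.
        irreducible_pisot_unimodular d M \<and>
        finite \<Sigma> \<and> \<Sigma> \<subseteq> carrier_vec d \<and> automaton_over \<Sigma> B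
        \<longrightarrow> (\<exists>B'. computes f [mat_code M, automaton_code B] (automaton_code B') \<and>
                 automaton_over \<Sigma> B' \<and>
                 (\<forall>\<beta> P \<pi>. maximal_eigenvalue M \<beta> \<and>
                    hyperplane d P \<and> projection_along d P (eigenspace d M \<beta>) \<pi>
                    \<longrightarrow> recognized B' = interior_language d M P \<pi> (recognized B))))"
proof (intro conjI allI impI)
  fix d M \<beta> P \<pi> and \<Sigma> :: "int vec set" and L
  assume asm: "irreducible_pisot_unimodular d M \<and> maximal_eigenvalue M \<beta> \<and>
        hyperplane d P \<and> projection_along d P (eigenspace d M \<beta>) \<pi> \<and>
        finite \<Sigma> \<and> \<Sigma> \<subseteq> carrier_vec d \<and> regular_language \<Sigma> L"
  then obtain B where B: "automaton_over \<Sigma> B" "recognized B = L" by (auto simp: regular_language_def)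
  let ?Ms = "map list_of_vec (rows M)" and ?b = "automaton_entries B"
  obtain c where "certificate_list ?Ms (2 * letter_radius ?Ms ?b) (dec c)"
    using interior_automaton(1)[OF _ _ B(1)] asm by blast
  then obtain B' where "automaton_over \<Sigma> B'" "recognized B' = interior_language d M P \<pi> (recognized B)"
    using interior_automaton(2)[OF _ _ B(1)] asm by metis
  then show "regular_language \<Sigma> (interior_language d M P \<pi> L)"
    unfolding regular_language_def B(2) by blast
  \<comment> \<open>Every open set in the union that defines the interior has its preimage inside
    the value set, so each interior point is the value of some word of L, which then belongs to the
    interior language.\<close>
  show "word_value M ` interior_language d M P \<pi> L = proj_interior d P \<pi> (word_value M ` L)"
    unfolding interior_language_def proj_interior_def by blast
next
  obtain f where f: "\<And>x y. \<exists>c. certificate_list (dec x) (2 * letter_radius (dec x) (dec y)) (dec c) \<Longrightarrow>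
     computes f [x, y] (enc (interior_code
       (dec (LEAST c. certificate_list (dec x) (2 * letter_radius (dec x) (dec y)) (dec c))) (dec x, dec y)))"
    using interior_code_recursive by blast
  show "\<exists>f. \<forall>d M \<Sigma> B.
        irreducible_pisot_unimodular d M \<and>
        finite \<Sigma> \<and> \<Sigma> \<subseteq> carrier_vec d \<and> automaton_over \<Sigma> B
        \<longrightarrow> (\<exists>B'. computes f [mat_code M, automaton_code B] (automaton_code B') \<and>
                 automaton_over \<Sigma> B' \<and>
                 (\<forall>\<beta> P \<pi>. maximal_eigenvalue M \<beta> \<and>
                    hyperplane d P \<and> projection_along d P (eigenspace d M \<beta>) \<pi>
                    \<longrightarrow> recognized B' = interior_language d M P \<pi> (recognized B)))"
  proof (intro exI[of _ f] allI impI)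
    fix d M and \<Sigma> :: "int vec set" and B
    assume asm: "irreducible_pisot_unimodular d M \<and> finite \<Sigma> \<and> \<Sigma> \<subseteq> carrier_vec d \<and> automaton_over \<Sigma> B"
    then have M: "irreducible_pisot_unimodular d M" and \<Sigma>: "\<Sigma> \<subseteq> carrier_vec d" and B: "automaton_over \<Sigma> B"
      by blast+
    let ?Ms = "map list_of_vec (rows M)" and ?b = "automaton_entries B"
    let ?P = "\<lambda>c. certificate_list ?Ms (2 * letter_radius ?Ms ?b) (dec c)"
    have ex: "\<exists>c. ?P c" by (rule interior_automaton(1)[OF M \<Sigma> B])
    have "computes f [mat_code M, automaton_code B] (enc (interior_code (dec (LEAST c. ?P c)) (?Ms, ?b)))"
      using f[of "enc ?Ms" "enc ?b"] ex unfolding mat_code_enc automaton_code_enc dec_enc by blast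
    moreover have "?P (LEAST c. ?P c)" by (rule LeastI_ex[OF ex])
    ultimately show "\<exists>B'. computes f [mat_code M, automaton_code B] (automaton_code B') \<and>
                 automaton_over \<Sigma> B' \<and>
                 (\<forall>\<beta> P \<pi>. maximal_eigenvalue M \<beta> \<and>
                    hyperplane d P \<and> projection_along d P (eigenspace d M \<beta>) \<pi>
                    \<longrightarrow> recognized B' = interior_language d M P \<pi> (recognized B))"
      using interior_automaton(2)[OF M \<Sigma> B, of "dec (LEAST c. ?P c)"] unfolding automaton_code_enc by metis
  qed
qed

end
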